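(* (a) If $X$ is a nonempty open subset of an infinite dimensional normed space, then $X$ does not have small sets with respect to $(X,G_X)$. (b) Let $K_{NSML}$ be the class of all space-group pairs $(X,H)$ such that $X$ is a nonempty open subset of an infinite dimensional normed space and $G_X\subseteq H\subseteq H(X)$. Then $K_{NSML}$ is faithful.
   Context: Normed spaces are real. For a topological space $X$, $H(X)$ is the group of all auto-homeomorphisms of $X$. A space-group pair is a pair $(X,G)$ where $X$ is a topological space and $G$ is a subgroup of $H(X)$. A class $K$ of space-group pairs is faithful if for every $(X,G),(Y,H)\in K$ and every group isomorphism $\varphi:G\to H$ there is a homeomorphism $\tau$ from $X$ onto $Y$ such that $\varphi(g)=\tau\circ g\circ\tau^{-1}$ for every $g\in G$. A nonempty open set $U\subseteq X$ is small with respect to $(X,G)$ if for every nonempty open $V\subseteq U$ there is $g\in G$ with $g(U)\subseteq V$. Let $E$ be a normed space. For $x,y\in E$, $[x,y]=\{tx+(1-t)y : t\in[0,1]\}$; $B_E(x,r)$ is the closed ball, and $B_E(A,r)=\bigcup_{x\in A}B_E(x,r)$ for $A\subseteq E$. For a function $g$, $\mathrm{supp}(g)=\{x : g(x)\neq x\}$. A set $\mathcal S$ of subsets of a metric space is separated if for some $r>0$, $d(S,T)>r$ for all distinct $S,T\in\mathcal S$. A one-to-one function $f$ between metric spaces is bilipschitz if $f$ and $f^{-1}$ are Lipschitz, and locally bilipschitz if every point of the domain has an open neighborhood on which $f$ is bilipschitz. A homeomorphism $h\in H(E)$ is basic if there are $x,v\in E$ and $r>0$ such that (1) $\mathrm{supp}(h)\subseteq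 B_E([x,x+v],r)$; (2) for every $z\in E$ there is $\lambda(z)\in\mathbb R$ with $h(z)=z+\lambda(z)v$; (3) $h(x)=x+v$. With such $x,v,r$ fixed for $h$, write $r^h=r$ and $S^h=B_E([x,x+v],r)$. ($\mathrm{Id}$ is basic with $v=0$.) $\widehat G_E$ is the set of all $h\in H(E)$ for which there is a sequence $\{h_i : i\in\mathbb N\}$ of basic homeomorphisms such that: (1) $\{S^{h_i} : i\in\mathbb N\}$ is separated; (2) $h\restriction(E\setminus\bigcup_i S^{h_i})=\mathrm{Id}$ and $h\restriction S^{h_i}=h_i\restriction S^{h_i}$ for every $i$; (3) $\mathrm{supp}(h)$ is bounded; (4) $r^{h_i}=r^{h_j}$ for all $i,j$; (5) $h$ is locally bilipschitz. $G_E$ is the subgroup of $H(E)$ generated by $\widehat G_E$. For a nonempty open $X\subseteq E$, $G_X=\{g\restriction X : g\in G_E \text{ and } g\restriction(E\setminus X)=\mathrm{Id}\}$. *)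

theory Defs
  imports
    "HOL-Analysis.Analysis"
    "HOL-Algebra.Bij"
    "HOL-Algebra.Generated_Groups"
begin

section \<open>Space-group pairs\<close>

text \<open>As in \<^const>\<open>BijGroup\<close>, the elements are extensional functions, so that two group elements
  are equal iff they agree on the points of the space.\<close>

definition homeo_group :: "'a topology \<Rightarrow> ('a \<Rightarrow> 'a) monoid"
  where "homeo_group X = BijGroup (topspace X)
    \<lparr>carrier := {f \<in> Bij (topspace X). homeomorphic_map X X f}\<rparr>"

definition space_group_pair :: "'a topology \<Rightarrow> ('a \<Rightarrow> 'a) set \<Rightarrow> bool"
  where "space_group_pair X G \<longleftrightarrow> subgroup G (homeo_group X)"

text \<open>A class of pairs ranges over spaces with different underlying types, while a HOL set of pairs
  has only one. Hence the relation has two arguments: a class given by a type-polymorphic constant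
  is faithful iff the relation holds between any two of its type instances.\<close>

definition faithful_between ::
    "('a topology \<times> ('a \<Rightarrow> 'a) set) set \<Rightarrow> ('b topology \<times> ('b \<Rightarrow> 'b) set) set \<Rightarrow> bool"
  where "faithful_between K L \<longleftrightarrow>
    (\<forall>(X, G) \<in> K. \<forall>(Y, H) \<in> L.
      \<forall>\<phi> \<in> iso (homeo_group X\<lparr>carrier := G\<rparr>) (homeo_group Y\<lparr>carrier := H\<rparr>).
        \<exists>\<tau> \<tau>'. homeomorphic_maps X Y \<tau> \<tau>' \<and>
          (\<forall>g \<in> G. \<phi> g = (\<lambda>y \<in> topspace Y. \<tau> (g (\<tau>' y)))))"

definition small_set :: "'a topology \<Rightarrow> ('a \<Rightarrow> 'a) set \<Rightarrow> 'a set \<Rightarrow> bool"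
  where "small_set X G U \<longleftrightarrow>
    U \<noteq> {} \<and> openin X U \<and>
    (\<forall>V. V \<noteq> {} \<and> openin X V \<and> V \<subseteq> U \<longrightarrow> (\<exists>g \<in> G. g ` U \<subseteq> V))"


section \<open>Metric notions\<close>

definition cball_around :: "'a::metric_space set \<Rightarrow> real \<Rightarrow> 'a set"
  where "cball_around A r = (\<Union>x\<in>A. cball x r)"

text \<open>The support is not closed up.\<close>

definition supp :: "('a \<Rightarrow> 'a) \<Rightarrow> 'a set"
  where "supp g = {x. g x \<noteq> x}"

text \<open>Applied only to families of nonempty sets, where \<^const>\<open>setdist\<close> is the infimum of the
  distances.\<close>

definition separated_family :: "'a::metric_space set set \<Rightarrow> bool"
  where "separated_family \<S> \<longleftrightarrow>
    (\<exists>r>0. \<forall>S\<in>\<S>. \<forall>T\<in>\<S>. S \<noteq> T \<longrightarrow> setdist S T > r)"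

definition bilipschitz_on :: "'a::metric_space set \<Rightarrow> ('a \<Rightarrow> 'b::metric_space) \<Rightarrow> bool"
  where "bilipschitz_on U f \<longleftrightarrow>
    inj_on f U \<and> (\<exists>C. C-lipschitz_on U f) \<and> (\<exists>D. D-lipschitz_on (f ` U) (inv_into U f))"

definition locally_bilipschitz_on :: "'a::metric_space set \<Rightarrow> ('a \<Rightarrow> 'b::metric_space) \<Rightarrow> bool"
  where "locally_bilipschitz_on S f \<longleftrightarrow>
    inj_on f S \<and> (\<forall>x\<in>S. \<exists>U. openin (top_of_set S) U \<and> x \<in> U \<and> bilipschitz_on U f)"


section \<open>The groups generated by basic homeomorphisms\<close>

definition infinite_dimensional :: "'a::real_vector set \<Rightarrow> bool"
  where "infinite_dimensional V \<longleftrightarrow> \<not> (\<exists>B. finite B \<and> span B = V)"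

definition tube :: "'a::real_normed_vector \<Rightarrow> 'a \<Rightarrow> real \<Rightarrow> 'a set"
  where "tube x v r = cball_around (closed_segment x (x + v)) r"

definition basic_homeo ::
    "('a::real_normed_vector \<Rightarrow> 'a) \<Rightarrow> 'a \<Rightarrow> 'a \<Rightarrow> real \<Rightarrow> bool"
  where "basic_homeo h x v r \<longleftrightarrow>
    h \<in> carrier (homeo_group euclidean) \<and> r > 0 \<and>
    supp h \<subseteq> tube x v r \<and>
    (\<forall>z. \<exists>l::real. h z = z + l *\<^sub>R v) \<and>
    h x = x + v"

text \<open>The data \<open>x i, v i, r i\<close> of the basic homeomorphism \<open>f i\<close> belong to the witness,
  so \<open>tube (x i) (v i) (r i)\<close> is the tube chosen for \<open>f i\<close>.
  The set of tubes, not the indexed family, is separated: repetitions are allowed.\<close>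

definition G_gens :: "('a::real_normed_vector \<Rightarrow> 'a) set"
  where "G_gens = {h \<in> carrier (homeo_group euclidean).
    \<exists>(f :: nat \<Rightarrow> 'a \<Rightarrow> 'a) x v r.
      (\<forall>i. basic_homeo (f i) (x i) (v i) (r i)) \<and>
      separated_family (range (\<lambda>i. tube (x i) (v i) (r i))) \<and>
      (\<forall>z. z \<notin> (\<Union>i. tube (x i) (v i) (r i)) \<longrightarrow> h z = z) \<and>
      (\<forall>i. \<forall>z \<in> tube (x i) (v i) (r i). h z = f i z) \<and>
      bounded (supp h) \<and>
      (\<forall>i j. r i = r j) \<and>
      locally_bilipschitz_on UNIV h}"

definition G_whole :: "('a::real_normed_vector \<Rightarrow> 'a) set"
  where "G_whole = generate (homeo_group euclidean) G_gens"

definition G_on :: "'a::real_normed_vector set \<Rightarrow> ('a \<Rightarrow> 'a) set"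
  where "G_on X = {restrict g X | g. g \<in> G_whole \<and> (\<forall>z. z \<notin> X \<longrightarrow> g z = z)}"

definition K_NSML :: "('a::real_normed_vector topology \<times> ('a \<Rightarrow> 'a) set) set"
  where "K_NSML = {(top_of_set X, H) | X H.
    infinite_dimensional (UNIV :: 'a set) \<and> open X \<and> X \<noteq> {} \<and>
    space_group_pair (top_of_set X) H \<and> G_on X \<subseteq> H}"

end

theory Submission
  imports Defs
begin

text \<open>(b) The inclusion of the support of one homeomorphism in the closure of the support of another is
  definable in the group. A point is then described by a sequence of group elements whose supports
  shrink to it. To exclude all other sequences, suppose that points \<open>y i\<close> of the supports have no
  accumulation point in the space. Then the lines through the \<open>y i\<close> in a fixed direction are locally
  finite, so one basic homeomorphism with a single tube can move infinitely many of the \<open>y i\<close> out of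
  a ball and fix infinitely many others. If every such choice accumulates, the supports shrink to a
  compact set. It has empty interior, and if it had two points, one of them could be pushed off it
  while the other stays fixed.

  (a) Near each point a product of \<open>n\<close> generators and their inverses displaces by vectors of a subspace
  of dimension at most \<open>n\<close>, since separated tubes do not interfere with each other. A map of this kind
  cannot shrink a ball of radius \<open>R\<close> into the concentric ball of radius \<open>R / 10\<close>: on a ball of dimension
  \<open>n + 1\<close> the displacement would approximate \<open>c - z\<close>, contradicting Brouwer's theorem.\<close>

section \<open>Recovering supports from the group\<close>

text \<open>Two features of the setting shape (b). First, \<open>H\<close> may be any group of
  homeomorphisms containing \<open>G_on X\<close>, so that nothing more is known about a general
  element. The elements constructed outright are restrictions of single generators with one tube,
  and every notion is expressed by multiplication alone, so as to pass through an arbitrary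
  isomorphism. Commutation sees an open set only up to closure, so the supports are nested only up
  to closures. Second, the norm may be incomplete: a sequence without accumulation points may be
  Cauchy and then has no separated subsequence. Lines help because only a real parameter has to be
  kept in a compact set. Infinite dimension enters (b) through Riesz's lemma.

  In (a) the number \<open>n\<close> depends on the group element, and the subspace changes from
  place to place without any continuity. Over a compact ball one only knows finitely many boxes of
  dimension \<open>n\<close> that contain all displacements; counting grid points is enough to see
  that such boxes cannot fill a ball of dimension \<open>n + 1\<close>.\<close>

definition commutes :: "('g, 'm) monoid_scheme \<Rightarrow> 'g \<Rightarrow> 'g \<Rightarrow> bool"
  where "commutes M a b \<longleftrightarrow> a \<otimes>\<^bsub>M\<^esub> b = b \<otimes>\<^bsub>M\<^esub> a"

definition group_commutator :: "('g, 'm) monoid_scheme \<Rightarrow> 'g \<Rightarrow> 'g \<Rightarrow> 'g"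
  where "group_commutator M a b = a \<otimes>\<^bsub>M\<^esub> b \<otimes>\<^bsub>M\<^esub> inv\<^bsub>M\<^esub> a \<otimes>\<^bsub>M\<^esub> inv\<^bsub>M\<^esub> b"

definition conjugate :: "('g, 'm) monoid_scheme \<Rightarrow> 'g \<Rightarrow> 'g \<Rightarrow> 'g"
  where "conjugate M g a = g \<otimes>\<^bsub>M\<^esub> a \<otimes>\<^bsub>M\<^esub> inv\<^bsub>M\<^esub> g"

text \<open>This notion of disjointness and its use below follow Belk, Elliott and Matucci's proof of Rubin's
  theorem.\<close>

definition alg_disjoint :: "('g, 'm) monoid_scheme \<Rightarrow> 'g \<Rightarrow> 'g \<Rightarrow> bool"
  where "alg_disjoint M f g \<longleftrightarrow>
    (\<forall>h\<in>carrier M. \<not> commutes M f h \<longrightarrow>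
      (\<exists>f1\<in>carrier M. \<exists>f2\<in>carrier M. commutes M f1 g \<and> commutes M f2 g \<and>
        group_commutator M f1 (group_commutator M f2 h) \<noteq> \<one>\<^bsub>M\<^esub> \<and>
        commutes M (group_commutator M f1 (group_commutator M f2 h)) g))"

text \<open>The exponent is the least common multiple of \<open>1, 2, 3, 4\<close>: a point moved by \<open>g ^ 12\<close> has five
  different images under \<open>1, g, g ^ 2, g ^ 3, g ^ 4\<close>, whereas a double commutator with \<open>h\<close> lives on
  four translates of the support of \<open>h\<close>. For the groups considered, \<open>covers M f k\<close> will mean
  that the support of \<open>k\<close> lies in the closure of the support of \<open>f\<close>.\<close>

definition covers :: "('g, 'm) monoid_scheme \<Rightarrow> 'g \<Rightarrow> 'g \<Rightarrow> bool"
  where "covers M f k \<longleftrightarrow>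
    (\<forall>g\<in>carrier M. alg_disjoint M f g \<longrightarrow> commutes M k (g [^]\<^bsub>M\<^esub> (12::nat)))"

definition apart :: "('g, 'm) monoid_scheme \<Rightarrow> 'g \<Rightarrow> 'g \<Rightarrow> bool"
  where "apart M f k \<longleftrightarrow> (\<forall>m\<in>carrier M. covers M f m \<and> covers M k m \<longrightarrow> m = \<one>\<^bsub>M\<^esub>)"

text \<open>The second condition fails for supports that do not shrink to a point, because \<open>g\<close> can then fix
  some of their points and displace others. The third one transports the sequence into an arbitrarily
  small ball, away from the boundary of the space.\<close>

definition point_seq :: "('g, 'm) monoid_scheme \<Rightarrow> (nat \<Rightarrow> 'g) \<Rightarrow> bool"
  where "point_seq M f \<longleftrightarrow>
    (\<forall>i. f i \<in> carrier M \<and> f i \<noteq> \<one>\<^bsub>M\<^esub> \<and> covers M (f i) (f (Suc i))) \<and>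
    (\<forall>g\<in>carrier M. (\<exists>i. apart M (conjugate M g (f i)) (f i)) \<or>
       (\<forall>i. \<exists>j. covers M (f i) (conjugate M g (f j)))) \<and>
    (\<exists>w\<in>carrier M. w \<noteq> \<one>\<^bsub>M\<^esub> \<and>
       (\<forall>v\<in>carrier M. v \<noteq> \<one>\<^bsub>M\<^esub> \<and> covers M w v \<longrightarrow>
          (\<exists>g\<in>carrier M. \<exists>i. covers M v (conjugate M g (f i)))))"

lemma (in group) group_commutator_closed [simp]:
  "a \<in> carrier G \<Longrightarrow> b \<in> carrier G \<Longrightarrow> group_commutator G a b \<in> carrier G"
  by (simp add: group_commutator_def)

lemma (in group) conjugate_closed [simp]:
  "a \<in> carrier G \<Longrightarrow> b \<in> carrier G \<Longrightarrow> conjugate G a b \<in> carrier G"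
  by (simp add: conjugate_def)

lemma (in group) group_commutator_eq_one:
  assumes "a \<in> carrier G" "b \<in> carrier G"
  shows "group_commutator G a b = \<one> \<longleftrightarrow> commutes G a b"
proof -
  have *: "group_commutator G a b = (a \<otimes> b) \<otimes> inv (b \<otimes> a)"
    using assms by (simp add: group_commutator_def inv_mult_group m_assoc)
  show ?thesis
    unfolding * commutes_def using assms inv_closed inv_solve_right' l_one m_closed
    by (metis r_inv)
qed

text \<open>Elements of \<open>M\<close> carry information only on \<open>X\<close>, whence the
  restriction to points of \<open>X\<close> throughout. \<open>moving\<close> asks for a nontrivial
  twelfth power and not just a nontrivial element, because \<open>covers\<close> tests commutation
  with twelfth powers only.\<close>

locale locally_moving = group M for M :: "('a::t2_space \<Rightarrow> 'a) monoid" (structure) +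
  fixes X :: "'a set"
  assumes open_X: "open X"
    and maps: "\<And>a x. a \<in> carrier M \<Longrightarrow> x \<in> X \<Longrightarrow> a x \<in> X"
    and mult_apply: "\<And>a b x. a \<in> carrier M \<Longrightarrow> b \<in> carrier M \<Longrightarrow> x \<in> X \<Longrightarrow> (a \<otimes> b) x = a (b x)"
    and one_apply: "\<And>x. x \<in> X \<Longrightarrow> \<one> x = x"
    and faithful: "\<And>a. a \<in> carrier M \<Longrightarrow> (\<And>x. x \<in> X \<Longrightarrow> a x = x) \<Longrightarrow> a = \<one>"
    and cont: "\<And>a. a \<in> carrier M \<Longrightarrow> continuous_on X a"
    and moving: "\<And>U. open U \<Longrightarrow> U \<noteq> {} \<Longrightarrow> U \<subseteq> X \<Longrightarrow>
      \<exists>g\<in>carrier M. {x \<in> X. g x \<noteq> x} \<subseteq> U \<and> g [^] (12::nat) \<noteq> \<one>"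
begin

text \<open>\<open>supp\<close> would also see the values off \<open>X\<close>, which mean nothing
  for restricted functions.\<close>

definition mv :: "('a \<Rightarrow> 'a) \<Rightarrow> 'a set"
  where "mv a = {x \<in> X. a x \<noteq> x}"

lemma inv_apply:
  assumes "a \<in> carrier M" "x \<in> X"
  shows "(inv a) (a x) = x" "a ((inv a) x) = x"
  using assms mult_apply[of "inv a" a x] mult_apply[of a "inv a" x] by (auto simp: one_apply)

declare inv_apply(1) [simp]

lemma mv_subset: "mv a \<subseteq> X"
  by (auto simp: mv_def)

lemma fixed_outside_mv: "x \<in> X \<Longrightarrow> x \<notin> mv a \<Longrightarrow> a x = x"
  by (auto simp: mv_def)

lemma inj_apply: "a \<in> carrier M \<Longrightarrow> x \<in> X \<Longrightarrow> y \<in> X \<Longrightarrow> a x = a y \<longleftrightarrow> x = y"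
  by (metis inv_apply(1))

lemma eqI:
  assumes "a \<in> carrier M" "b \<in> carrier M" "\<And>x. x \<in> X \<Longrightarrow> a x = b x"
  shows "a = b"
proof -
  have "inv b \<otimes> a = \<one>"
    using assms by (intro faithful) (auto simp: mult_apply)
  then show ?thesis
    using assms by (metis inv_closed inv_equality inv_inv)
qed

lemma mv_empty: "a \<in> carrier M \<Longrightarrow> mv a = {} \<longleftrightarrow> a = \<one>"
  using faithful[of a] by (auto simp: mv_def one_apply)

lemma mv_closed: "a \<in> carrier M \<Longrightarrow> x \<in> mv a \<Longrightarrow> a x \<in> mv a"
  by (auto simp: mv_def maps inj_apply)

lemma inv_fixed: "a \<in> carrier M \<Longrightarrow> x \<in> X \<Longrightarrow> a x = x \<Longrightarrow> (inv a) x = x"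
  by (metis inv_apply(1))

lemma pow_apply: "a \<in> carrier M \<Longrightarrow> x \<in> X \<Longrightarrow> (a [^] (n::nat)) x = (a ^^ n) x \<and> (a ^^ n) x \<in> X"
proof (induction n arbitrary: x)
  case (Suc n)
  then show ?case
    by (simp add: mult_apply maps funpow_swap1)
qed (auto simp: one_apply)

lemma open_preimage: "a \<in> carrier M \<Longrightarrow> open U \<Longrightarrow> open (X \<inter> a -` U)"
  using cont open_X continuous_open_preimage by blast

text \<open>Separate \<open>x\<close> from \<open>a x\<close> by disjoint open sets and intersect
  the first with the preimage of the second.\<close>

lemma displaced:
  assumes "a \<in> carrier M" "open W" "W \<subseteq> X" "x \<in> W" "a x \<noteq> x"
  shows "\<exists>U. open U \<and> x \<in> U \<and> U \<subseteq> W \<and> (\<forall>y\<in>U. a y \<notin> U)"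
proof -
  obtain P Q where PQ: "open P" "open Q" "a x \<in> P" "x \<in> Q" "P \<inter> Q = {}"
    using hausdorff[OF assms(5)] by auto
  let ?U = "(X \<inter> a -` P) \<inter> Q \<inter> W"
  have "open ?U"
    using open_Int[OF open_Int[OF open_preimage[OF assms(1) PQ(1)] PQ(2)] assms(2)] .
  moreover have "x \<in> ?U" "?U \<subseteq> W" "\<forall>y\<in>?U. a y \<notin> ?U"
    using PQ assms by auto
  ultimately show ?thesis by blast
qed

lemma open_mv:
  assumes "a \<in> carrier M"
  shows "open (mv a)"
proof (subst open_subopen, intro ballI)
  fix x assume "x \<in> mv a"
  then obtain U where "open U" "x \<in> U" "U \<subseteq> X" "\<And>y. y \<in> U \<Longrightarrow> a y \<notin> U"
    using displaced[OF assms open_X subset_refl, of x] unfolding mv_def by blast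
  then show "\<exists>T. open T \<and> x \<in> T \<and> T \<subseteq> mv a"
    unfolding mv_def by (intro exI[of _ U]) force
qed

lemma moving_nontrivial:
  assumes "open U" "U \<noteq> {}" "U \<subseteq> X"
  obtains g where "g \<in> carrier M" "mv g \<subseteq> U" "g \<noteq> \<one>" "g [^] (12::nat) \<noteq> \<one>"
  using moving[OF assms] nat_pow_one mv_def by metis

lemma disjoint_commute:
  assumes a: "a \<in> carrier M" and b: "b \<in> carrier M" and d: "mv a \<inter> mv b = {}"
  shows "commutes M a b"
  unfolding commutes_def
proof (rule eqI)
  fix x assume x: "x \<in> X"
  have "a (b x) = b (a x)"
    using x a b d mv_closed[of a x] mv_closed[of b x]
    by (metis disjoint_iff fixed_outside_mv maps)
  then show "(a \<otimes> b) x = (b \<otimes> a) x"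
    using a b x by (simp add: mult_apply)
qed (use a b in auto)

lemma commutes_apply:
  assumes "commutes M a b" "a \<in> carrier M" "b \<in> carrier M" "x \<in> X"
  shows "a (b x) = b (a x)"
  using assms mult_apply unfolding commutes_def by metis

lemma group_commutator_apply:
  assumes "a \<in> carrier M" "b \<in> carrier M" "x \<in> X"
  shows "group_commutator M a b x = a (b ((inv a) ((inv b) x)))"
  using assms by (simp add: group_commutator_def mult_apply maps)

lemma mv_group_commutator:
  assumes "a \<in> carrier M" "b \<in> carrier M" "x \<in> mv (group_commutator M a b)"
  shows "x \<in> mv b \<or> (inv a) x \<in> mv b"
proof (rule ccontr)
  assume n: "\<not> ?thesis"
  have x: "x \<in> X" using assms mv_subset by auto
  have "b x = x" "b ((inv a) x) = (inv a) x"
    using n x assms fixed_outside_mv maps by auto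
  then have "group_commutator M a b x = x"
    using assms x inv_fixed by (simp add: group_commutator_apply inv_apply(2)[OF assms(1) x])
  then show False using assms(3) by (auto simp: mv_def)
qed

lemma mv_conjugate:
  assumes "g \<in> carrier M" "a \<in> carrier M"
  shows "mv (conjugate M g a) = g ` mv a"
proof
  show "mv (conjugate M g a) \<subseteq> g ` mv a"
  proof
    fix x assume x: "x \<in> mv (conjugate M g a)"
    then have xX: "x \<in> X" using mv_subset by auto
    have "(inv g) x \<in> mv a"
      using x assms xX by (auto simp: mv_def conjugate_def mult_apply maps inv_apply(2)[OF assms(1) xX])
    then show "x \<in> g ` mv a"
      using inv_apply(2)[OF assms(1) xX] by (metis image_eqI)
  qed
  show "g ` mv a \<subseteq> mv (conjugate M g a)"
    using assms by (auto simp: mv_def conjugate_def mult_apply maps inj_apply)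
qed

text \<open>If \<open>f\<close> and \<open>h\<close> do not commute, \<open>h\<close> moves a point
  of the support of \<open>f\<close>. Take an open \<open>U\<close> there that \<open>h\<close>
  moves off itself, then \<open>f2\<close> supported in \<open>U\<close>, then \<open>V\<close>
  moved off itself by \<open>f2\<close>, then \<open>f1\<close> supported in \<open>V\<close>. On
  \<open>U\<close> the commutator \<open>k\<close> of \<open>f2\<close> and \<open>h\<close> agrees
  with \<open>f2\<close>, so the commutator of \<open>f1\<close> and \<open>k\<close> is supported
  in \<open>U\<close>, away from \<open>g\<close>. It is nontrivial because \<open>f2\<close>
  carries \<open>V\<close> to where \<open>f1\<close> is the identity.\<close>

lemma disjoint_alg_disjoint:
  assumes f: "f \<in> carrier M" and g: "g \<in> carrier M" and d: "mv f \<inter> mv g = {}"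
  shows "alg_disjoint M f g"
  unfolding alg_disjoint_def
proof (intro ballI impI)
  fix h assume h: "h \<in> carrier M" and nc: "\<not> commutes M f h"
  then have "mv f \<inter> mv h \<noteq> {}"
    using disjoint_commute[OF f h] by metis
  then obtain x where x: "x \<in> mv f" "x \<in> mv h"
    by (meson disjoint_iff)
  have "h x \<noteq> x" using x(2) by (simp add: mv_def)
  from displaced[OF h open_mv[OF f] mv_subset x(1) this]
  obtain U where U: "open U" "x \<in> U" "U \<subseteq> mv f" and hU: "\<And>y. y \<in> U \<Longrightarrow> h y \<notin> U"
    by (elim exE conjE) blast
  have UX: "U \<subseteq> X" using U mv_subset by auto
  obtain f2 where f2: "f2 \<in> carrier M" "mv f2 \<subseteq> U" "f2 \<noteq> \<one>"
    using moving_nontrivial[OF U(1) _ UX] U(2) by blast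
  then obtain y where y: "y \<in> mv f2" using mv_empty by blast
  have "f2 y \<noteq> y" using y by (simp add: mv_def)
  from displaced[OF f2(1) open_mv[OF f2(1)] mv_subset y this]
  obtain V where V: "open V" "y \<in> V" "V \<subseteq> mv f2" and f2V: "\<And>z. z \<in> V \<Longrightarrow> f2 z \<notin> V"
    by (elim exE conjE) blast
  have VX: "V \<subseteq> X" and VU: "V \<subseteq> U" using V mv_subset f2 by auto
  obtain f1 where f1: "f1 \<in> carrier M" "mv f1 \<subseteq> V" "f1 \<noteq> \<one>"
    using moving_nontrivial[OF V(1) _ VX] V(2) by blast
  define k where "k = group_commutator M f2 h"
  have k: "k \<in> carrier M" using k_def f2 h by auto
  have f2U: "f2 z \<in> U" if "z \<in> U" for z
    using that f2 UX fixed_outside_mv mv_closed by (metis subsetD)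
  have kU: "k z = f2 z" if "z \<in> U" for z
  proof -
    have zX: "z \<in> X" and iX: "(inv h) z \<in> X" using that UX h maps by auto
    have "(inv h) z \<notin> U"
      using hU[of "(inv h) z"] that inv_apply(2)[OF h zX] by auto
    then have "(inv f2) ((inv h) z) = (inv h) z"
      using f2 iX fixed_outside_mv inv_fixed by blast
    then show ?thesis
      using zX h f2 by (simp add: k_def group_commutator_apply inv_apply(2)[OF h zX])
  qed
  have sub: "mv (group_commutator M f1 k) \<subseteq> U"
  proof
    fix z assume z: "z \<in> mv (group_commutator M f1 k)"
    then have zX: "z \<in> X" using mv_subset by auto
    show "z \<in> U"
    proof (rule ccontr)
      assume nz: "z \<notin> U"
      have iX: "(inv k) z \<in> X" using zX k maps by auto
      have "(inv k) z \<notin> U"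
        using kU[of "(inv k) z"] f2U[of "(inv k) z"] nz inv_apply(2)[OF k zX] by auto
      then have "(inv f1) ((inv k) z) = (inv k) z"
        using f1 VU iX fixed_outside_mv inv_fixed by blast
      moreover have "f1 z = z"
        using nz f1 VU zX fixed_outside_mv by blast
      ultimately have "group_commutator M f1 k z = z"
        using f1 k zX by (simp add: group_commutator_apply inv_apply(2)[OF k zX])
      then show False using z by (auto simp: mv_def)
    qed
  qed
  have nontriv: "group_commutator M f1 k \<noteq> \<one>"
  proof
    assume "group_commutator M f1 k = \<one>"
    then have c: "commutes M f1 k" using group_commutator_eq_one f1 k by blast
    obtain z where z: "z \<in> mv f1" using f1 mv_empty by blast
    then have zV: "z \<in> V" "f1 z \<in> V" using f1 mv_closed by blast+
    have "f1 (k z) = k (f1 z)" using commutes_apply[OF c f1(1) k] zV VX by auto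
    then have "f1 (f2 z) = f2 (f1 z)" using kU[of z] kU[of "f1 z"] zV VU by (simp add: subset_iff)
    moreover have "f1 (f2 z) = f2 z"
      using f2V zV f1 VX f2 maps fixed_outside_mv by (metis subsetD)
    ultimately have "f1 z = z" using inj_apply f2 zV VX by (metis subsetD)
    then show False using z by (auto simp: mv_def)
  qed
  have com: "commutes M a g" if "a \<in> carrier M" "mv a \<subseteq> U" for a
    using disjoint_commute[OF that(1) g] that U d by blast
  show "\<exists>f1\<in>carrier M. \<exists>f2\<in>carrier M. commutes M f1 g \<and> commutes M f2 g \<and>
        group_commutator M f1 (group_commutator M f2 h) \<noteq> \<one> \<and>
        commutes M (group_commutator M f1 (group_commutator M f2 h)) g"
    using com f1 f2 VU sub nontriv k unfolding k_def
    by (intro bexI[of _ f1] bexI[of _ f2]) auto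
qed

lemma displaced_power:
  assumes g: "g \<in> carrier M" and "open W" "W \<subseteq> X" "x \<in> W"
    and "\<And>i. 1 \<le> i \<Longrightarrow> i \<le> n \<Longrightarrow> (g ^^ i) x \<noteq> x"
  shows "\<exists>U. open U \<and> x \<in> U \<and> U \<subseteq> W \<and> (\<forall>i y. 1 \<le> i \<and> i \<le> n \<and> y \<in> U \<longrightarrow> (g ^^ i) y \<notin> U)"
  using assms(5)
proof (induction n)
  case 0
  then show ?case using assms by (intro exI[of _ W]) auto
next
  case (Suc n)
  then obtain U where U: "open U" "x \<in> U" "U \<subseteq> W"
    "\<forall>i y. 1 \<le> i \<and> i \<le> n \<and> y \<in> U \<longrightarrow> (g ^^ i) y \<notin> U"
    by auto
  have pw: "(g [^] Suc n) y = (g ^^ Suc n) y" if "y \<in> X" for y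
    using pow_apply[OF g that, of "Suc n"] by blast
  have nx: "(g [^] Suc n) x \<noteq> x"
    using pw[of x] assms Suc.prems[of "Suc n"] by (metis le_add1 plus_1_eq_Suc order_refl subsetD)
  have UX: "U \<subseteq> X" using U(3) assms(3) by blast
  obtain V where V: "open V" "x \<in> V" "V \<subseteq> U" "\<And>y. y \<in> V \<Longrightarrow> (g [^] Suc n) y \<notin> V"
    using displaced[OF nat_pow_closed[OF g] U(1) UX U(2) nx] by (elim exE conjE) blast
  have "(g ^^ i) y \<notin> V" if "1 \<le> i" "i \<le> Suc n" "y \<in> V" for i y
  proof (cases "i = Suc n")
    case True
    have "y \<in> X" using that V U assms by auto
    then show ?thesis using V(4)[OF that(3)] pw[of y] True by metis
  next
    case False
    then have "i \<le> n" "y \<in> U" using that V by auto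
    then have "(g ^^ i) y \<notin> U" using U(4) that by blast
    then show ?thesis using V by blast
  qed
  then show ?case using V U by blast
qed

text \<open>At a point moved by \<open>f\<close> and by \<open>g ^ 12\<close>, some neighbourhood
  \<open>U\<close> is disjoint from its image under \<open>f\<close> and from its images under
  \<open>g\<close>, ..., \<open>g ^ 4\<close>. A nontrivial \<open>h\<close> supported in
  \<open>U\<close> does not commute with \<open>f\<close>. The resulting double commutator
  \<open>k\<close> commutes with \<open>g\<close>, so its support contains the points
  \<open>z\<close>, \<open>g z\<close>, ..., \<open>g ^ 4 z\<close>; they lie in four translates of
  \<open>U\<close> by elements commuting with \<open>g\<close>. Two of them in the same translate
  would give a point of \<open>U\<close> that returns to \<open>U\<close> after at most four
  steps.\<close>

lemma alg_disjoint_power_disjoint: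
  assumes f: "f \<in> carrier M" and g: "g \<in> carrier M" and ad: "alg_disjoint M f g"
  shows "mv f \<inter> mv (g [^] (12::nat)) = {}"
proof (rule ccontr)
  assume "mv f \<inter> mv (g [^] (12::nat)) \<noteq> {}"
  then obtain x where x0: "x \<in> mv f" "x \<in> mv (g [^] (12::nat))"
    by blast
  then have x: "x \<in> mv f" "(g ^^ 12) x \<noteq> x"
    using pow_apply[OF g, of x 12] unfolding mv_def by auto
  have nx: "(g ^^ i) x \<noteq> x" if "1 \<le> i" "i \<le> 4" for i
  proof
    assume e: "(g ^^ i) x = x"
    have "i = 1 \<or> i = 2 \<or> i = 3 \<or> i = 4" using that by auto
    then have "i * (12 div i) = 12" by auto
    then obtain j where j: "12 = i * j" by metis
    then have "(g ^^ 12) x = ((g ^^ i) ^^ j) x"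
      unfolding j by (simp add: funpow_mult mult.commute)
    also have "\<dots> = x" using e by (induction j) auto
    finally show False using x by auto
  qed
  have "\<exists>U. open U \<and> x \<in> U \<and> U \<subseteq> mv f \<and> (\<forall>i y. 1 \<le> i \<and> i \<le> 4 \<and> y \<in> U \<longrightarrow> (g ^^ i) y \<notin> U)"
    by (intro displaced_power[OF g open_mv[OF f] mv_subset x(1)] nx)
  then obtain U1 where U1: "open U1" "x \<in> U1" "U1 \<subseteq> mv f"
      "\<forall>i y. 1 \<le> i \<and> i \<le> 4 \<and> y \<in> U1 \<longrightarrow> (g ^^ i) y \<notin> U1"
    by (elim exE conjE) blast
  have "U1 \<subseteq> X" "f x \<noteq> x" using U1 x(1) by (auto simp: mv_def)
  from displaced[OF f U1(1) this(1) U1(2) this(2)]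
  obtain U where U: "open U" "x \<in> U" "U \<subseteq> U1" "\<And>y. y \<in> U \<Longrightarrow> f y \<notin> U"
    by (elim exE conjE) blast
  have UX: "U \<subseteq> X" using U U1 mv_subset by blast
  obtain h where h: "h \<in> carrier M" "mv h \<subseteq> U" "h \<noteq> \<one>"
    using moving_nontrivial[OF U(1) _ UX] U(2) by blast
  have "\<not> commutes M f h"
  proof
    assume c: "commutes M f h"
    obtain y where y: "y \<in> mv h" using h mv_empty by blast
    then have yX: "y \<in> X" "y \<in> U" using h UX by auto
    have "h (f y) = f y" using U(4)[OF yX(2)] h fixed_outside_mv maps f yX by blast
    then have "f (h y) = f y" using commutes_apply[OF c f h(1) yX(1)] by simp
    then have "h y = y" using inj_apply f h maps yX by blast
    then show False using y by (auto simp: mv_def)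
  qed
  then obtain f1 f2 where f12: "f1 \<in> carrier M" "f2 \<in> carrier M" "commutes M f1 g" "commutes M f2 g"
    "group_commutator M f1 (group_commutator M f2 h) \<noteq> \<one>"
    "commutes M (group_commutator M f1 (group_commutator M f2 h)) g"
    using ad h unfolding alg_disjoint_def by blast
  define k where "k = group_commutator M f1 (group_commutator M f2 h)"
  have k: "k \<in> carrier M" "k \<noteq> \<one>" "commutes M k g" using f12 h by (auto simp: k_def)
  define w where "w j = (if j = 0 then \<one> else if j = 1 then f2 else if j = 2 then f1 else f1 \<otimes> f2)"
    for j :: nat
  have wc: "w j \<in> carrier M" for j using f12 by (auto simp: w_def)
  have wg: "(w j) (g y) = g (w j y)" if "y \<in> X" for y j
  proof -
    have "f1 (g z) = g (f1 z)" "f2 (g z) = g (f2 z)" if "z \<in> X" for z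
      using commutes_apply that f12 g by auto
    then show ?thesis
      using that f12 g by (auto simp: w_def one_apply mult_apply maps)
  qed
  have iwg: "(inv (w j)) ((g ^^ n) y) = (g ^^ n) ((inv (w j)) y)" if "y \<in> X" for y j n
  proof (induction n)
    case (Suc n)
    have 1: "(g ^^ n) y \<in> X" using pow_apply[OF g that] by auto
    have 2: "(inv (w j)) ((g ^^ n) y) \<in> X" using wc 1 maps by blast
    have "g ((g ^^ n) y) = (w j) (g ((inv (w j)) ((g ^^ n) y)))"
      using wg[OF 2, of j] by (simp add: inv_apply(2)[OF wc 1])
    then have "(inv (w j)) (g ((g ^^ n) y)) = g ((inv (w j)) ((g ^^ n) y))"
      using wc 2 g maps by simp
    then show ?case using Suc by simp
  qed simp
  have in4: "\<exists>j<4. (inv (w j)) z \<in> U" if z: "z \<in> mv k" for z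
  proof -
    have zX: "z \<in> X" using z mv_subset by auto
    have "z \<in> mv (group_commutator M f2 h) \<or> (inv f1) z \<in> mv (group_commutator M f2 h)"
      using mv_group_commutator[OF f12(1) _ z[unfolded k_def]] f12 h by auto
    moreover have "y \<in> U \<or> (inv f2) y \<in> U" if "y \<in> mv (group_commutator M f2 h)" for y
      using mv_group_commutator[OF f12(2) h(1) that] h by blast
    ultimately consider "z \<in> U" | "(inv f2) z \<in> U" | "(inv f1) z \<in> U" | "(inv f2) ((inv f1) z) \<in> U"
      by blast
    then show ?thesis
    proof cases
      case 1 then show ?thesis using zX by (intro exI[of _ 0]) (auto simp: w_def one_apply)
    next
      case 2 then show ?thesis by (intro exI[of _ 1]) (auto simp: w_def)
    next
      case 3 then show ?thesis by (intro exI[of _ 2]) (auto simp: w_def)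
    next
      case 4 then show ?thesis using zX f12
        by (intro exI[of _ 3]) (auto simp: w_def inv_mult_group mult_apply)
    qed
  qed
  obtain z where z: "z \<in> mv k" using k mv_empty by blast
  have zX: "z \<in> X" using z mv_subset by auto
  have gz: "(g ^^ i) z \<in> mv k" for i
  proof (induction i)
    case (Suc i)
    have "k (g ((g ^^ i) z)) = g (k ((g ^^ i) z))"
      using commutes_apply[OF k(3) k(1) g] Suc mv_subset by blast
    then show ?case using Suc inj_apply[OF g] maps[OF g] maps[OF k(1)] by (auto simp: mv_def)
  qed (use z in auto)
  obtain J where J: "\<And>i. J i < 4 \<and> (inv (w (J i))) ((g ^^ i) z) \<in> U"
    using in4[OF gz] by metis
  have "\<not> inj_on J {..4::nat}"
  proof
    assume "inj_on J {..4}"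
    then have "card {..4::nat} \<le> card {..<4::nat}"
      using J by (intro card_inj_on_le[of J]) auto
    then show False by simp
  qed
  then obtain a b where ab: "a \<le> 4" "b \<le> 4" "a \<noteq> b" "J a = J b"
    by (auto simp: inj_on_def)
  have key: False if "a < b" "b \<le> 4" "J a = J b" for a b
  proof -
    let ?u = "(inv (w (J a))) ((g ^^ a) z)"
    have azX: "(g ^^ a) z \<in> X" using pow_apply[OF g zX] by auto
    have "(g ^^ (b - a)) ?u = (inv (w (J a))) ((g ^^ (b - a)) ((g ^^ a) z))"
      using iwg[OF azX] by simp
    also have "(g ^^ (b - a)) ((g ^^ a) z) = (g ^^ b) z"
      using that by (metis comp_apply funpow_add le_add_diff_inverse2 less_imp_le_nat)
    finally have "(g ^^ (b - a)) ?u \<in> U" using J[of b] that by simp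
    moreover have "?u \<in> U" using J by auto
    moreover have "1 \<le> b - a" "b - a \<le> 4" using that by auto
    ultimately show False using U1(4) U(3) by blast
  qed
  show False using key[of a b] key[of b a] ab by (metis linorder_neqE_nat)
qed

text \<open>If \<open>f\<close> and \<open>g\<close> are disjoint in the algebraic sense, the
  support of \<open>g ^ 12\<close> misses that of \<open>f\<close> and, being open, also its
  closure. Conversely, if \<open>k\<close> moves a point outside the closure, an element
  \<open>g\<close> supported in a small set there that \<open>k\<close> moves off itself is disjoint
  from \<open>f\<close>, yet its twelfth power does not commute with \<open>k\<close>.\<close>

theorem covers_iff:
  assumes f: "f \<in> carrier M" and k: "k \<in> carrier M"
  shows "covers M f k \<longleftrightarrow> mv k \<subseteq> closure (mv f)"
proof
  assume sub: "mv k \<subseteq> closure (mv f)"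
  show "covers M f k"
    unfolding covers_def
  proof (intro ballI impI)
    fix g assume g: "g \<in> carrier M" "alg_disjoint M f g"
    then have "mv f \<inter> mv (g [^] (12::nat)) = {}"
      using alg_disjoint_power_disjoint f by auto
    then have "closure (mv f) \<inter> mv (g [^] (12::nat)) = {}"
      using g open_mv[of "g [^] (12::nat)"] by (metis Int_commute nat_pow_closed open_Int_closure_eq_empty)
    then show "commutes M k (g [^] (12::nat))"
      using disjoint_commute g k sub by blast
  qed
next
  assume c: "covers M f k"
  show "mv k \<subseteq> closure (mv f)"
  proof (rule ccontr)
    assume "\<not> ?thesis"
    then obtain x where x: "x \<in> mv k - closure (mv f)" by auto
    have o: "open (mv k - closure (mv f))"
      using open_mv[OF k] by (simp add: open_Diff)
    have "k x \<noteq> x" "mv k - closure (mv f) \<subseteq> X" using x by (auto simp: mv_def)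
    from displaced[OF k o this(2) x this(1)]
    obtain U where U: "open U" "x \<in> U" "U \<subseteq> mv k - closure (mv f)" "\<And>y. y \<in> U \<Longrightarrow> k y \<notin> U"
      by (elim exE conjE) blast
    have UX: "U \<subseteq> X" using U mv_subset by blast
    obtain g where g: "g \<in> carrier M" "mv g \<subseteq> U" "g [^] (12::nat) \<noteq> \<one>"
      using moving_nontrivial[OF U(1) _ UX] U(2) by blast
    have "mv f \<inter> mv g = {}" using g U closure_subset by blast
    then have cm: "commutes M k (g [^] (12::nat))"
      using c g disjoint_alg_disjoint f unfolding covers_def by blast
    let ?h = "g [^] (12::nat)"
    have fix1: "?h y = y" if "y \<in> X" "y \<notin> U" for y
    proof -
      have "(g ^^ n) y = y" for n
        using fixed_outside_mv[OF that(1)] that g by (induction n) auto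
      then show ?thesis using pow_apply[OF g(1) that(1)] by auto
    qed
    have hc: "?h \<in> carrier M" using g by auto
    obtain y where y: "y \<in> mv ?h" using g mv_empty[OF hc] by blast
    then have yU: "y \<in> U" "y \<in> X" using fix1 by (auto simp: mv_def)
    have "?h (k y) = k y" using fix1 U(4) yU k maps by blast
    then have "k (?h y) = k y" using commutes_apply[OF cm k hc yU(2)] by simp
    then have "?h y = y" using inj_apply k yU hc maps by blast
    then show False using y by (auto simp: mv_def)
  qed
qed

text \<open>Closures of disjoint open sets can have points in common, but no nonempty open
  set.\<close>

lemma apart_iff:
  assumes f: "f \<in> carrier M" and k: "k \<in> carrier M"
  shows "apart M f k \<longleftrightarrow> mv f \<inter> mv k = {}"
proof
  assume a: "apart M f k"
  show "mv f \<inter> mv k = {}"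
  proof (rule ccontr)
    assume ne: "\<not> ?thesis"
    have "open (mv f \<inter> mv k)" "mv f \<inter> mv k \<subseteq> X"
      using open_mv[OF f] open_mv[OF k] mv_subset by auto
    then obtain m where m: "m \<in> carrier M" "mv m \<subseteq> mv f \<inter> mv k" "m \<noteq> \<one>"
      using moving_nontrivial[OF _ ne] by blast
    then have "mv m \<subseteq> closure (mv f)" "mv m \<subseteq> closure (mv k)"
      using closure_subset by blast+
    then show False
      using a m covers_iff[OF f m(1)] covers_iff[OF k m(1)] unfolding apart_def by blast
  qed
next
  assume d: "mv f \<inter> mv k = {}"
  show "apart M f k"
    unfolding apart_def
  proof (intro ballI impI)
    fix m assume m: "m \<in> carrier M" "covers M f m \<and> covers M k m"
    then have sub: "mv m \<subseteq> closure (mv f)" "mv m \<subseteq> closure (mv k)"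
      using covers_iff f k by auto
    have "mv f \<inter> closure (mv k) = {}"
      using d open_mv[OF f] by (metis open_Int_closure_eq_empty)
    then have "mv m \<inter> mv f = {}" using sub by auto
    then have "mv m \<inter> closure (mv f) = {}"
      using open_mv[OF m(1)] by (metis open_Int_closure_eq_empty)
    then show "m = \<one>" using sub m mv_empty by blast
  qed
qed

end

section \<open>Transport along a group isomorphism\<close>

locale group_iso = G: group G + H: group H for G (structure) and H (structure) +
  fixes \<phi> assumes iso: "\<phi> \<in> iso G H"
begin

sublocale hom: group_hom G H \<phi>
  using iso by unfold_locales (auto simp: iso_def)

lemma image: "\<phi> ` carrier G = carrier H"
  using iso by (auto simp: iso_def bij_betw_def)

lemma inj: "a \<in> carrier G \<Longrightarrow> b \<in> carrier G \<Longrightarrow> \<phi> a = \<phi> b \<longleftrightarrow> a = b"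
  using iso by (auto simp: iso_def bij_betw_def inj_on_def)

lemma one_iff: "a \<in> carrier G \<Longrightarrow> \<phi> a = \<one>\<^bsub>H\<^esub> \<longleftrightarrow> a = \<one>\<^bsub>G\<^esub>"
  using inj[of a "\<one>\<^bsub>G\<^esub>"] by auto

text \<open>Once the quantifiers are pulled back to \<open>G\<close>, each of the group-theoretic
  notions transfers by rewriting.\<close>

lemma ball_H: "(\<forall>b\<in>carrier H. P b) \<longleftrightarrow> (\<forall>a\<in>carrier G. P (\<phi> a))"
  using image by (metis imageE imageI)

lemma bex_H: "(\<exists>b\<in>carrier H. P b) \<longleftrightarrow> (\<exists>a\<in>carrier G. P (\<phi> a))"
  using image by (metis imageE imageI)

lemma hom_group_commutator:
  "a \<in> carrier G \<Longrightarrow> b \<in> carrier G \<Longrightarrow>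
    group_commutator H (\<phi> a) (\<phi> b) = \<phi> (group_commutator G a b)"
  by (simp add: group_commutator_def)

lemma hom_conjugate:
  "a \<in> carrier G \<Longrightarrow> b \<in> carrier G \<Longrightarrow> conjugate H (\<phi> a) (\<phi> b) = \<phi> (conjugate G a b)"
  by (simp add: conjugate_def)

lemma hom_commutes:
  "a \<in> carrier G \<Longrightarrow> b \<in> carrier G \<Longrightarrow> commutes H (\<phi> a) (\<phi> b) \<longleftrightarrow> commutes G a b"
  unfolding commutes_def by (metis inj hom.hom_mult G.m_closed)

lemma hom_alg_disjoint:
  assumes "f \<in> carrier G" "g \<in> carrier G"
  shows "alg_disjoint H (\<phi> f) (\<phi> g) \<longleftrightarrow> alg_disjoint G f g"
  unfolding alg_disjoint_def ball_H bex_H using assms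
  by (simp add: hom_group_commutator hom_commutes one_iff cong: ball_cong bex_cong conj_cong)

lemma hom_covers:
  assumes "f \<in> carrier G" "k \<in> carrier G"
  shows "covers H (\<phi> f) (\<phi> k) \<longleftrightarrow> covers G f k"
proof -
  have "commutes H (\<phi> k) (\<phi> g [^]\<^bsub>H\<^esub> (12::nat)) \<longleftrightarrow> commutes G k (g [^]\<^bsub>G\<^esub> (12::nat))"
    if "g \<in> carrier G" for g
    using that assms hom_commutes[of k "g [^]\<^bsub>G\<^esub> (12::nat)"] by (simp add: hom.hom_nat_pow)
  then show ?thesis
    unfolding covers_def ball_H using assms by (simp add: hom_alg_disjoint cong: ball_cong)
qed

lemma hom_apart:
  assumes "f \<in> carrier G" "k \<in> carrier G"
  shows "apart H (\<phi> f) (\<phi> k) \<longleftrightarrow> apart G f k"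
  unfolding apart_def ball_H using assms by (simp add: hom_covers one_iff cong: ball_cong)

lemma hom_point_seq:
  assumes "\<And>i. f i \<in> carrier G"
  shows "point_seq H (\<lambda>i. \<phi> (f i)) \<longleftrightarrow> point_seq G f"
  unfolding point_seq_def ball_H bex_H using assms
  by (simp add: hom_covers hom_apart one_iff hom_conjugate cong: ball_cong bex_cong conj_cong)

lemma inverse_iso: "group_iso H G (inv_into (carrier G) \<phi>)"
  using G.iso_set_sym[OF iso] by unfold_locales

end

section \<open>Shifts along a direction\<close>

text \<open>On each line in direction \<open>v\<close> the map is increasing, which gives
  bijectivity. For the inverse, \<open>key\<close> bounds \<open>l z' - l z\<close> by the variation
  of \<open>l\<close> between \<open>z\<close> and \<open>z + (h z' - h z)\<close>. This point is
  close to \<open>z\<close> as soon as the images are close, so the local bound near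
  \<open>z\<close> applies before it is known that \<open>z'\<close> is near
  \<open>z\<close>.\<close>

lemma shift_homeo:
  fixes v :: "'a::real_normed_vector" and l :: "'a \<Rightarrow> real" and \<kappa> :: real
  assumes range: "\<And>z. 0 \<le> l z" "\<And>z. l z \<le> 1"
    and \<kappa>: "\<kappa> < 1" and one: "\<And>z t. \<bar>l (z + t *\<^sub>R v) - l z\<bar> \<le> \<kappa> * \<bar>t\<bar>"
    and loc: "\<And>z. \<exists>K \<delta>. \<delta> > 0 \<and> K \<ge> 0 \<and>
      (\<forall>a b. dist a z < \<delta> \<longrightarrow> dist b z < \<delta> \<longrightarrow> \<bar>l a - l b\<bar> \<le> K * dist a b)"
  defines "h \<equiv> \<lambda>z. z + l z *\<^sub>R v"
  shows "bij h" "homeomorphic_map euclidean euclidean h" "locally_bilipschitz_on UNIV h"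
proof -
  have key: "(1 - \<kappa>) * \<bar>l z' - l z\<bar> \<le> \<bar>l (z + (h z' - h z)) - l z\<bar>" for z z'
  proof -
    have "z + (h z' - h z) = z' + (l z' - l z) *\<^sub>R v"
      by (simp add: h_def algebra_simps)
    then have "\<bar>l (z + (h z' - h z)) - l z'\<bar> \<le> \<kappa> * \<bar>l z' - l z\<bar>"
      using one[of z' "l z' - l z"] by simp
    then show ?thesis by (auto simp: algebra_simps)
  qed
  have lcont: "continuous_on UNIV l"
    unfolding continuous_on_iff
  proof (intro ballI allI impI)
    fix z :: 'a and e :: real assume e: "0 < e"
    obtain K \<delta> where K: "\<delta> > 0" "K \<ge> 0"
      "\<And>a b. dist a z < \<delta> \<Longrightarrow> dist b z < \<delta> \<Longrightarrow> \<bar>l a - l b\<bar> \<le> K * dist a b"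
      using loc[of z] by blast
    show "\<exists>d>0. \<forall>x'\<in>UNIV. dist x' z < d \<longrightarrow> dist (l x') (l z) < e"
    proof (intro exI[of _ "min \<delta> (e / (K + 1))"] conjI ballI impI)
      show "0 < min \<delta> (e / (K + 1))" using K e by auto
      fix x assume x: "dist x z < min \<delta> (e / (K + 1))"
      then have "(K + 1) * dist x z < e"
        using K by (simp add: pos_less_divide_eq mult.commute)
      moreover have "\<bar>l x - l z\<bar> \<le> K * dist x z" using K x by auto
      moreover have "K * dist x z \<le> (K + 1) * dist x z" by (simp add: mult_right_mono)
      ultimately show "dist (l x) (l z) < e" by (simp add: dist_real_def)
    qed
  qed
  have inj: "inj h"
  proof (rule injI)
    fix z z' assume e: "h z = h z'"
    have "(1 - \<kappa>) * \<bar>l z' - l z\<bar> \<le> 0" using key[of z' z] e by simp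
    then have "l z' = l z" using \<kappa> by (simp add: mult_le_0_iff)
    then show "z = z'" using e by (simp add: h_def)
  qed
  have surj: "surj h"
  proof -
    have "\<exists>z. h z = w" for w
    proof -
      \<comment> \<open>The preimage is sought on the line through \<open>w\<close>; since
        \<open>l\<close> has values between 0 and 1, the function is nonpositive at 0 and
        nonnegative at 1.\<close>
      have "continuous_on {0..1} (\<lambda>t. t - l (w - t *\<^sub>R v))"
        by (intro continuous_intros continuous_on_compose2[OF lcont]) auto
      then have "\<exists>t\<ge>0. t \<le> 1 \<and> t - l (w - t *\<^sub>R v) = 0"
        using range[of w] range[of "w - v"] by (intro IVT') auto
      then obtain t where "t = l (w - t *\<^sub>R v)" by auto
      then have "h (w - t *\<^sub>R v) = w" by (simp add: h_def)
      then show ?thesis by blast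
    qed
    then show ?thesis by (metis surjI)
  qed
  show bij: "bij h" using inj surj by (simp add: bij_def)
  have hcont: "continuous_on UNIV h"
    unfolding h_def by (intro continuous_intros lcont)
  have low: "dist a b \<le> (1 + K * norm v / (1 - \<kappa>)) * dist (h a) (h b)"
    if "\<bar>l (a + (h b - h a)) - l a\<bar> \<le> K * dist (h a) (h b)" for a b K
  proof -
    have "b - a = (h b - h a) - (l b - l a) *\<^sub>R v" by (simp add: h_def algebra_simps)
    then have "dist a b \<le> dist (h a) (h b) + \<bar>l b - l a\<bar> * norm v"
      by (metis dist_norm norm_minus_commute norm_scaleR norm_triangle_ineq4 real_norm_def)
    moreover have "\<bar>l b - l a\<bar> \<le> K * dist (h a) (h b) / (1 - \<kappa>)"
      using key[of b a] that \<kappa> by (simp add: pos_le_divide_eq mult.commute)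
    then have "\<bar>l b - l a\<bar> * norm v \<le> K * dist (h a) (h b) / (1 - \<kappa>) * norm v"
      by (rule mult_right_mono) simp
    ultimately show ?thesis by (simp add: algebra_simps)
  qed
  have icont: "continuous_on UNIV (inv_into UNIV h)"
    unfolding continuous_on_iff
  proof (intro ballI allI impI)
    fix w :: 'a and e :: real assume e: "0 < e"
    let ?z = "inv_into UNIV h w"
    have hz: "h ?z = w" using surj by (simp add: surj_f_inv_f)
    obtain K \<delta> where K: "\<delta> > 0" "K \<ge> 0"
      "\<And>a b. dist a ?z < \<delta> \<Longrightarrow> dist b ?z < \<delta> \<Longrightarrow> \<bar>l a - l b\<bar> \<le> K * dist a b"
      using loc[of ?z] by blast
    define C where "C = 1 + K * norm v / (1 - \<kappa>)"
    have C: "C \<ge> 1" using K \<kappa> by (simp add: C_def)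
    show "\<exists>d>0. \<forall>x'\<in>UNIV. dist x' w < d \<longrightarrow> dist (inv_into UNIV h x') (inv_into UNIV h w) < e"
    proof (intro exI[of _ "min \<delta> (e / C)"] conjI ballI impI)
      show "0 < min \<delta> (e / C)" using K e C by auto
      fix x assume x: "dist x w < min \<delta> (e / C)"
      have hx: "h (inv_into UNIV h x) = x" using surj by (simp add: surj_f_inv_f)
      have d: "dist (?z + (x - w)) ?z = dist x w" by (simp add: dist_norm)
      have "\<bar>l (?z + (h (inv_into UNIV h x) - h ?z)) - l ?z\<bar> \<le> K * dist (h ?z) (h (inv_into UNIV h x))"
        unfolding hz hx using K(3)[of "?z + (x - w)" ?z] d x K(1) by (simp add: dist_commute)
      then have "dist ?z (inv_into UNIV h x) \<le> C * dist w x"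
        using low[of ?z "inv_into UNIV h x" K] unfolding hz hx C_def by simp
      also have "\<dots> < e" using x C by (simp add: pos_less_divide_eq mult.commute dist_commute)
      finally show "dist (inv_into UNIV h x) (inv_into UNIV h w) < e" by (simp add: dist_commute)
    qed
  qed
  show "homeomorphic_map euclidean euclidean h"
    unfolding homeomorphic_map_maps homeomorphic_maps_def
    using hcont icont inj surj by (intro exI[of _ "inv_into UNIV h"]) (auto simp: surj_f_inv_f)
  show "locally_bilipschitz_on UNIV h"
    unfolding locally_bilipschitz_on_def
  proof (intro conjI ballI)
    show "inj h" by (rule inj)
    fix z :: 'a
    obtain K \<delta> where K: "\<delta> > 0" "K \<ge> 0"
      "\<And>a b. dist a z < \<delta> \<Longrightarrow> dist b z < \<delta> \<Longrightarrow> \<bar>l a - l b\<bar> \<le> K * dist a b"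
      using loc[of z] by blast
    define L where "L = 1 + K * norm v"
    define C where "C = 1 + K * norm v / (1 - \<kappa>)"
    have C: "C \<ge> 1" and L: "L \<ge> 1" using K \<kappa> by (auto simp: C_def L_def)
    \<comment> \<open>For \<open>a\<close> and \<open>b\<close> within \<open>\<eta>\<close> of
      \<open>z\<close> the images are at most \<open>2 * L * \<eta>\<close> apart, so
      \<open>a + (h b - h a)\<close> remains within \<open>\<delta>\<close> of
      \<open>z\<close>.\<close>
    define \<eta> where "\<eta> = \<delta> / (1 + 2 * L)"
    have "\<eta> * (1 + 2 * L) = \<delta>"
      using L by (simp add: \<eta>_def)
    then have "\<eta> + 2 * L * \<eta> = \<delta>" by (simp add: algebra_simps)
    moreover have "\<eta> > 0" using K L by (simp add: \<eta>_def)
    ultimately have \<eta>: "\<eta> > 0" "\<eta> + 2 * L * \<eta> = \<delta>" by auto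
    have \<eta>\<delta>: "\<eta> \<le> \<delta>" using \<eta> L by (smt (verit) mult_nonneg_nonneg)
    have up: "dist (h a) (h b) \<le> L * dist a b" if "a \<in> ball z \<eta>" "b \<in> ball z \<eta>" for a b
    proof -
      have "h a - h b = (a - b) + (l a - l b) *\<^sub>R v" by (simp add: h_def algebra_simps)
      then have "dist (h a) (h b) \<le> dist a b + \<bar>l a - l b\<bar> * norm v"
        by (metis dist_norm norm_scaleR norm_triangle_ineq real_norm_def)
      moreover have "\<bar>l a - l b\<bar> \<le> K * dist a b"
        using K(3) that \<eta>\<delta> by (simp add: dist_commute)
      then have "\<bar>l a - l b\<bar> * norm v \<le> K * dist a b * norm v"
        by (rule mult_right_mono) simp
      ultimately show ?thesis by (simp add: L_def algebra_simps)
    qed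
    have dn: "dist a b \<le> C * dist (h a) (h b)" if ab: "a \<in> ball z \<eta>" "b \<in> ball z \<eta>" for a b
    proof -
      have "dist a b \<le> 2 * \<eta>"
        using ab dist_triangle[of a b z] by (simp add: dist_commute)
      then have "L * dist a b \<le> 2 * L * \<eta>" using L by (simp add: mult_left_mono)
      then have u: "norm (h b - h a) \<le> 2 * L * \<eta>"
        using up[OF ab] by (simp add: dist_norm norm_minus_commute)
      have "dist (a + (h b - h a)) z \<le> dist a z + norm (h b - h a)"
        by (metis add_diff_cancel_left' dist_commute dist_norm dist_triangle2 add.commute dist_triangle norm_minus_commute)
      then have "dist (a + (h b - h a)) z < \<delta>"
        using u ab \<eta>(2) by (simp add: dist_commute)
      then have "\<bar>l (a + (h b - h a)) - l a\<bar> \<le> K * dist (h a) (h b)"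
        using K(3)[of "a + (h b - h a)" a] ab \<eta>\<delta> by (simp add: dist_commute dist_norm norm_minus_commute)
      then show ?thesis using low C_def by blast
    qed
    have "bilipschitz_on (ball z \<eta>) h"
      unfolding bilipschitz_on_def
    proof (intro conjI)
      show "inj_on h (ball z \<eta>)" using inj inj_on_subset by blast
      show "\<exists>C. C-lipschitz_on (ball z \<eta>) h"
        using up L by (intro exI[of _ L] lipschitz_onI) auto
      show "\<exists>D. D-lipschitz_on (h ` ball z \<eta>) (inv_into (ball z \<eta>) h)"
        using dn C \<open>inj_on h (ball z \<eta>)\<close>
        by (intro exI[of _ C] lipschitz_onI) auto
    qed
    then show "\<exists>U. openin (top_of_set UNIV) U \<and> z \<in> U \<and> bilipschitz_on U h"
      using \<eta> by (intro exI[of _ "ball z \<eta>"]) auto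
  qed
qed

lemma carrier_homeo_group:
  "f \<in> carrier (homeo_group X) \<longleftrightarrow> f \<in> Bij (topspace X) \<and> homeomorphic_map X X f"
  by (simp add: homeo_group_def)

text \<open>The sequence of basic homeomorphisms is constant, so the set of tubes is a singleton and
  separated. The point \<open>x\<close> with \<open>l x = 1\<close> is the one that a basic
  homeomorphism has to move by the full vector.\<close>

lemma shift_in_G_gens:
  fixes v :: "'a::real_normed_vector" and l :: "'a \<Rightarrow> real" and \<kappa> :: real
  assumes range: "\<And>z. 0 \<le> l z" "\<And>z. l z \<le> 1"
    and \<kappa>: "\<kappa> < 1" and one: "\<And>z t. \<bar>l (z + t *\<^sub>R v) - l z\<bar> \<le> \<kappa> * \<bar>t\<bar>"
    and loc: "\<And>z. \<exists>K \<delta>. \<delta> > 0 \<and> K \<ge> 0 \<and>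
      (\<forall>a b. dist a z < \<delta> \<longrightarrow> dist b z < \<delta> \<longrightarrow> \<bar>l a - l b\<bar> \<le> K * dist a b)"
    and x: "l x = 1" and r: "r > 0" and sup: "\<And>z. l z \<noteq> 0 \<Longrightarrow> z \<in> cball x r"
  shows "(\<lambda>z. z + l z *\<^sub>R v) \<in> G_gens"
proof -
  let ?h = "\<lambda>z. z + l z *\<^sub>R v"
  note sh = shift_homeo[of l \<kappa> v, OF range \<kappa> one loc]
  have car: "?h \<in> carrier (homeo_group euclidean)"
    using sh by (simp add: carrier_homeo_group Bij_def)
  have sub: "cball x r \<subseteq> tube x v r"
    by (auto simp: tube_def cball_around_def intro!: bexI[of _ x])
  have supp: "supp ?h \<subseteq> cball x r"
    using sup by (auto simp: supp_def)
  have "basic_homeo ?h x v r"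
    unfolding basic_homeo_def using car r supp sub x by auto
  moreover have "separated_family (range (\<lambda>i::nat. tube x v r))"
    by (auto simp: separated_family_def intro!: exI[of _ 1])
  moreover have "bounded (supp ?h)"
    using supp bounded_cball bounded_subset by blast
  moreover have "?h z = z" if "z \<notin> (\<Union>i::nat. tube x v r)" for z
    using that sub supp by (auto simp: supp_def)
  ultimately show ?thesis
    unfolding G_gens_def using car sh(3)
    by (intro CollectI conjI exI[of _ "\<lambda>_. ?h"] exI[of _ "\<lambda>_. x"] exI[of _ "\<lambda>_. v"] exI[of _ "\<lambda>_. r"]) auto
qed

section \<open>Homeomorphisms as a subgroup of the bijections\<close>

lemma homeo_subgroup_BijGroup:
  "subgroup {f \<in> Bij (topspace X). homeomorphic_map X X f} (BijGroup (topspace X))"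
  (is "subgroup ?H _")
proof -
  interpret group "BijGroup (topspace X)" by (rule group_BijGroup)
  show ?thesis
  proof (rule subgroupI)
    show "?H \<subseteq> carrier (BijGroup (topspace X))" by (auto simp: BijGroup_def)
    have "homeomorphic_map X X (\<lambda>x\<in>topspace X. x)"
      by (rule homeomorphic_map_eq[of X X id]) auto
    then show "?H \<noteq> {}" using id_Bij by blast
  next
    fix a assume a: "a \<in> ?H"
    then obtain g where g: "homeomorphic_maps X X a g" by (auto simp: homeomorphic_map_maps)
    have "inv\<^bsub>BijGroup (topspace X)\<^esub> a = (\<lambda>x\<in>topspace X. (inv_into (topspace X) a) x)"
      using a by (simp add: inv_BijGroup)
    moreover have "homeomorphic_map X X (\<lambda>x\<in>topspace X. (inv_into (topspace X) a) x)"
    proof (rule homeomorphic_map_eq[of X X g])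
      show "homeomorphic_map X X g" using g homeomorphic_maps_map by blast
      fix x assume x: "x \<in> topspace X"
      have "inj_on a (topspace X)" using a by (auto simp: Bij_def bij_betw_def)
      moreover have "g x \<in> topspace X" "a (g x) = x"
        using g x by (auto simp: homeomorphic_maps_def continuous_map_def)
      ultimately show "g x = (\<lambda>x\<in>topspace X. (inv_into (topspace X) a) x) x"
        using x by (metis inv_into_f_f restrict_apply)
    qed
    ultimately show "inv\<^bsub>BijGroup (topspace X)\<^esub> a \<in> ?H"
      using a restrict_inv_into_Bij by auto
  next
    fix a b assume ab: "a \<in> ?H" "b \<in> ?H"
    have "homeomorphic_map X X (compose (topspace X) a b)"
      by (rule homeomorphic_map_eq[OF homeomorphic_map_compose[of X X b X a]])
        (use ab in \<open>auto simp: compose_def\<close>)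
    then show "a \<otimes>\<^bsub>BijGroup (topspace X)\<^esub> b \<in> ?H"
      using ab by (simp add: BijGroup_def compose_Bij)
  qed
qed

lemma group_homeo_group: "group (homeo_group X)"
  unfolding homeo_group_def
  using subgroup.subgroup_is_group[OF homeo_subgroup_BijGroup group_BijGroup] .

lemma homeo_group_mult:
  assumes "f \<in> carrier (homeo_group X)" "g \<in> carrier (homeo_group X)"
  shows "f \<otimes>\<^bsub>homeo_group X\<^esub> g = compose (topspace X) f g"
  using assms by (simp add: homeo_group_def BijGroup_def)

lemma homeo_group_one: "\<one>\<^bsub>homeo_group X\<^esub> = (\<lambda>x\<in>topspace X. x)"
  by (simp add: homeo_group_def BijGroup_def)

section \<open>Pushes whose support is a ball\<close>

definition push :: "'a::real_normed_vector \<Rightarrow> 'a \<Rightarrow> real \<Rightarrow> 'a \<Rightarrow> 'a"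
  where "push x v s z = z + max 0 (1 - dist z x / s) *\<^sub>R v"

text \<open>The tent function has slope \<open>1 / s\<close>, so its rate of change along
  \<open>v\<close> is at most \<open>norm v / s\<close>, which is below 1.\<close>

lemma push_in_G_gens:
  assumes s: "norm v < s"
  shows "push x v s \<in> G_gens"
proof -
  let ?l = "\<lambda>z. max 0 (1 - dist z x / s)"
  have s0: "s > 0" using s norm_ge_zero[of v] by linarith
  have lip: "\<bar>?l a - ?l b\<bar> \<le> (1 / s) * dist a b" for a b
  proof -
    have "\<bar>?l a - ?l b\<bar> \<le> \<bar>dist a x / s - dist b x / s\<bar>" by (auto simp: max_def)
    also have "\<dots> = \<bar>dist a x - dist b x\<bar> / s" using s0 by (simp flip: diff_divide_distrib)
    also have "\<bar>dist a x - dist b x\<bar> \<le> dist a b"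
      by (smt (verit) dist_commute dist_triangle)
    finally show ?thesis using s0 by (simp add: divide_right_mono)
  qed
  have "(\<lambda>z. z + ?l z *\<^sub>R v) \<in> G_gens"
  proof (rule shift_in_G_gens[where \<kappa> = "norm v / s" and x = x and r = s])
    show "norm v / s < 1" using s s0 by simp
    fix z t
    show "\<bar>?l (z + t *\<^sub>R v) - ?l z\<bar> \<le> norm v / s * \<bar>t\<bar>"
      using lip[of "z + t *\<^sub>R v" z] by (simp add: dist_norm mult.commute)
  next
    fix z
    show "\<exists>K \<delta>. \<delta> > 0 \<and> K \<ge> 0 \<and> (\<forall>a b. dist a z < \<delta> \<longrightarrow> dist b z < \<delta> \<longrightarrow> \<bar>?l a - ?l b\<bar> \<le> K * dist a b)"
      using lip s0 by (intro exI[of _ "1 / s"] exI[of _ 1]) auto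
  next
    fix z assume "?l z \<noteq> 0"
    then show "z \<in> cball x s" using s0 by (auto simp: max_def dist_commute field_simps split: if_splits)
  qed (use s0 in auto)
  then show ?thesis by (simp add: push_def[abs_def])
qed

lemma push_fixed_iff:
  assumes "s > 0" "v \<noteq> 0"
  shows "push x v s z \<noteq> z \<longleftrightarrow> z \<in> ball x s"
  using assms by (auto simp: push_def max_def dist_commute field_simps)

lemma push_center: "push x v s x = x + v"
  by (simp add: push_def)

section \<open>Finite-dimensional subspaces\<close>

lemma infdist_less_imp_ex:
  assumes "A \<noteq> {}" "infdist z A < e"
  shows "\<exists>a\<in>A. dist z a < e"
proof (rule ccontr)
  assume "\<not> ?thesis"
  then have "e \<le> infdist z A"
    using assms(1) by (auto simp: infdist_notempty not_less intro!: cINF_greatest)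
  then show False using assms(2) by simp
qed

lemma compact_combinations:
  fixes e :: "nat \<Rightarrow> 'a::real_normed_vector"
  shows "compact {(\<Sum>i<m. t i *\<^sub>R e i) | t. \<forall>i<m. \<bar>t i\<bar> \<le> A}"
proof (induction m)
  case 0
  have "{(\<Sum>i<0. t i *\<^sub>R e i) | t. \<forall>i<0. \<bar>t i\<bar> \<le> A} = {0}" by auto
  then show ?case by simp
next
  case (Suc m)
  let ?S = "{(\<Sum>i<m. t i *\<^sub>R e i) | t. \<forall>i<m. \<bar>t i\<bar> \<le> A}"
  have "{(\<Sum>i<Suc m. t i *\<^sub>R e i) | t. \<forall>i<Suc m. \<bar>t i\<bar> \<le> A}
      = (\<lambda>(s, u). s + u *\<^sub>R e m) ` (?S \<times> {-A..A})" (is "?L = ?R")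
  proof
    show "?L \<subseteq> ?R"
    proof
      fix z assume "z \<in> ?L"
      then obtain t where t: "z = (\<Sum>i<m. t i *\<^sub>R e i) + t m *\<^sub>R e m" "\<forall>i<Suc m. \<bar>t i\<bar> \<le> A"
        by auto
      then show "z \<in> ?R"
        by (intro image_eqI[of _ _ "(\<Sum>i<m. t i *\<^sub>R e i, t m)"]) (auto simp: abs_le_iff minus_le_iff)
    qed
    show "?R \<subseteq> ?L"
    proof
      fix z assume "z \<in> ?R"
      then obtain t u where t: "z = (\<Sum>i<m. t i *\<^sub>R e i) + u *\<^sub>R e m" "\<forall>i<m. \<bar>t i\<bar> \<le> A" "u \<in> {-A..A}"
        by auto
      then have "z = (\<Sum>i<Suc m. (t(m := u)) i *\<^sub>R e i)" "\<forall>i<Suc m. \<bar>(t(m := u)) i\<bar> \<le> A"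
        by (auto simp: less_Suc_eq)
      then show "z \<in> ?L" by blast
    qed
  qed
  moreover have "compact \<dots>"
    using Suc by (intro compact_continuous_image compact_Times)
      (auto simp: case_prod_unfold intro!: continuous_intros)
  ultimately show ?case by simp
qed

lemma combination_in_span: "(\<Sum>i<m. t i *\<^sub>R e i) \<in> span (e ` {..<m})"
  for e :: "nat \<Rightarrow> 'a::real_vector"
  by (intro span_sum span_scale span_base) auto

lemma span_combinations:
  fixes e :: "nat \<Rightarrow> 'a::real_vector"
  shows "span (e ` {..<m}) = range (\<lambda>t. \<Sum>i<m. t i *\<^sub>R e i)"
proof
  show "range (\<lambda>t. \<Sum>i<m. t i *\<^sub>R e i) \<subseteq> span (e ` {..<m})"
    using combination_in_span by blast
  show "span (e ` {..<m}) \<subseteq> range (\<lambda>t. \<Sum>i<m. t i *\<^sub>R e i)"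
  proof
    fix s assume "s \<in> span (e ` {..<m})"
    then have "\<exists>t. s = (\<Sum>i<m. t i *\<^sub>R e i)"
    proof (induction rule: span_induct_alt)
      case base
      then show ?case by (intro exI[of _ "\<lambda>_. 0"]) simp
    next
      case (step c x y)
      then obtain k t where k: "k < m" "x = e k" "y = (\<Sum>i<m. t i *\<^sub>R e i)" by auto
      have "(\<Sum>i<m. (if i = k then c else 0) *\<^sub>R e i) = (\<Sum>i<m. if i = k then c *\<^sub>R e i else 0)"
        by (rule sum.cong) auto
      also have "\<dots> = c *\<^sub>R e k" using k by simp
      finally have "c *\<^sub>R x + y = (\<Sum>i<m. ((if i = k then c else 0) + t i) *\<^sub>R e i)"
        using k by (simp add: scaleR_left_distrib sum.distrib)
      then show ?case by (rule exI[of _ "\<lambda>i. (if i = k then c else 0) + t i"])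
    qed
    then show "s \<in> range (\<lambda>t. \<Sum>i<m. t i *\<^sub>R e i)" by blast
  qed
qed

text \<open>Combinations of norm above \<open>2 * norm (e m) + 1\<close> have distance at least 1
  from \<open>e m\<close>; the others have bounded coefficients and so lie in a compact set that
  misses \<open>e m\<close>.\<close>

lemma dist_to_combinations:
  fixes e :: "nat \<Rightarrow> 'a::real_normed_vector"
  assumes "\<And>t j. j < m \<Longrightarrow> \<bar>t j\<bar> \<le> \<kappa> * norm (\<Sum>i<m. t i *\<^sub>R e i)" and "\<kappa> \<ge> 0"
    and em: "e m \<notin> span (e ` {..<m})"
  obtains d where "d > 0" "\<And>t. d \<le> dist (e m) (\<Sum>i<m. t i *\<^sub>R e i)"
proof -
  let ?B = "2 * norm (e m) + 1"
  define C where "C = {(\<Sum>i<m. t i *\<^sub>R e i) | t. \<forall>i<m. \<bar>t i\<bar> \<le> \<kappa> * ?B}"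
  have "closed C" unfolding C_def using compact_combinations by (rule compact_imp_closed)
  moreover have "e m \<notin> C" unfolding C_def using em combination_in_span[of _ e m] by auto
  ultimately obtain d where "d > 0" "ball (e m) d \<subseteq> - C"
    using openE[of "- C" "e m"] by auto
  then have d: "d > 0" "\<And>s. s \<in> C \<Longrightarrow> d \<le> dist (e m) s" by force+
  show thesis
  proof (rule that[of "min d 1"])
    show "min d 1 > 0" using d by auto
    fix t
    let ?s = "\<Sum>i<m. t i *\<^sub>R e i"
    show "min d 1 \<le> dist (e m) ?s"
    proof (cases "norm ?s \<le> ?B")
      case True
      have "\<bar>t i\<bar> \<le> \<kappa> * ?B" if "i < m" for i
        using assms(1)[OF that, of t] mult_left_mono[OF True assms(2)] by linarith
      then have "?s \<in> C" unfolding C_def by blast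
      then show ?thesis using d by fastforce
    next
      case False
      have "norm ?s \<le> norm (e m) + dist (e m) ?s"
        by (metis dist_norm norm_minus_commute norm_triangle_sub)
      then show ?thesis using False norm_ge_zero[of "e m"] by linarith
    qed
  qed
qed

text \<open>Induction: the distance from \<open>e m\<close> to the span of its predecessors controls
  the last coordinate, and subtracting the last term leads back to the previous case.\<close>

lemma coordinate_bound:
  fixes e :: "nat \<Rightarrow> 'a::real_normed_vector"
  assumes ind: "\<And>m. e m \<notin> span (e ` {..<m})"
  shows "\<exists>\<kappa>\<ge>0. \<forall>t. \<forall>j<m. \<bar>t j\<bar> \<le> \<kappa> * norm (\<Sum>i<m. t i *\<^sub>R e i)"
proof (induction m)
  case 0
  then show ?case by auto
next
  case (Suc m)
  then obtain \<kappa> where \<kappa>: "\<kappa> \<ge> 0" "\<And>t j. j < m \<Longrightarrow> \<bar>t j\<bar> \<le> \<kappa> * norm (\<Sum>i<m. t i *\<^sub>R e i)"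
    by blast
  obtain d where d: "d > 0" "\<And>t. d \<le> dist (e m) (\<Sum>i<m. t i *\<^sub>R e i)"
    using dist_to_combinations[of m \<kappa> e] \<kappa> ind by metis
  define \<kappa>' where "\<kappa>' = 1 / d + \<kappa> * (1 + norm (e m) / d)"
  have "\<bar>t j\<bar> \<le> \<kappa>' * norm (\<Sum>i<Suc m. t i *\<^sub>R e i)" if j: "j < Suc m" for t j
  proof -
    let ?s = "\<Sum>i<m. t i *\<^sub>R e i" and ?z = "\<Sum>i<Suc m. t i *\<^sub>R e i"
    have tm: "\<bar>t m\<bar> * d \<le> norm ?z"
    proof (cases "t m = 0")
      case False
      have "norm ?z = norm (t m *\<^sub>R (e m - (\<Sum>i<m. (- t i / t m) *\<^sub>R e i)))"
        using False by (simp add: algebra_simps scaleR_sum_right sum_negf)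
      also have "\<dots> = \<bar>t m\<bar> * dist (e m) (\<Sum>i<m. (- t i / t m) *\<^sub>R e i)"
        by (simp add: dist_norm)
      also have "\<dots> \<ge> \<bar>t m\<bar> * d"
        by (intro mult_left_mono d(2)) auto
      finally show ?thesis .
    qed auto
    then have tm': "\<bar>t m\<bar> \<le> norm ?z / d" using d by (simp add: pos_le_divide_eq)
    show ?thesis
    proof (cases "j = m")
      case True
      have "norm ?z / d \<le> \<kappa>' * norm ?z"
        unfolding \<kappa>'_def using \<kappa> d by (simp add: algebra_simps)
      then show ?thesis using tm' True by simp
    next
      case False
      have "norm ?s \<le> norm ?z + \<bar>t m\<bar> * norm (e m)"
        using norm_triangle_ineq4[of ?z "t m *\<^sub>R e m"] by simp
      also have "\<dots> \<le> norm ?z + norm ?z / d * norm (e m)"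
        using tm' by (intro add_left_mono mult_right_mono) auto
      finally have "\<kappa> * norm ?s \<le> \<kappa> * (norm ?z + norm ?z / d * norm (e m))"
        using \<kappa>(1) by (rule mult_left_mono)
      also have "\<dots> \<le> \<kappa>' * norm ?z"
        unfolding \<kappa>'_def using d by (simp add: algebra_simps)
      finally show ?thesis using \<kappa>(2)[of j t] False j by linarith
    qed
  qed
  moreover have "\<kappa>' \<ge> 0" unfolding \<kappa>'_def using \<kappa> d by auto
  ultimately show ?case by blast
qed

lemma independent_sequence:
  assumes "infinite_dimensional (UNIV :: 'a::real_vector set)"
  obtains e :: "nat \<Rightarrow> 'a::real_vector" where "\<And>m. e m \<notin> span (e ` {..<m})"
proof -
  have "\<exists>e :: nat \<Rightarrow> 'a. \<forall>m. e m \<notin> span (e ` {..<m})"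
  proof (rule dependent_wellorder_choice)
    fix r and f g :: "nat \<Rightarrow> 'a" and x :: nat
    assume "\<And>y. y < x \<Longrightarrow> f y = g y"
    then have "f ` {..<x} = g ` {..<x}" by auto
    then show "(r \<notin> span (f ` {..<x})) = (r \<notin> span (g ` {..<x}))" by simp
  next
    fix x :: nat and f :: "nat \<Rightarrow> 'a"
    show "\<exists>r. r \<notin> span (f ` {..<x})"
      using assms unfolding infinite_dimensional_def by blast
  qed
  then show thesis using that by blast
qed

text \<open>Riesz's lemma with constant 1/2: take a point \<open>s\<close> of the span whose
  distance to \<open>e m\<close> is less than twice the infimum, and normalise
  \<open>e m - s\<close>. This is what prevents balls from being totally bounded.\<close>

lemma separated_unit_sequence:
  assumes "infinite_dimensional (UNIV :: 'a::real_normed_vector set)"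
  shows "\<exists>x :: nat \<Rightarrow> 'a. (\<forall>n. norm (x n) = 1) \<and> (\<forall>m n. m \<noteq> n \<longrightarrow> 1 / 2 \<le> dist (x m) (x n))"
proof -
  obtain e :: "nat \<Rightarrow> 'a" where e: "\<And>m. e m \<notin> span (e ` {..<m})"
    using independent_sequence[OF assms] by blast
  have "\<exists>x. norm x = 1 \<and> x \<in> span (e ` {..<Suc m}) \<and> (\<forall>s\<in>span (e ` {..<m}). 1 / 2 \<le> dist x s)" for m
  proof -
    let ?S = "span (e ` {..<m})"
    obtain \<kappa> where \<kappa>: "\<kappa> \<ge> 0" "\<And>t j. j < m \<Longrightarrow> \<bar>t j\<bar> \<le> \<kappa> * norm (\<Sum>i<m. t i *\<^sub>R e i)"
      using coordinate_bound[OF e] by blast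
    obtain d where d: "d > 0" "\<And>t. d \<le> dist (e m) (\<Sum>i<m. t i *\<^sub>R e i)"
      using dist_to_combinations[of m \<kappa> e] \<kappa> e by metis
    define D where "D = infdist (e m) ?S"
    have ne: "?S \<noteq> {}" using span_zero by blast
    have dD: "d \<le> D"
      unfolding D_def infdist_notempty[OF ne]
    proof (rule cINF_greatest[OF ne])
      fix s assume "s \<in> ?S"
      then obtain t where "s = (\<Sum>i<m. t i *\<^sub>R e i)" unfolding span_combinations by blast
      then show "d \<le> dist (e m) s" using d(2)[of t] by simp
    qed
    then have D: "D > 0" using d by simp
    have "\<exists>s\<in>?S. dist (e m) s < 2 * D" using ne D by (intro infdist_less_imp_ex) (auto simp: D_def)
    then obtain s where s: "s \<in> ?S" "dist (e m) s < 2 * D" by blast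
    have Ds: "D \<le> dist (e m) s" unfolding D_def using s(1) by (rule infdist_le)
    let ?c = "1 / dist (e m) s"
    have c: "?c > 0" "dist (e m) s > 0" using D Ds by auto
    let ?x = "?c *\<^sub>R (e m - s)"
    have 1: "norm ?x = 1" using c by (simp add: dist_norm)
    have "e m \<in> span (e ` {..<Suc m})" by (intro span_base) auto
    moreover have "?S \<subseteq> span (e ` {..<Suc m})" by (intro span_mono) auto
    ultimately have 2: "?x \<in> span (e ` {..<Suc m})" using s by (intro span_scale span_diff) auto
    have "1 / 2 \<le> dist ?x w" if w: "w \<in> ?S" for w
    proof -
      have "s + (1 / ?c) *\<^sub>R w \<in> ?S" using s w by (intro span_add span_scale) auto
      then have "D \<le> dist (e m) (s + (1 / ?c) *\<^sub>R w)" unfolding D_def by (rule infdist_le)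
      moreover have "?x - w = ?c *\<^sub>R (e m - (s + (1 / ?c) *\<^sub>R w))"
        using c by (simp add: algebra_simps)
      then have "dist ?x w = ?c * dist (e m) (s + (1 / ?c) *\<^sub>R w)"
        using c by (simp add: dist_norm)
      ultimately have "?c * D \<le> dist ?x w" using c by (simp add: divide_right_mono)
      moreover have "1 / 2 \<le> ?c * D" using s c by (simp add: field_simps)
      ultimately show ?thesis by linarith
    qed
    then show ?thesis using 1 2 by blast
  qed
  then obtain x where x: "\<And>m. norm (x m) = 1" "\<And>m. x m \<in> span (e ` {..<Suc m})"
    "\<And>m s. s \<in> span (e ` {..<m}) \<Longrightarrow> 1 / 2 \<le> dist (x m) s"
    by metis
  have *: "1 / 2 \<le> dist (x m) (x n)" if "n < m" for m n
  proof (rule x(3))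
    have "span (e ` {..<Suc n}) \<subseteq> span (e ` {..<m})" using that by (intro span_mono) auto
    then show "x n \<in> span (e ` {..<m})" using x(2) by blast
  qed
  have "1 / 2 \<le> dist (x m) (x n)" if "m \<noteq> n" for m n
    using *[of m n] *[of n m] that by (cases "n < m") (auto simp: dist_commute)
  then show ?thesis using x(1) by blast
qed

section \<open>Sequences of supports shrinking to a point\<close>

locale open_homeos =
  fixes X :: "'a::real_normed_vector set" and H :: "('a \<Rightarrow> 'a) set"
  assumes inf_dim: "infinite_dimensional (UNIV :: 'a set)" and X_open: "open X"
    and pair: "space_group_pair (top_of_set X) H" and G_on_sub: "G_on X \<subseteq> H"
begin

definition M :: "('a \<Rightarrow> 'a) monoid"
  where "M = homeo_group (top_of_set X)\<lparr>carrier := H\<rparr>"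

lemma H_sub: "H \<subseteq> carrier (homeo_group (top_of_set X))"
  using pair subgroup.subset unfolding space_group_pair_def by blast

lemma carrier_M: "carrier M = H"
  by (simp add: M_def)

lemma vector_of_norm: "0 \<le> t \<Longrightarrow> \<exists>v::'a. norm v = t"
proof -
  assume t: "0 \<le> t"
  obtain x :: "nat \<Rightarrow> 'a" where "\<forall>n. norm (x n) = 1"
    using separated_unit_sequence[OF inf_dim] by blast
  then show ?thesis using t by (intro exI[of _ "t *\<^sub>R x 0"]) simp
qed

lemma G_gens_restrict:
  assumes "h \<in> G_gens" "\<And>z. h z \<noteq> z \<Longrightarrow> z \<in> X"
  shows "restrict h X \<in> H"
proof -
  have "restrict h X \<in> G_on X"
    unfolding G_on_def G_whole_def
  proof (intro CollectI exI[of _ h] conjI allI impI)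
    show "h \<in> generate (homeo_group euclidean) G_gens" using assms(1) by (rule generate.incl)
    show "h z = z" if "z \<notin> X" for z using that assms(2)[of z] by metis
  qed simp
  then show ?thesis using G_on_sub by blast
qed

definition pushX :: "'a \<Rightarrow> 'a \<Rightarrow> real \<Rightarrow> 'a \<Rightarrow> 'a"
  where "pushX x v s = restrict (push x v s) X"

lemma pushX_carrier:
  assumes "v \<noteq> 0" "norm v < s" "ball x s \<subseteq> X"
  shows "pushX x v s \<in> carrier M"
proof -
  have "s > 0" using assms norm_ge_zero[of v] by linarith
  then show ?thesis
    unfolding carrier_M pushX_def
    using G_gens_restrict[OF push_in_G_gens[OF assms(2)]] push_fixed_iff assms by blast
qed

sublocale locally_moving M X
proof -
  have gr: "group M"
    unfolding M_def using subgroup.subgroup_is_group[OF _ group_homeo_group] pair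
    by (simp add: space_group_pair_def)
  then interpret group M .
  have bij: "a \<in> Bij X" and hm: "homeomorphic_map (top_of_set X) (top_of_set X) a"
    if "a \<in> carrier M" for a
    using that H_sub carrier_homeo_group[of a "top_of_set X"] by (auto simp: carrier_M)
  have mult: "(a \<otimes>\<^bsub>M\<^esub> b) x = a (b x)" if "a \<in> carrier M" "b \<in> carrier M" "x \<in> X" for a b x
  proof -
    have "a \<otimes>\<^bsub>M\<^esub> b = compose X a b"
      using homeo_group_mult[of a "top_of_set X" b] that H_sub by (auto simp: M_def)
    then show ?thesis using that by (simp add: compose_def)
  qed
  have one: "\<one>\<^bsub>M\<^esub> = (\<lambda>x\<in>X. x)"
    by (simp add: M_def homeo_group_one)
  show "locally_moving M X"
  proof (unfold_locales)
    show "open X" by (rule X_open)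
    show "a x \<in> X" if "a \<in> carrier M" "x \<in> X" for a x
      using bij[OF that(1)] that Bij_imp_funcset by blast
    show "(a \<otimes>\<^bsub>M\<^esub> b) x = a (b x)" if "a \<in> carrier M" "b \<in> carrier M" "x \<in> X" for a b x
      using mult that .
    show "\<one>\<^bsub>M\<^esub> x = x" if "x \<in> X" for x using that one by simp
    show "a = \<one>\<^bsub>M\<^esub>" if "a \<in> carrier M" "\<And>x. x \<in> X \<Longrightarrow> a x = x" for a
      using that bij[OF that(1)] unfolding one
      by (intro extensionalityI[of _ X]) (auto simp: Bij_def)
    show "continuous_on X a" if "a \<in> carrier M" for a
      using homeomorphic_imp_continuous_map[OF hm[OF that]]
      by (simp add: continuous_map_in_subtopology)
    fix U :: "'a set" assume U: "open U" "U \<noteq> {}" "U \<subseteq> X"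
    then obtain x s where x: "x \<in> U" "s > 0" "ball x s \<subseteq> U" by (meson all_not_in_conv openE)
    obtain v :: 'a where v: "norm v = s / 2" using vector_of_norm[of "s / 2"] x by auto
    have v0: "v \<noteq> 0" and vs: "norm v < s" using v x by auto
    let ?g = "pushX x v s"
    have gc: "?g \<in> carrier M" using pushX_carrier v0 vs x U by blast
    have xX: "x \<in> X" using x U by blast
    \<comment> \<open>Each application adds a nonnegative multiple of \<open>v\<close>, and the
      first one adds \<open>v\<close> itself, so no iterate returns \<open>x\<close> to its
      place.\<close>
    have "\<exists>t. (?g [^]\<^bsub>M\<^esub> n) x = x + t *\<^sub>R v \<and> (n > 0 \<longrightarrow> t \<ge> 1)" for n :: nat
    proof (induction n)
      case 0
      then show ?case using xX one by (intro exI[of _ 0]) simp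
    next
      case (Suc n)
      then obtain t where t: "(?g [^]\<^bsub>M\<^esub> n) x = x + t *\<^sub>R v" "n > 0 \<longrightarrow> t \<ge> 1" by blast
      have tX: "x + t *\<^sub>R v \<in> X"
        using funcset_mem[OF Bij_imp_funcset[OF bij[OF nat_pow_closed[OF gc, of n]]] xX] t(1) by simp
      have "(?g [^]\<^bsub>M\<^esub> Suc n) x = ?g (x + t *\<^sub>R v)"
        unfolding nat_pow_Suc2[OF gc] using mult[OF gc nat_pow_closed[OF gc] xX] t(1) by simp
      also have "\<dots> = x + (t + max 0 (1 - dist (x + t *\<^sub>R v) x / s)) *\<^sub>R v"
        using tX by (simp add: pushX_def push_def algebra_simps)
      finally have eq: "(?g [^]\<^bsub>M\<^esub> Suc n) x = x + (t + max 0 (1 - dist (x + t *\<^sub>R v) x / s)) *\<^sub>R v" .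
      show ?case
      proof (cases "n = 0")
        case True
        then have "x + t *\<^sub>R v = x" using t(1) xX one by simp
        then have "t = 0" using v0 by simp
        then show ?thesis using eq by (intro exI[of _ 1]) simp
      next
        case False
        then show ?thesis
          using eq t(2) by (intro exI[of _ "t + max 0 (1 - dist (x + t *\<^sub>R v) x / s)"]) auto
      qed
    qed
    from this[of 12] obtain t where t: "(?g [^]\<^bsub>M\<^esub> (12::nat)) x = x + t *\<^sub>R v" "t \<ge> 1"
      by auto
    have "?g [^]\<^bsub>M\<^esub> (12::nat) \<noteq> \<one>\<^bsub>M\<^esub>"
    proof
      assume "?g [^]\<^bsub>M\<^esub> (12::nat) = \<one>\<^bsub>M\<^esub>"
      then have "x + t *\<^sub>R v = x" using t one xX by simp
      then show False using t v0 by simp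
    qed
    moreover have "{x \<in> X. ?g x \<noteq> x} \<subseteq> U"
      using x push_fixed_iff[OF x(2) v0] by (auto simp: pushX_def)
    ultimately show "\<exists>g\<in>carrier M. {x \<in> X. g x \<noteq> x} \<subseteq> U \<and> g [^]\<^bsub>M\<^esub> (12::nat) \<noteq> \<one>\<^bsub>M\<^esub>"
      using gc by blast
  qed
qed

lemma mv_pushX:
  assumes "v \<noteq> 0" "s > 0" "ball x s \<subseteq> X"
  shows "mv (pushX x v s) = ball x s"
  using assms push_fixed_iff[OF assms(2,1)] by (auto simp: mv_def pushX_def)

lemma ball_support:
  assumes "s > 0" "ball x s \<subseteq> X"
  shows "\<exists>g\<in>carrier M. mv g = ball x s"
proof -
  obtain v :: 'a where v: "norm v = s / 2" using vector_of_norm[of "s / 2"] assms(1) by auto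
  then have "v \<noteq> 0" "norm v < s" using assms(1) by auto
  then show ?thesis using pushX_carrier[OF _ _ assms(2)] mv_pushX[OF _ assms] by blast
qed

lemma pushX_center: "x \<in> X \<Longrightarrow> pushX x v s x = x + v"
  by (simp add: pushX_def push_center)

text \<open>Convergence of the supports as sets. The empty support of a trivial element would tend
  to every point, hence the nontriviality assumptions in \<open>tends_closure\<close> and
  \<open>tends_unique\<close>.\<close>

definition tends :: "(nat \<Rightarrow> 'a \<Rightarrow> 'a) \<Rightarrow> 'a \<Rightarrow> bool"
  where "tends f x \<longleftrightarrow> (\<forall>U. open U \<and> x \<in> U \<longrightarrow> (\<exists>n. \<forall>i\<ge>n. mv (f i) \<subseteq> U))"

lemma tendsD: "tends f x \<Longrightarrow> open U \<Longrightarrow> x \<in> U \<Longrightarrow> \<exists>n. \<forall>i\<ge>n. mv (f i) \<subseteq> U"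
  by (auto simp: tends_def)

lemma tends_ballI:
  assumes "\<And>e. e > 0 \<Longrightarrow> \<exists>n. \<forall>i\<ge>n. mv (f i) \<subseteq> ball x e"
  shows "tends f x"
  unfolding tends_def using assms by (meson openE subset_trans)

lemma tends_conjugate:
  assumes f: "\<And>i. f i \<in> carrier M" and g: "g \<in> carrier M" and x: "x \<in> X" and t: "tends f x"
  shows "tends (\<lambda>i. conjugate M g (f i)) (g x)"
  unfolding tends_def
proof (intro allI impI)
  fix U assume U: "open U \<and> g x \<in> U"
  then have "open (X \<inter> g -` U)" "x \<in> X \<inter> g -` U" using open_preimage g x by auto
  from tendsD[OF t this] obtain n where n: "\<And>i. i \<ge> n \<Longrightarrow> mv (f i) \<subseteq> X \<inter> g -` U" by blast
  then show "\<exists>n. \<forall>i\<ge>n. mv (conjugate M g (f i)) \<subseteq> U"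
    using mv_conjugate[OF g f] by (intro exI[of _ n] allI impI) fastforce
qed

lemma tends_closure:
  assumes f: "\<And>i. f i \<in> carrier M" "\<And>i. f i \<noteq> \<one>\<^bsub>M\<^esub>" and t: "tends f x" and U: "\<And>i. i \<ge> n \<Longrightarrow> mv (f i) \<subseteq> U"
  shows "x \<in> closure U"
proof (rule ccontr)
  assume "x \<notin> closure U"
  then obtain k where k: "\<forall>i\<ge>k. mv (f i) \<subseteq> - closure U"
    using tendsD[OF t, of "- closure U"] by auto
  then have "mv (f (max n k)) \<subseteq> - closure U" "mv (f (max n k)) \<subseteq> U" using U by auto
  then have "mv (f (max n k)) = {}" using closure_subset by blast
  then show False using f mv_empty by blast
qed

lemma tends_unique:
  assumes f: "\<And>i. f i \<in> carrier M" "\<And>i. f i \<noteq> \<one>\<^bsub>M\<^esub>" and t: "tends f x" "tends f y"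
  shows "x = y"
proof (rule ccontr)
  assume "x \<noteq> y"
  then obtain U V where UV: "open U" "open V" "x \<in> U" "y \<in> V" "U \<inter> V = {}" using hausdorff by metis
  obtain n where "\<forall>i\<ge>n. mv (f i) \<subseteq> U" using tendsD[OF t(1)] UV by blast
  then have "y \<in> closure U" using tends_closure[OF f t(2)] by blast
  then show False using UV open_Int_closure_eq_empty by (metis Int_commute disjoint_iff)
qed

lemma move_center:
  assumes x: "ball x s \<subseteq> X" and w: "w \<in> ball x s"
  shows "\<exists>g\<in>carrier M. g x = w \<and> mv g \<subseteq> ball x s"
proof -
  have "dist x w < s" using w by simp
  then have s: "s > 0" using zero_le_dist[of x w] by linarith
  then have xX: "x \<in> X" using x by auto
  show ?thesis
  proof (cases "w = x")
    case True
    then show ?thesis using one_apply xX mv_empty[of "\<one>\<^bsub>M\<^esub>"]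
      by (intro bexI[of _ "\<one>\<^bsub>M\<^esub>"]) auto
  next
    case False
    then have "w - x \<noteq> 0" "norm (w - x) < s" using w by (auto simp: dist_norm norm_minus_commute)
    then show ?thesis
      using pushX_center[OF xX, of "w - x" s] pushX_carrier[OF _ _ x] mv_pushX[OF _ s x]
      by (intro bexI[of _ "pushX x (w - x) s"]) auto
  qed
qed

text \<open>Balls around \<open>x\<close> with radii tending to 0 serve as supports. If
  \<open>g\<close> fixes \<open>x\<close>, the conjugates shrink to \<open>x\<close> as well and fit
  into every ball; otherwise \<open>x\<close> and \<open>g x\<close> have disjoint neighbourhoods.
  For the last clause \<open>w\<close> is \<open>f 0\<close>: a nontrivial element that it covers
  moves a point of the first ball, and a push takes \<open>x\<close> to that point.\<close>

lemma point_seq_exists: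
  assumes x: "x \<in> X"
  shows "\<exists>f. point_seq M f \<and> tends f x"
proof -
  obtain \<rho> where \<rho>: "\<rho> > 0" "ball x \<rho> \<subseteq> X" using X_open x openE by blast
  define s where "s i = \<rho> / (real i + 1)" for i :: nat
  have s: "s i > 0" "s i \<le> \<rho>" "s (Suc i) \<le> s i" for i
    using \<rho> by (auto simp: s_def field_simps)
  have s0: "\<exists>n. \<forall>i\<ge>n. s i < e" if e: "e > 0" for e
  proof -
    obtain n :: nat where n: "\<rho> / e < real n" using reals_Archimedean2 by blast
    have "s i < e" if "i \<ge> n" for i
    proof -
      have "\<rho> / e < real i + 1" using n that by simp
      then show ?thesis using e by (simp add: s_def field_simps)
    qed
    then show ?thesis by blast
  qed
  have bX: "ball x (s i) \<subseteq> X" for i using s(2)[of i] \<rho> by (meson subset_ball subset_trans)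
  have "\<exists>g. g \<in> carrier M \<and> mv g = ball x (s i)" for i using ball_support[OF s(1) bX] by blast
  then obtain f where f: "\<And>i. f i \<in> carrier M" "\<And>i. mv (f i) = ball x (s i)" by metis
  have f1: "f i \<noteq> \<one>\<^bsub>M\<^esub>" for i
    using f[of i] mv_empty[of "f i"] s(1)[of i] by auto
  have t: "tends f x"
  proof (rule tends_ballI)
    fix e :: real assume "e > 0"
    then obtain n where "\<forall>i\<ge>n. s i < e" using s0 by blast
    then show "\<exists>n. \<forall>i\<ge>n. mv (f i) \<subseteq> ball x e"
      using f(2) by (intro exI[of _ n]) (auto simp: subset_ball less_imp_le)
  qed
  have "covers M (f i) (f (Suc i))" for i
    unfolding covers_iff[OF f(1) f(1)] f(2)
    using subset_ball[OF s(3)[of i]] closure_subset[of "ball x (s i)"] by (rule subset_trans)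
  moreover have "(\<exists>i. apart M (conjugate M g (f i)) (f i)) \<or>
       (\<forall>i. \<exists>j. covers M (f i) (conjugate M g (f j)))" if g: "g \<in> carrier M" for g
  proof (cases "g x = x")
    case True
    have "\<exists>j. covers M (f i) (conjugate M g (f j))" for i
    proof -
      have "tends (\<lambda>i. conjugate M g (f i)) x"
        using tends_conjugate[OF f(1) g x t] True by simp
      then obtain j where "mv (conjugate M g (f j)) \<subseteq> ball x (s i)"
        using tendsD[OF _ open_ball] s(1)[of i] centre_in_ball by blast
      then have "mv (conjugate M g (f j)) \<subseteq> closure (mv (f i))"
        using f(2) closure_subset by (metis subset_trans)
      then show ?thesis using covers_iff[OF f(1) conjugate_closed[OF g f(1)]] by blast
    qed
    then show ?thesis by blast
  next
    case False
    then obtain U V where UV: "open U" "open V" "g x \<in> U" "x \<in> V" "U \<inter> V = {}" using hausdorff by metis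
    obtain n where n: "\<And>i. i \<ge> n \<Longrightarrow> mv (conjugate M g (f i)) \<subseteq> U"
      using tendsD[OF tends_conjugate[OF f(1) g x t]] UV by blast
    obtain m where m: "\<And>i. i \<ge> m \<Longrightarrow> mv (f i) \<subseteq> V" using tendsD[OF t] UV by blast
    have "apart M (conjugate M g (f (max n m))) (f (max n m))"
      unfolding apart_iff[OF conjugate_closed[OF g f(1)] f(1)]
      using n[of "max n m"] m[of "max n m"] UV(5) by auto
    then show ?thesis by blast
  qed
  moreover have "\<exists>g\<in>carrier M. \<exists>i. covers M u (conjugate M g (f i))"
    if u: "u \<in> carrier M" "u \<noteq> \<one>\<^bsub>M\<^esub>" "covers M (f 0) u" for u
  proof -
    have "mv u \<subseteq> closure (ball x (s 0))" using covers_iff[OF f(1) u(1)] u(3) f(2) by metis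
    moreover have "mv u \<noteq> {}" using u mv_empty[OF u(1)] by simp
    ultimately have "mv u \<inter> ball x (s 0) \<noteq> {}"
      using open_Int_closure_eq_empty[OF open_mv[OF u(1)], of "ball x (s 0)"] by auto
    then obtain w where w: "w \<in> mv u" "w \<in> ball x (s 0)" by blast
    obtain g where g: "g \<in> carrier M" "g x = w" using move_center[OF bX w(2)] by blast
    have "tends (\<lambda>i. conjugate M g (f i)) w" using tends_conjugate[OF f(1) g(1) x t] g by simp
    then obtain n where "mv (conjugate M g (f n)) \<subseteq> mv u"
      using tendsD[OF _ open_mv[OF u(1)] w(1)] by blast
    then have "mv (conjugate M g (f n)) \<subseteq> closure (mv u)" using closure_subset by blast
    then have "covers M u (conjugate M g (f n))"
      using covers_iff[OF u(1) conjugate_closed[OF g(1) f(1)]] by blast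
    then show ?thesis using g(1) by blast
  qed
  moreover have "f 0 \<in> carrier M \<and> f 0 \<noteq> \<one>\<^bsub>M\<^esub>" using f(1) f1 by blast
  ultimately have "point_seq M f"
    unfolding point_seq_def using f(1) f1 by (intro conjI allI ballI bexI[of _ "f 0"]) auto
  then show ?thesis using t by blast
qed

end

section \<open>Parallel lines through the points of a sequence\<close>

lemma line_limit:
  fixes v z :: "'a::real_normed_vector" and y :: "nat \<Rightarrow> 'a"
  assumes v: "v \<noteq> 0" and y: "\<And>n. norm (y n) \<le> B"
    and d: "\<And>n. dist z (y n + t n *\<^sub>R v) < 1 / (real n + 1)"
  obtains r u where "strict_mono r" "(\<lambda>n. y (r n)) \<longlonglongrightarrow> z - u *\<^sub>R v"
proof -
  \<comment> \<open>\<open>A\<close> bounds the parameters \<open>t n\<close>, because both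
    \<open>y n\<close> and the point reached from it stay bounded. Compactness is thus used only for
    an interval of reals.\<close>
  define A where "A = (norm z + B + 1) / norm v"
  have tA: "t n \<in> {-A..A}" for n
  proof -
    have "norm (t n *\<^sub>R v) \<le> norm z + norm (y n) + dist z (y n + t n *\<^sub>R v)"
    proof -
      have "t n *\<^sub>R v = (z - y n) - (z - (y n + t n *\<^sub>R v))" by simp
      then have "norm (t n *\<^sub>R v) \<le> norm (z - y n) + norm (z - (y n + t n *\<^sub>R v))"
        by (metis norm_triangle_ineq4)
      moreover have "norm (z - y n) \<le> norm z + norm (y n)" by (rule norm_triangle_ineq4)
      ultimately show ?thesis by (simp add: dist_norm)
    qed
    moreover have "1 / (real n + 1) \<le> 1" by simp
    ultimately have "norm (t n *\<^sub>R v) \<le> norm z + B + 1" using y[of n] d[of n] by linarith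
    then have "\<bar>t n\<bar> * norm v \<le> norm z + B + 1" by simp
    then have "\<bar>t n\<bar> \<le> A" unfolding A_def using v by (simp add: pos_le_divide_eq)
    then show ?thesis by auto
  qed
  have "seq_compact {-A..A}" by (rule compact_imp_seq_compact) simp
  then obtain u r where r: "strict_mono r" "(t \<circ> r) \<longlonglongrightarrow> u"
    by (rule seq_compactE[of _ t]) (use tA in auto)
  have "(\<lambda>n. inverse (real (Suc n))) \<longlonglongrightarrow> 0" by (rule LIMSEQ_inverse_real_of_nat)
  then have "(\<lambda>n. z - (y n + t n *\<^sub>R v)) \<longlonglongrightarrow> 0"
    by (rule Lim_null_comparison[rotated])
      (use d in \<open>auto intro!: always_eventually less_imp_le simp: dist_norm inverse_eq_divide add.commute\<close>)
  then have "(\<lambda>n. z - (y (r n) + t (r n) *\<^sub>R v)) \<longlonglongrightarrow> 0"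
    using LIMSEQ_subseq_LIMSEQ[OF _ r(1)] by (auto simp: o_def)
  moreover have "(\<lambda>n. t (r n) *\<^sub>R v) \<longlonglongrightarrow> u *\<^sub>R v"
    using r(2) by (intro tendsto_intros) (simp add: o_def)
  ultimately have "(\<lambda>n. z - (z - (y (r n) + t (r n) *\<^sub>R v)) - t (r n) *\<^sub>R v) \<longlonglongrightarrow> z - 0 - u *\<^sub>R v"
    by (intro tendsto_diff tendsto_const)
  then show thesis using r(1) that by simp
qed

text \<open>If the lines came arbitrarily close to \<open>z\<close>, then by
  \<open>line_limit\<close> a sequence of the \<open>y i\<close> with indices tending to infinity
  would converge to a point of the line through \<open>z\<close>.\<close>

lemma lines_locally_finite:
  fixes v :: "'a::real_normed_vector" and y :: "nat \<Rightarrow> 'a"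
  assumes v: "v \<noteq> 0" and y: "\<And>n. norm (y n) \<le> B"
    and acc: "\<And>l. \<exists>e>0. \<exists>n. \<forall>i\<ge>n. e \<le> dist (y i) l"
  shows "\<exists>\<epsilon>>0. \<exists>N. \<forall>i\<ge>N. \<epsilon> \<le> infdist z (range (\<lambda>t. y i + t *\<^sub>R v))"
proof (rule ccontr)
  assume neg: "\<not> ?thesis"
  have "\<exists>i\<ge>n. \<exists>t. dist z (y i + t *\<^sub>R v) < 1 / (real n + 1)" for n :: nat
  proof -
    have "1 / (real n + 1) > 0" by simp
    then have "\<not> (\<forall>i\<ge>n. 1 / (real n + 1) \<le> infdist z (range (\<lambda>t. y i + t *\<^sub>R v)))"
      using neg by blast
    then obtain i where i: "i \<ge> n" "infdist z (range (\<lambda>t. y i + t *\<^sub>R v)) < 1 / (real n + 1)"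
      by (auto simp: not_le)
    from infdist_less_imp_ex[OF _ i(2)] have "\<exists>t. dist z (y i + t *\<^sub>R v) < 1 / (real n + 1)" by auto
    then show ?thesis using i by blast
  qed
  then obtain k t where k: "\<And>n. k n \<ge> n" "\<And>n. dist z (y (k n) + t n *\<^sub>R v) < 1 / (real n + 1)"
    by metis
  obtain r u where r: "strict_mono r" "(\<lambda>n. y (k (r n))) \<longlonglongrightarrow> z - u *\<^sub>R v"
    by (rule line_limit[of v "\<lambda>n. y (k n)" B z t]) (use v y k in auto)
  obtain e n where e: "e > 0" "\<And>i. i \<ge> n \<Longrightarrow> e \<le> dist (y i) (z - u *\<^sub>R v)"
    using acc by blast
  have "\<forall>\<^sub>F m in sequentially. dist (y (k (r m))) (z - u *\<^sub>R v) < e"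
    using r(2) e(1) by (rule tendstoD)
  moreover have "\<forall>\<^sub>F m in sequentially. m \<ge> n" by (rule eventually_ge_at_top)
  ultimately have "\<forall>\<^sub>F m in sequentially. False"
  proof eventually_elim
    case (elim m)
    have "k (r m) \<ge> n" using k(1)[of "r m"] seq_suble[OF r(1), of m] elim by linarith
    then show False using e(2) elim by force
  qed
  then show False by simp
qed

text \<open>Lines are closed, by \<open>line_limit\<close> for a constant sequence.\<close>

lemma line_infdist_zero:
  fixes v :: "'a::real_normed_vector"
  assumes v: "v \<noteq> 0" and z: "infdist z (range (\<lambda>t. y + t *\<^sub>R v)) = 0"
  shows "range (\<lambda>t. z + t *\<^sub>R v) = range (\<lambda>t. y + t *\<^sub>R v)"
proof -
  have "\<exists>t. dist z (y + t *\<^sub>R v) < 1 / (real n + 1)" for n :: nat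
    using infdist_less_imp_ex[of "range (\<lambda>t. y + t *\<^sub>R v)" z "1 / (real n + 1)"] z by auto
  then obtain t where t: "\<And>n. dist z (y + t n *\<^sub>R v) < 1 / (real n + 1)" by metis
  obtain r u where r: "strict_mono (r :: nat \<Rightarrow> nat)" "(\<lambda>n::nat. y) \<longlonglongrightarrow> z - u *\<^sub>R v"
    by (rule line_limit[of v "\<lambda>n. y" "norm y" z t]) (use v t in auto)
  have "z - u *\<^sub>R v = y" using LIMSEQ_unique[OF r(2) tendsto_const] by simp
  then have zu: "z = y + u *\<^sub>R v" by (metis diff_add_cancel)
  have "z + t *\<^sub>R v \<in> range (\<lambda>t. y + t *\<^sub>R v)" for t
    by (rule range_eqI[of _ _ "u + t"]) (simp add: zu algebra_simps)
  moreover have "y + t *\<^sub>R v \<in> range (\<lambda>t. z + t *\<^sub>R v)" for t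
    by (rule range_eqI[of _ _ "t - u"]) (simp add: zu algebra_simps)
  ultimately show ?thesis by blast
qed

lemma infdist_translation_invariant:
  fixes v :: "'a::real_normed_vector"
  assumes A: "\<And>a t. a \<in> A \<Longrightarrow> a + t *\<^sub>R v \<in> A"
  shows "infdist (z + t *\<^sub>R v) A = infdist z A"
proof (cases "A = {}")
  case False
  have le: "infdist (z + t *\<^sub>R v) A \<le> infdist z A" for z t
  proof -
    have "infdist (z + t *\<^sub>R v) A \<le> dist z a" if "a \<in> A" for a
      using infdist_le[OF A[OF that, of t], of "z + t *\<^sub>R v"] by (simp add: dist_norm)
    then show ?thesis
      unfolding infdist_notempty[OF False, of z] using False by (intro cINF_greatest) auto
  qed
  show ?thesis using le[of z t] le[of "z + t *\<^sub>R v" "- t"] by simp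
qed (simp add: infdist_def)

text \<open>The numerator of the difference is at most \<open>(a + b) * D\<close>, so the first
  denominator cancels and the bound depends on the second one alone.\<close>

lemma ratio_lipschitz:
  fixes a a' b b' D m :: real
  assumes "0 \<le> a" "0 \<le> b" "0 < a + b" "0 < m" "m \<le> a' + b'" "\<bar>a - a'\<bar> \<le> D" "\<bar>b - b'\<bar> \<le> D"
  shows "\<bar>a / (a + b) - a' / (a' + b')\<bar> \<le> D / m"
proof -
  have D: "D \<ge> 0" using assms by linarith
  have p: "0 < a' + b'" using assms by linarith
  have "a / (a + b) - a' / (a' + b') = (a * (b' - b) + b * (a - a')) / ((a + b) * (a' + b'))"
    using assms p by (simp add: divide_simps) (simp add: algebra_simps)
  moreover have "\<bar>a * (b' - b) + b * (a - a')\<bar> \<le> (a + b) * D"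
  proof -
    have "\<bar>a * (b' - b) + b * (a - a')\<bar> \<le> \<bar>a * (b' - b)\<bar> + \<bar>b * (a - a')\<bar>"
      by (rule abs_triangle_ineq)
    also have "\<dots> = a * \<bar>b - b'\<bar> + b * \<bar>a - a'\<bar>"
      using assms(1,2) by (simp add: abs_mult abs_minus_commute)
    also have "\<dots> \<le> a * D + b * D" using assms by (intro add_mono mult_left_mono) auto
    finally show ?thesis by (simp add: algebra_simps)
  qed
  moreover have "0 < (a + b) * (a' + b')" using assms(3) p by simp
  ultimately have "\<bar>a / (a + b) - a' / (a' + b')\<bar> \<le> (a + b) * D / ((a + b) * (a' + b'))"
    by (simp only: abs_divide abs_of_pos) (intro divide_right_mono, auto)
  also have "\<dots> = D / (a' + b')" using assms by simp
  also have "\<dots> \<le> D / m" using assms D by (intro divide_left_mono) auto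
  finally show ?thesis .
qed

text \<open>The weight is a ratio of distances to the two families of lines. It is only locally Lipschitz, so that
  the lines may come arbitrarily close to each other; this happens when they converge to a line of the
  completion of the space.\<close>

lemma separating_shift:
  fixes v p :: "'a::real_normed_vector"
  assumes \<rho>: "\<rho> > 0" and v: "norm v = 3 * \<rho>"
    and A: "\<And>a t. a \<in> A \<Longrightarrow> a + t *\<^sub>R v \<in> A" and B: "\<And>b t. b \<in> B \<Longrightarrow> b + t *\<^sub>R v \<in> B"
    and ne: "A \<noteq> {}" "B \<noteq> {}"
    and pos: "\<And>z. 0 < infdist z A + infdist z B"
    and x: "x \<in> A" "x \<in> ball p \<rho>"
  shows "\<exists>h\<in>G_gens. (\<forall>z. h z \<noteq> z \<longrightarrow> z \<in> ball p (5 * \<rho>)) \<and> (\<forall>z\<in>B. h z = z) \<and>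
    (\<forall>z\<in>A \<inter> ball p \<rho>. h z = z + v)"
proof -
  let ?a = "\<lambda>z. infdist z A" and ?b = "\<lambda>z. infdist z B"
  \<comment> \<open>\<open>\<theta>\<close> is 1 on \<open>A\<close>, 0 on \<open>B\<close> and
    constant along \<open>v\<close>, so only the cutoff \<open>\<beta>\<close> varies in that
    direction. It falls from 1 to 0 between the radii \<open>\<rho>\<close> and
    \<open>5 * \<rho>\<close>; with \<open>norm v = 3 * \<rho>\<close> the rate is 3/4.\<close>
  define \<theta> where "\<theta> z = ?b z / (?b z + ?a z)" for z
  define \<beta> where "\<beta> z = max 0 (min 1 ((5 * \<rho> - dist z p) / (4 * \<rho>)))" for z
  have \<theta>01: "0 \<le> \<theta> z" "\<theta> z \<le> 1" for z
    using pos[of z] infdist_nonneg[of z A] infdist_nonneg[of z B] by (auto simp: \<theta>_def divide_simps)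
  have \<beta>01: "0 \<le> \<beta> z" "\<beta> z \<le> 1" for z by (auto simp: \<beta>_def)
  have \<theta>v: "\<theta> (z + t *\<^sub>R v) = \<theta> z" for z t
    unfolding \<theta>_def
    using infdist_translation_invariant[of A v z t] infdist_translation_invariant[of B v z t] A B by simp
  have \<beta>lip: "\<bar>\<beta> z - \<beta> w\<bar> \<le> dist z w / (4 * \<rho>)" for z w
  proof -
    have "\<bar>\<beta> z - \<beta> w\<bar> \<le> \<bar>(5 * \<rho> - dist z p) / (4 * \<rho>) - (5 * \<rho> - dist w p) / (4 * \<rho>)\<bar>"
      unfolding \<beta>_def by (auto simp: max_def min_def)
    also have "\<dots> = \<bar>dist w p - dist z p\<bar> / (4 * \<rho>)"
      using \<rho> by (simp flip: diff_divide_distrib)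
    also have "\<bar>dist w p - dist z p\<bar> \<le> dist z w"
      using dist_triangle[of w p z] dist_triangle[of z p w] by (simp add: dist_commute abs_le_iff)
    finally show ?thesis using \<rho> by (simp add: divide_right_mono)
  qed
  let ?l = "\<lambda>z. \<theta> z * \<beta> z"
  have "(\<lambda>z. z + ?l z *\<^sub>R v) \<in> G_gens"
  proof (rule shift_in_G_gens[where \<kappa> = "3/4" and x = x and r = "6 * \<rho>"])
    show "0 \<le> ?l z" for z using \<theta>01 \<beta>01 by simp
    show "?l z \<le> 1" for z using \<theta>01 \<beta>01 by (simp add: mult_le_one)
    show "\<bar>?l (z + t *\<^sub>R v) - ?l z\<bar> \<le> 3 / 4 * \<bar>t\<bar>" for z t
    proof -
      have "\<bar>?l (z + t *\<^sub>R v) - ?l z\<bar> = \<theta> z * \<bar>\<beta> (z + t *\<^sub>R v) - \<beta> z\<bar>"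
        unfolding \<theta>v using \<theta>01[of z] by (simp add: abs_mult flip: right_diff_distrib)
      also have "\<dots> \<le> 1 * \<bar>\<beta> (z + t *\<^sub>R v) - \<beta> z\<bar>" using \<theta>01 by (intro mult_right_mono) auto
      also have "\<dots> \<le> dist (z + t *\<^sub>R v) z / (4 * \<rho>)" using \<beta>lip by simp
      also have "\<dots> = 3 / 4 * \<bar>t\<bar>" using \<rho> v by (simp add: dist_norm)
      finally show ?thesis .
    qed
    show "\<exists>K \<delta>. \<delta> > 0 \<and> K \<ge> 0 \<and>
      (\<forall>a b. dist a z < \<delta> \<longrightarrow> dist b z < \<delta> \<longrightarrow> \<bar>?l a - ?l b\<bar> \<le> K * dist a b)" for z
    proof (intro exI conjI allI impI)
      \<comment> \<open>Within \<open>?m / 4\<close> of \<open>z\<close> each of the two distances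
        changes by less than \<open>?m / 4\<close>, so their sum stays above
        \<open>?m / 2\<close>.\<close>
      let ?m = "?b z + ?a z"
      have m: "?m > 0" using pos[of z] by simp
      show "?m / 4 > 0" "1 / (?m / 2) + 1 / (4 * \<rho>) \<ge> 0" using m \<rho> by auto
      fix a b assume ab: "dist a z < ?m / 4" "dist b z < ?m / 4"
      have inf: "\<bar>infdist a S - infdist b S\<bar> \<le> dist a b" for S :: "'a set" and a b
        using infdist_triangle[of a S b] infdist_triangle[of b S a] by (simp add: dist_commute)
      have "?m / 2 \<le> ?b b + ?a b"
        using inf[of b A z] inf[of b B z] ab unfolding abs_le_iff by argo
      then have "\<bar>\<theta> a - \<theta> b\<bar> \<le> dist a b / (?m / 2)"
        unfolding \<theta>_def using m inf[of a A b] inf[of a B b] pos[of a]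
        by (intro ratio_lipschitz) (auto simp: infdist_nonneg)
      moreover have "\<bar>?l a - ?l b\<bar> \<le> \<bar>\<theta> a - \<theta> b\<bar> + \<bar>\<beta> a - \<beta> b\<bar>"
      proof -
        have "?l a - ?l b = (\<theta> a - \<theta> b) * \<beta> a + \<theta> b * (\<beta> a - \<beta> b)" by (simp add: algebra_simps)
        then have "\<bar>?l a - ?l b\<bar> \<le> \<bar>\<theta> a - \<theta> b\<bar> * \<beta> a + \<theta> b * \<bar>\<beta> a - \<beta> b\<bar>"
          using \<theta>01[of b] \<beta>01[of a] by (metis abs_mult abs_of_nonneg abs_triangle_ineq)
        also have "\<dots> \<le> \<bar>\<theta> a - \<theta> b\<bar> * 1 + 1 * \<bar>\<beta> a - \<beta> b\<bar>"
          using \<theta>01[of b] \<beta>01[of a] by (intro add_mono mult_mono) auto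
        finally show ?thesis by simp
      qed
      ultimately show "\<bar>?l a - ?l b\<bar> \<le> (1 / (?m / 2) + 1 / (4 * \<rho>)) * dist a b"
        using \<beta>lip[of a b] by (simp add: distrib_right)
    qed
    have "infdist x A = 0" using x by simp
    moreover have "\<beta> x = 1" using x \<rho> by (auto simp: \<beta>_def dist_commute divide_simps)
    ultimately show "?l x = 1" using pos[of x] by (simp add: \<theta>_def)
    show "6 * \<rho> > 0" using \<rho> by simp
    fix z assume "?l z \<noteq> 0"
    then have "\<beta> z \<noteq> 0" by auto
    then have "dist z p < 5 * \<rho>" using \<rho> by (auto simp: \<beta>_def max_def min_def divide_simps split: if_splits)
    then show "z \<in> cball x (6 * \<rho>)"
      using x dist_triangle[of x z p] by (auto simp: dist_commute)
  qed simp_all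
  moreover have "z \<in> ball p (5 * \<rho>)" if "z + ?l z *\<^sub>R v \<noteq> z" for z
  proof -
    have "\<beta> z \<noteq> 0" using that by auto
    then show ?thesis using \<rho> by (auto simp: \<beta>_def max_def min_def divide_simps dist_commute split: if_splits)
  qed
  moreover have "z + ?l z *\<^sub>R v = z" if "z \<in> B" for z
    using that by (simp add: \<theta>_def)
  moreover have "z + ?l z *\<^sub>R v = z + v" if "z \<in> A \<inter> ball p \<rho>" for z
  proof -
    have "infdist z A = 0" "\<beta> z = 1" using that \<rho> by (auto simp: \<beta>_def dist_commute divide_simps)
    then show ?thesis using pos[of z] by (simp add: \<theta>_def)
  qed
  ultimately show ?thesis by (intro bexI[of _ "\<lambda>z. z + ?l z *\<^sub>R v"]) auto
qed

context open_homeos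
begin

text \<open>The distinct lines through the \<open>y i\<close> are dealt alternately to two families,
  to which \<open>separating_shift\<close> is applied. The length \<open>3 * \<rho>\<close> of the
  shift exceeds the diameter of the ball, so every shifted \<open>y i\<close> leaves it.\<close>

lemma separating_element:
  fixes y :: "nat \<Rightarrow> 'a"
  assumes \<rho>: "\<rho> > 0" "ball p (10 * \<rho>) \<subseteq> X" and y: "\<And>i. y i \<in> ball p \<rho>"
    and acc: "\<And>l. \<exists>e>0. \<exists>n. \<forall>i\<ge>n. e \<le> dist (y i) l"
  shows "\<exists>g\<in>carrier M. (\<forall>n. \<exists>i\<ge>n. g (y i) = y i) \<and> (\<forall>n. \<exists>i\<ge>n. g (y i) \<notin> cball p \<rho>)"
proof -
  obtain v :: 'a where v: "norm v = 3 * \<rho>" using vector_of_norm[of "3 * \<rho>"] \<rho> by auto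
  have v0: "v \<noteq> 0" using v \<rho> by auto
  define L where "L i = range (\<lambda>t. y i + t *\<^sub>R v)" for i
  have yB: "norm (y i) \<le> norm p + \<rho>" for i
  proof -
    have "norm (y i) \<le> norm p + dist p (y i)"
      by (metis dist_norm norm_minus_commute norm_triangle_sub)
    then show ?thesis using y[of i] by simp
  qed
  have yL: "y i \<in> L i" for i unfolding L_def by (rule range_eqI[of _ _ 0]) simp
  have lf: "\<exists>\<epsilon>>0. \<exists>N. \<forall>i\<ge>N. \<epsilon> \<le> infdist z (L i)" for z
    unfolding L_def using lines_locally_finite[OF v0 yB acc] .
  have zero: "L i = range (\<lambda>t. z + t *\<^sub>R v)" if "infdist z (L i) = 0" for z i
    using line_infdist_zero[OF v0, of z "y i"] that unfolding L_def by simp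
  \<comment> \<open>Only finitely many lines come near \<open>z\<close>, so a line that is close
    enough to \<open>z\<close> has distance 0. Hence distance 0 from an infinite union of lines is
    distance 0 from one of them, see \<open>near\<close>.\<close>
  have gap: "\<exists>\<epsilon>>0. \<forall>i. infdist z (L i) < \<epsilon> \<longrightarrow> infdist z (L i) = 0" for z
  proof -
    obtain \<epsilon> N where \<epsilon>: "\<epsilon> > 0" "\<And>i. i \<ge> N \<Longrightarrow> \<epsilon> \<le> infdist z (L i)" using lf by blast
    let ?S = "insert \<epsilon> ((\<lambda>i. infdist z (L i)) ` {i. i < N \<and> infdist z (L i) > 0})"
    have fin: "finite ?S" by simp
    have "Min ?S > 0" using fin \<epsilon> by (subst Min_gr_iff) auto
    moreover have "infdist z (L i) = 0" if "infdist z (L i) < Min ?S" for i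
    proof (rule ccontr)
      assume "infdist z (L i) \<noteq> 0"
      then have p: "infdist z (L i) > 0" using infdist_nonneg[of z "L i"] by simp
      have "Min ?S \<le> infdist z (L i)"
      proof (cases "i < N")
        case True
        then show ?thesis using p by (intro Min_le[OF fin]) auto
      next
        case False
        have "Min ?S \<le> \<epsilon>" by (intro Min_le[OF fin]) auto
        then show ?thesis using \<epsilon>(2)[of i] False by linarith
      qed
      then show False using that by simp
    qed
    ultimately show ?thesis by blast
  qed
  \<comment> \<open>A line that occurs for infinitely many indices would contradict
    \<open>lf\<close> at its point \<open>y j\<close>.\<close>
  have inf: "infinite (range L)"
  proof
    assume "finite (range L)"
    then obtain j where j: "infinite {i \<in> UNIV. L i = L j}"
      using pigeonhole_infinite[of "UNIV :: nat set" L] by auto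
    obtain \<epsilon> N where \<epsilon>: "\<epsilon> > 0" "\<And>i. i \<ge> N \<Longrightarrow> \<epsilon> \<le> infdist (y j) (L i)" using lf by blast
    obtain i where "i \<ge> N" "L i = L j"
      using j by (metis (mono_tags, lifting) infinite_nat_iff_unbounded_le mem_Collect_eq)
    then show False using \<epsilon>(2)[of i] \<epsilon>(1) yL[of j] by simp
  qed
  then obtain f :: "nat \<Rightarrow> 'a set" where f: "inj f" "range f \<subseteq> range L"
    using infinite_countable_subset by blast
  define A where "A = (\<Union>k. f (2 * k))"
  define B where "B = (\<Union>k. f (2 * k + 1))"
  have fL: "\<exists>i. f k = L i" for k using f by blast
  have Linv: "a + t *\<^sub>R v \<in> L i" if "a \<in> L i" for a t i
  proof -
    from that[unfolded L_def] obtain s where "a = y i + s *\<^sub>R v" by blast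
    then show ?thesis unfolding L_def by (intro range_eqI[of _ _ "s + t"]) (simp add: algebra_simps)
  qed
  have finv: "a + t *\<^sub>R v \<in> f k" if "a \<in> f k" for a t k
    using fL[of k] Linv that by auto
  have fne: "f k \<noteq> {}" for k using fL[of k] yL by auto
  \<comment> \<open>Different \<open>k\<close> give different lines and therefore different indices,
    so the indices are unbounded. The values 0 and 1 of \<open>c\<close> select the family
    \<open>A\<close> or \<open>B\<close>.\<close>
  have often: "\<exists>i\<ge>n. \<exists>k. L i = f (2 * k + c)" for n c
  proof -
    have "\<exists>i. L i = f (2 * k + c)" for k using fL[of "2 * k + c"] by metis
    then obtain i where i: "\<And>k. L (i k) = f (2 * k + c)" by metis
    have "inj i"
    proof (rule injI)
      fix a b assume "i a = i b"
      then have "f (2 * a + c) = f (2 * b + c)" using i by metis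
      then show "a = b" using f(1) by (simp add: inj_eq)
    qed
    then have "infinite (range i)" by (simp add: finite_image_iff)
    then obtain m where "m \<ge> n" "m \<in> range i" by (meson infinite_nat_iff_unbounded_le)
    then show ?thesis using i by auto
  qed
  have near: "\<exists>i k. infdist z (L i) = 0 \<and> L i = f (2 * k + c)"
    if "infdist z (\<Union>k. f (2 * k + c)) = 0" for z c
  proof -
    let ?U = "\<Union>k. f (2 * k + c)"
    have ne: "?U \<noteq> {}" using fne by blast
    obtain \<epsilon> where \<epsilon>: "\<epsilon> > 0" "\<And>i. infdist z (L i) < \<epsilon> \<Longrightarrow> infdist z (L i) = 0"
      using gap by blast
    have "\<exists>a\<in>?U. dist z a < \<epsilon>" using infdist_less_imp_ex[OF ne] that \<epsilon>(1) by metis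
    then obtain a k where a: "a \<in> f (2 * k + c)" "dist z a < \<epsilon>" by blast
    obtain i where i: "f (2 * k + c) = L i" using fL by blast
    have "infdist z (L i) < \<epsilon>" using infdist_le[of a "L i" z] a i by simp
    then show ?thesis using \<epsilon> i by metis
  qed
  have pos: "0 < infdist z A + infdist z B" for z
  proof (rule ccontr)
    assume "\<not> ?thesis"
    then have "infdist z A = 0" "infdist z B = 0"
      using infdist_nonneg[of z A] infdist_nonneg[of z B] by auto
    then obtain i k j m where "infdist z (L i) = 0" "L i = f (2 * k)" "infdist z (L j) = 0" "L j = f (2 * m + 1)"
      using near[of z 0] near[of z 1] unfolding A_def B_def by auto
    then have "f (2 * k) = f (2 * m + 1)" using zero by metis
    then have "2 * k = 2 * m + 1" using f(1) by (simp add: inj_eq)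
    then show False by presburger
  qed
  obtain i0 k0 where "L i0 = f (2 * k0 + 0)" using often by blast
  then have x: "y i0 \<in> A" using yL[of i0] by (auto simp: A_def)
  have ne: "A \<noteq> {}" "B \<noteq> {}" using fne by (auto simp: A_def B_def)
  have Ai: "a + t *\<^sub>R v \<in> A" if "a \<in> A" for a t using that finv by (auto simp: A_def)
  have Bi: "a + t *\<^sub>R v \<in> B" if "a \<in> B" for a t using that finv by (auto simp: B_def)
  obtain h where h: "h \<in> G_gens" "\<And>z. h z \<noteq> z \<Longrightarrow> z \<in> ball p (5 * \<rho>)"
    "\<And>z. z \<in> B \<Longrightarrow> h z = z" "\<And>z. z \<in> A \<inter> ball p \<rho> \<Longrightarrow> h z = z + v"
    using separating_shift[OF \<rho>(1) v Ai Bi ne pos x y] by blast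
  have sub: "ball p (5 * \<rho>) \<subseteq> X" using \<rho> subset_ball[of "5 * \<rho>" "10 * \<rho>" p] by auto
  have yX: "y i \<in> X" for i using y[of i] \<rho> by auto
  have "restrict h X \<in> carrier M"
    unfolding carrier_M using h(2) sub by (intro G_gens_restrict[OF h(1)]) blast
  moreover have "\<exists>i\<ge>n. restrict h X (y i) = y i" for n
  proof -
    obtain i k where "i \<ge> n" "L i = f (2 * k + 1)" using often by blast
    then have "y i \<in> B" using yL[of i] by (auto simp: B_def)
    then show ?thesis using h(3) yX \<open>i \<ge> n\<close> by auto
  qed
  moreover have "\<exists>i\<ge>n. restrict h X (y i) \<notin> cball p \<rho>" for n
  proof -
    obtain i k where i: "i \<ge> n" "L i = f (2 * k + 0)" using often by blast
    then have "y i \<in> A" using yL[of i] by (auto simp: A_def)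
    then have "h (y i) = y i + v" using h(4) y by blast
    moreover have "norm v \<le> dist p (y i + v) + dist p (y i)"
      using dist_triangle[of "y i" "y i + v" p] by (simp add: dist_norm norm_minus_commute)
    then have "y i + v \<notin> cball p \<rho>" using v y[of i] \<rho> by auto
    ultimately show ?thesis using yX i by auto
  qed
  ultimately show ?thesis by blast
qed


section \<open>Limits of the definable sequences\<close>

lemma closure_image:
  assumes "g \<in> carrier M" "x \<in> X" "x \<in> closure S" "S \<subseteq> X"
  shows "g x \<in> closure (g ` S)"
  unfolding closure_iff_nhds_not_empty
proof (intro allI impI)
  fix V U assume U: "U \<subseteq> V" "open U" "g x \<in> U"
  have "open (X \<inter> g -` U)" using open_preimage[OF assms(1) U(2)] .
  moreover have "x \<in> X \<inter> g -` U" using assms U by auto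
  ultimately have "S \<inter> (X \<inter> g -` U) \<noteq> {}"
    using assms(3) unfolding closure_iff_nhds_not_empty by blast
  then show "g ` S \<inter> V \<noteq> {}" using U by blast
qed

lemma conjugate_inv:
  assumes "g \<in> carrier M" "a \<in> carrier M"
  shows "conjugate M (inv\<^bsub>M\<^esub> g) (conjugate M g a) = a" "conjugate M g (conjugate M (inv\<^bsub>M\<^esub> g) a) = a"
proof -
  have c: "inv\<^bsub>M\<^esub> g \<otimes>\<^bsub>M\<^esub> (g \<otimes>\<^bsub>M\<^esub> z) = z" "g \<otimes>\<^bsub>M\<^esub> (inv\<^bsub>M\<^esub> g \<otimes>\<^bsub>M\<^esub> z) = z" if "z \<in> carrier M" for z
    using that assms(1) by (simp_all flip: m_assoc)
  show "conjugate M (inv\<^bsub>M\<^esub> g) (conjugate M g a) = a"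
    unfolding conjugate_def using assms by (simp add: m_assoc c)
  show "conjugate M g (conjugate M (inv\<^bsub>M\<^esub> g) a) = a"
    unfolding conjugate_def using assms by (simp add: m_assoc c)
qed

text \<open>Makes \<open>hom_point_seq\<close> applicable to conjugation: conjugates of point
  sequences are point sequences.\<close>

lemma inner_automorphism:
  assumes g: "g \<in> carrier M"
  shows "group_iso M M (conjugate M g)"
proof
  have "conjugate M g \<in> hom M M"
  proof (rule homI)
    fix a b assume ab: "a \<in> carrier M" "b \<in> carrier M"
    have "inv\<^bsub>M\<^esub> g \<otimes>\<^bsub>M\<^esub> (g \<otimes>\<^bsub>M\<^esub> (b \<otimes>\<^bsub>M\<^esub> inv\<^bsub>M\<^esub> g)) = b \<otimes>\<^bsub>M\<^esub> inv\<^bsub>M\<^esub> g"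
      using g ab by (simp flip: m_assoc)
    then show "conjugate M g (a \<otimes>\<^bsub>M\<^esub> b) = conjugate M g a \<otimes>\<^bsub>M\<^esub> conjugate M g b"
      unfolding conjugate_def using g ab by (simp add: m_assoc)
  qed (use g in simp)
  moreover have "bij_betw (conjugate M g) (carrier M) (carrier M)"
    by (rule bij_betw_byWitness[where f' = "conjugate M (inv\<^bsub>M\<^esub> g)"])
      (use g in \<open>auto simp: conjugate_inv\<close>)
  ultimately show "conjugate M g \<in> iso M M" by (simp add: iso_def)
qed

text \<open>Each contradiction comes from the dichotomy in \<open>point_seq\<close>. Fixed points of
  \<open>g\<close> in arbitrarily late supports exclude apartness, by \<open>common\<close>; so the
  conjugated supports would have to enter every \<open>closure (U i)\<close>, which the choice of
  \<open>g\<close> prevents.\<close>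

lemma point_seq_tends_in_ball:
  assumes ps: "point_seq M F" and \<rho>: "\<rho> > 0" "ball p (20 * \<rho>) \<subseteq> X"
    and i0: "mv (F i0) \<subseteq> cball p \<rho>"
  shows "\<exists>x\<in>X. tends F x"
proof -
  have F: "F i \<in> carrier M" "F i \<noteq> \<one>\<^bsub>M\<^esub>" "covers M (F i) (F (Suc i))" for i
    using ps unfolding point_seq_def by blast+
  have Q: "(\<exists>i. apart M (conjugate M g (F i)) (F i)) \<or> (\<forall>i. \<exists>j. covers M (F i) (conjugate M g (F j)))"
    if "g \<in> carrier M" for g
    using ps that unfolding point_seq_def by blast
  define U where "U i = mv (F i)" for i
  have U: "open (U i)" "U i \<noteq> {}" "U i \<subseteq> X" for i
    unfolding U_def using open_mv[OF F(1)] mv_empty[OF F(1)] F(2) mv_subset by auto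
  have mono: "U j \<subseteq> closure (U i)" if "i \<le> j" for i j
    using that
  proof (induction rule: dec_induct)
    case base
    show ?case by (rule closure_subset)
  next
    case (step n)
    have "U (Suc n) \<subseteq> closure (U n)"
      unfolding U_def using covers_iff[OF F(1) F(1)] F(3) by blast
    also have "\<dots> \<subseteq> closure (U i)" using step by (simp add: closure_minimal)
    finally show ?case .
  qed
  have gU: "mv (conjugate M g (F i)) = g ` U i" if "g \<in> carrier M" for g i
    unfolding U_def using mv_conjugate[OF that F(1)] .
  have gmono: "g ` U j \<subseteq> closure (g ` U i)" if g: "g \<in> carrier M" and "i \<le> j" for g i j
  proof
    fix z assume "z \<in> g ` U j"
    then obtain u where u: "u \<in> U j" "z = g u" by blast
    then show "z \<in> closure (g ` U i)"
      using closure_image[OF g _ _ U(3)[of i], of u] mono[OF that(2)] U(3)[of j] by blast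
  qed
  have cb: "U i \<subseteq> cball p \<rho>" if "i \<ge> i0" for i
  proof -
    have "U i \<subseteq> closure (U i0)" using mono[OF that] .
    also have "\<dots> \<subseteq> cball p \<rho>" using i0 unfolding U_def by (intro closure_minimal) auto
    finally show ?thesis .
  qed
  \<comment> \<open>Disjointness at one index passes to all later ones, because the supports are
    open and nested up to closures.\<close>
  have common: "\<not> (\<exists>i. apart M (conjugate M g (F i)) (F i))"
    if g: "g \<in> carrier M" and m: "\<And>i. \<exists>j\<ge>i. g ` U j \<inter> U j \<noteq> {}" for g
  proof
    assume "\<exists>i. apart M (conjugate M g (F i)) (F i)"
    then obtain i where "apart M (conjugate M g (F i)) (F i)" by blast
    then have d: "g ` U i \<inter> U i = {}"
      using apart_iff[OF conjugate_closed[OF g F(1)[of i]] F(1)[of i]] gU[OF g] by (simp add: U_def)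
    obtain j where j: "j \<ge> i" "g ` U j \<inter> U j \<noteq> {}" using m by blast
    have o: "open (g ` U k)" for k
      using open_mv[OF conjugate_closed[OF g F(1)[of k]]] gU[OF g] by simp
    have "closure (g ` U i) \<inter> U i = {}"
      using d U(1)[of i] by (metis Int_commute open_Int_closure_eq_empty)
    then have "g ` U j \<inter> U i = {}" using gmono[OF g j(1)] by blast
    then have "g ` U j \<inter> closure (U i) = {}" using o[of j] by (metis open_Int_closure_eq_empty)
    then show False using j mono[OF j(1)] by blast
  qed
  have acc: "\<exists>l. \<forall>e>0. \<forall>n. \<exists>i\<ge>n. dist (y i) l < e" if y: "\<And>i. y i \<in> U (i0 + i)" for y
  proof (rule ccontr)
    assume neg: "\<not> ?thesis"
    have "y i \<in> cball p \<rho>" for i using y[of i] cb[of "i0 + i"] by auto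
    \<comment> \<open>\<open>separating_element\<close> wants the points in an open ball, so the
      radius is doubled; this accounts for the \<open>20 * \<rho>\<close> in the assumption.\<close>
    then have yb: "y i \<in> ball p (2 * \<rho>)" for i using \<rho>(1) by (smt (verit) mem_ball mem_cball)
    have "\<exists>e>0. \<exists>n. \<forall>i\<ge>n. e \<le> dist (y i) l" for l using neg by (meson not_le)
    then obtain g where g: "g \<in> carrier M" "\<And>n. \<exists>i\<ge>n. g (y i) = y i" "\<And>n. \<exists>i\<ge>n. g (y i) \<notin> cball p (2 * \<rho>)"
      using separating_element[of "2 * \<rho>" p y] \<rho> yb by auto
    have "\<exists>j\<ge>i. g ` U j \<inter> U j \<noteq> {}" for i
    proof -
      obtain k where k: "k \<ge> i" "g (y k) = y k" using g(2) by blast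
      then have "y k \<in> g ` U (i0 + k) \<inter> U (i0 + k)" using y[of k] by (metis IntI imageI)
      then show ?thesis using k(1) by (intro exI[of _ "i0 + k"]) auto
    qed
    then obtain j where "covers M (F i0) (conjugate M g (F j))"
      using Q[OF g(1)] common[OF g(1)] by blast
    then have "g ` U j \<subseteq> closure (U i0)"
      using covers_iff[OF F(1) conjugate_closed[OF g(1) F(1)]] gU[OF g(1)] unfolding U_def by metis
    also have "\<dots> \<subseteq> cball p \<rho>" using cb[of i0] by (intro closure_minimal) auto
    finally have "closure (g ` U j) \<subseteq> cball p \<rho>" by (intro closure_minimal) auto
    moreover obtain k where k: "k \<ge> j" "g (y k) \<notin> cball p (2 * \<rho>)" using g(3) by blast
    moreover have "g (y k) \<in> closure (g ` U j)"
      using gmono[OF g(1), of j "i0 + k"] k(1) y[of k] by auto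
    ultimately have "g (y k) \<in> cball p \<rho>" by blast
    then show False using k(2) \<rho>(1) by simp
  qed
  define C where "C = (\<Inter>i. closure (U i))"
  have accC: "l \<in> C" if y: "\<And>i. y i \<in> U (i0 + i)" and l: "\<And>e n. e > 0 \<Longrightarrow> \<exists>i\<ge>n. dist (y i) l < e" for y l
  proof -
    have "l \<in> closure (closure (U i))" for i
      unfolding closure_approachable[of l "closure (U i)"]
    proof (intro allI impI)
      fix e :: real assume "e > 0"
      then obtain k where k: "k \<ge> i" "dist (y k) l < e" using l by blast
      then have "y k \<in> closure (U i)" using y[of k] mono[of i "i0 + k"] by auto
      then show "\<exists>z\<in>closure (U i). dist z l < e" using k by blast
    qed
    then show ?thesis by (simp add: C_def)
  qed
  have "\<exists>z. z \<in> U (i0 + i)" for i using U(2)[of "i0 + i"] by blast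
  then obtain y0 where "\<And>i. y0 i \<in> U (i0 + i)" by metis
  with acc[of y0] accC[of y0] obtain x where xC: "x \<in> C" by metis
  have "C \<subseteq> cball p \<rho>"
  proof -
    have "C \<subseteq> closure (U i0)" by (auto simp: C_def)
    also have "\<dots> \<subseteq> cball p \<rho>" using cb[of i0] by (intro closure_minimal) auto
    finally show ?thesis .
  qed
  then have xp: "dist p x \<le> \<rho>" using xC by auto
  then have xX: "x \<in> X" using \<rho> by auto
  have uniq: "x' = x" if x': "x' \<in> C" for x'
  proof (rule ccontr)
    assume ne: "x' \<noteq> x"
    \<comment> \<open>At most half the distance, so that a push supported in \<open>ball x s\<close>
      fixes the points within \<open>s\<close> of \<open>x'\<close>.\<close>
    define s where "s = min \<rho> (dist x x' / 2)"
    have s: "s > 0" "s \<le> \<rho>" "2 * s \<le> dist x x'" using ne \<rho> by (auto simp: s_def)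
    have bX: "ball x s \<subseteq> X"
    proof
      fix z assume "z \<in> ball x s"
      then have "dist p z < 20 * \<rho>" using dist_triangle[of p z x] xp s \<rho>(1) by simp
      then show "z \<in> X" using \<rho>(2) by auto
    qed
    \<comment> \<open>A ball in \<open>C\<close> would contain infinitely many points with mutual
      distances at least \<open>s / 4\<close>. Points of the supports within \<open>s / 16\<close>
      of them are still too far apart to accumulate.\<close>
    have "\<not> ball x s \<subseteq> C"
    proof
      assume sub: "ball x s \<subseteq> C"
      obtain u :: "nat \<Rightarrow> 'a" where u: "\<And>n. norm (u n) = 1" "\<And>m n. m \<noteq> n \<Longrightarrow> 1 / 2 \<le> dist (u m) (u n)"
        using separated_unit_sequence[OF inf_dim] by auto
      define c where "c i = x + (s / 2) *\<^sub>R u i" for i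
      have "c i \<in> closure (U (i0 + i))" for i
      proof -
        have "c i \<in> ball x s" using s u(1)[of i] by (simp add: c_def dist_norm)
        then show ?thesis using sub by (auto simp: C_def)
      qed
      moreover have s16: "s / 16 > 0" using s(1) by simp
      ultimately have "\<exists>y\<in>U (i0 + i). dist y (c i) < s / 16" for i
        using s16 unfolding closure_approachable by blast
      then obtain y where y: "\<And>i. y i \<in> U (i0 + i)" "\<And>i. dist (y i) (c i) < s / 16" by metis
      obtain l where l: "\<And>e n. e > 0 \<Longrightarrow> \<exists>i\<ge>n. dist (y i) l < e" using acc[OF y(1)] by blast
      obtain i where i: "dist (y i) l < s / 32" using l[of "s / 32" 0] s by auto
      obtain j where j: "j \<ge> Suc i" "dist (y j) l < s / 32" using l[of "s / 32" "Suc i"] s by auto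
      have "s / 4 \<le> dist (c i) (c j)"
      proof -
        have "dist (c i) (c j) = (s / 2) * dist (u i) (u j)"
          using s(1) by (simp add: c_def dist_norm flip: scaleR_diff_right)
        also have "\<dots> \<ge> (s / 2) * (1 / 2)" using u(2)[of i j] j(1) s(1) by (intro mult_left_mono) auto
        finally show ?thesis by simp
      qed
      moreover have "dist (c i) (c j) \<le> dist (y i) (c i) + (dist (y i) l + dist (y j) l) + dist (y j) (c j)"
        using dist_triangle3[of "c i" "c j" "y i"] dist_triangle[of "y i" "c j" "y j"] dist_triangle2[of "y i" "y j" l]
        by linarith
      ultimately show False using i j y(2)[of i] y(2)[of j] s(1) by linarith
    qed
    then obtain w where w: "w \<in> ball x s" "w \<notin> C" by blast
    obtain g where g: "g \<in> carrier M" "g x = w" "mv g \<subseteq> ball x s" using move_center[OF bX w(1)] by blast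
    have "\<exists>j\<ge>i. g ` U j \<inter> U j \<noteq> {}" for i
    proof -
      have "x' \<in> closure (U i)" using x' by (auto simp: C_def)
      then obtain z where z: "z \<in> U i" "dist z x' < s" using s(1) unfolding closure_approachable by blast
      have "z \<notin> ball x s" using dist_triangle[of x x' z] z(2) s(3) by auto
      then have "g z = z" using g(3) fixed_outside_mv[of z g] z(1) U(3)[of i] by blast
      then have "z \<in> g ` U i \<inter> U i" using z(1) by (metis IntI imageI)
      then show ?thesis by blast
    qed
    then have j: "\<exists>j. covers M (F i) (conjugate M g (F j))" for i
      using Q[OF g(1)] common[OF g(1)] by blast
    \<comment> \<open>Covering at every index puts \<open>w\<close>, the image of \<open>x\<close>,
      into all the closures and thus into \<open>C\<close>.\<close>
    have "w \<in> closure (U i)" for i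
    proof -
      obtain j where "covers M (F i) (conjugate M g (F j))" using j by blast
      then have "g ` U j \<subseteq> closure (U i)"
        using covers_iff[OF F(1) conjugate_closed[OF g(1) F(1)]] gU[OF g(1)] unfolding U_def by metis
      then have "closure (g ` U j) \<subseteq> closure (U i)" by (simp add: closure_minimal)
      moreover have "x \<in> closure (U j)" using xC by (auto simp: C_def)
      then have "g x \<in> closure (g ` U j)" using closure_image[OF g(1) xX _ U(3)] by blast
      ultimately show ?thesis using g(2) by auto
    qed
    then show False using w(2) by (simp add: C_def)
  qed
  have "tends F x"
  proof (rule tends_ballI, rule ccontr)
    fix e :: real assume e: "e > 0" and neg: "\<not> (\<exists>n. \<forall>i\<ge>n. mv (F i) \<subseteq> ball x e)"
    \<comment> \<open>A point of a later support is known to lie only in the closure of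
      \<open>U (i0 + i)\<close>; half of \<open>e\<close> is given up to replace it by a point of
      \<open>U (i0 + i)\<close>.\<close>
    have "\<exists>y\<in>U (i0 + i). e / 2 \<le> dist y x" for i
    proof -
      obtain k where k: "k \<ge> i0 + i" "\<not> U k \<subseteq> ball x e" using neg unfolding U_def by blast
      then obtain z where z: "z \<in> U k" "e \<le> dist x z" by (meson mem_ball not_le subsetI)
      then have "z \<in> closure (U (i0 + i))" using mono[OF k(1)] by blast
      then obtain y where y: "y \<in> U (i0 + i)" "dist y z < e / 2"
        using e unfolding closure_approachable by (meson half_gt_zero)
      have "e / 2 \<le> dist y x" using dist_triangle3[of x z y] z(2) y(2) by (simp add: dist_commute)
      then show ?thesis using y by blast
    qed
    then obtain y where y: "\<And>i. y i \<in> U (i0 + i)" "\<And>i. e / 2 \<le> dist (y i) x" by metis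
    obtain l where l: "\<And>e n. e > 0 \<Longrightarrow> \<exists>i\<ge>n. dist (y i) l < e" using acc[OF y(1)] by blast
    have "l = x" using uniq accC[OF y(1) l] by blast
    then obtain i where "dist (y i) x < e / 2" using l[of "e / 2" 0] e by auto
    then show False using y(2)[of i] by simp
  qed
  then show ?thesis using xX by blast
qed

lemma point_seq_tends:
  assumes ps: "point_seq M f"
  shows "\<exists>x\<in>X. tends f x"
proof -
  have f: "f i \<in> carrier M" for i using ps unfolding point_seq_def by blast
  obtain w where w: "w \<in> carrier M" "w \<noteq> \<one>\<^bsub>M\<^esub>"
    "\<And>v. v \<in> carrier M \<Longrightarrow> v \<noteq> \<one>\<^bsub>M\<^esub> \<Longrightarrow> covers M w v \<Longrightarrow>
      \<exists>g\<in>carrier M. \<exists>i. covers M v (conjugate M g (f i))"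
    using ps unfolding point_seq_def by blast
  obtain p where "p \<in> mv w" using w mv_empty by blast
  then obtain e where e: "e > 0" "ball p e \<subseteq> mv w" using open_mv[OF w(1)] openE by blast
  \<comment> \<open>Leaves around the ball of radius \<open>\<rho>\<close> the room that
    \<open>point_seq_tends_in_ball\<close> requires.\<close>
  define \<rho> where "\<rho> = e / 20"
  have \<rho>: "\<rho> > 0" "ball p (20 * \<rho>) \<subseteq> mv w" using e by (auto simp: \<rho>_def)
  have bw: "ball p \<rho> \<subseteq> mv w" using \<rho> subset_ball[of \<rho> "20 * \<rho>" p] by auto
  then have bX: "ball p \<rho> \<subseteq> X" using mv_subset by blast
  obtain v where v: "v \<in> carrier M" "mv v = ball p \<rho>" using ball_support[OF \<rho>(1) bX] by blast
  have "v \<noteq> \<one>\<^bsub>M\<^esub>" using mv_empty[OF v(1)] v(2) \<rho>(1) by auto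
  moreover have "covers M w v"
    using covers_iff[OF w(1) v(1)] v(2) bw closure_subset by blast
  ultimately obtain g i where g: "g \<in> carrier M" "covers M v (conjugate M g (f i))"
    using w(3) v(1) by blast
  interpret C: group_iso M M "conjugate M g" using g(1) by (rule inner_automorphism)
  let ?F = "\<lambda>i. conjugate M g (f i)"
  have "mv (?F i) \<subseteq> closure (ball p \<rho>)"
    using covers_iff[OF v(1) conjugate_closed[OF g(1) f]] g(2) v(2) by metis
  also have "\<dots> \<subseteq> cball p \<rho>" by (rule closure_minimal) auto
  finally have "mv (?F i) \<subseteq> cball p \<rho>" .
  moreover have "point_seq M ?F" using C.hom_point_seq[of f, OF f] ps by blast
  moreover have "ball p (20 * \<rho>) \<subseteq> X" using \<rho>(2) mv_subset by blast
  ultimately obtain x where x: "x \<in> X" "tends ?F x"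
    using point_seq_tends_in_ball[OF _ \<rho>(1)] by blast
  have "tends (\<lambda>i. conjugate M (inv\<^bsub>M\<^esub> g) (?F i)) ((inv\<^bsub>M\<^esub> g) x)"
    using tends_conjugate[OF conjugate_closed[OF g(1) f] inv_closed[OF g(1)] x] .
  then have "tends f ((inv\<^bsub>M\<^esub> g) x)"
    using conjugate_inv(1)[OF g(1) f] by simp
  then show ?thesis using maps[OF inv_closed[OF g(1)] x(1)] by blast
qed

end

section \<open>Reconstruction of the space\<close>

locale open_homeos_iso =
  A: open_homeos X G + B: open_homeos Y H + group_iso A.M B.M \<phi>
  for X :: "'a::real_normed_vector set" and G
    and Y :: "'b::real_normed_vector set" and H and \<phi>
begin

lemma phi_carrier: "a \<in> carrier A.M \<Longrightarrow> \<phi> a \<in> carrier B.M"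
  by (rule hom.hom_closed)

lemma preimage: "b \<in> carrier B.M \<Longrightarrow> \<exists>a\<in>carrier A.M. \<phi> a = b"
  using image by (metis imageE)

lemma inverse: "open_homeos_iso Y H X G (inv_into (carrier A.M) \<phi>)"
  using inverse_iso A.open_homeos_axioms B.open_homeos_axioms
  by (simp add: open_homeos_iso_def)

text \<open>Suppose that \<open>y\<close> and \<open>y'\<close> differ. An element \<open>k'\<close>
  supported near \<open>y\<close> and away from \<open>y'\<close> comes from some \<open>k\<close>
  fixing \<open>x\<close>: otherwise the \<open>f' i\<close> would eventually be supported where
  \<open>k\<close> moves points, although their images are apart from \<open>k'\<close>. Let
  \<open>k'\<close> take \<open>y\<close> into the support of \<open>\<phi> v\<close>, where
  \<open>x\<close> is outside the closure of the support of \<open>v\<close>. The conjugates of the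
  \<open>f i\<close> by \<open>k\<close> still tend to \<open>x\<close>, but \<open>v\<close>
  eventually covers them.\<close>

lemma limit_unique:
  assumes f: "\<And>i. f i \<in> carrier A.M" "\<And>i. f i \<noteq> \<one>\<^bsub>A.M\<^esub>"
    and f': "\<And>i. f' i \<in> carrier A.M" "\<And>i. f' i \<noteq> \<one>\<^bsub>A.M\<^esub>"
    and x: "x \<in> X" and t: "A.tends f x" "A.tends f' x"
    and y: "y \<in> Y" and s: "B.tends (\<lambda>i. \<phi> (f i)) y" "B.tends (\<lambda>i. \<phi> (f' i)) y'"
  shows "y = y'"
proof (rule ccontr)
  assume ne: "y \<noteq> y'"
  have pf: "\<phi> (f i) \<in> carrier B.M" "\<phi> (f' i) \<in> carrier B.M" for i
    using phi_carrier f(1) f'(1) by auto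
  obtain e where e: "e > 0" "ball y e \<subseteq> Y" using B.X_open y openE by blast
  define \<rho> where "\<rho> = min e (dist y y' / 2)"
  have \<rho>: "\<rho> > 0" "\<rho> \<le> e" "2 * \<rho> \<le> dist y y'" using ne e by (auto simp: \<rho>_def)
  have bY: "ball y \<rho> \<subseteq> Y" using e \<rho>(2) subset_ball by blast
  obtain b' where bc: "b' \<in> carrier B.M" and mb: "B.mv b' = ball y \<rho>"
    using B.ball_support[OF \<rho>(1) bY] by blast
  obtain b where b: "b \<in> carrier A.M" "\<phi> b = b'" using preimage[OF bc] by blast
  have "b' \<noteq> \<one>\<^bsub>B.M\<^esub>" using B.mv_empty[OF bc] mb \<rho>(1) by auto
  then have "b \<noteq> \<one>\<^bsub>A.M\<^esub>" using b by auto
  then obtain q0 where q0: "q0 \<in> A.mv b" using A.mv_empty[OF b(1)] by blast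
  \<comment> \<open>The support of \<open>b\<close> is invariant under \<open>b\<close> and free of
    fixed points, so it has more than one point.\<close>
  obtain q where q: "q \<in> A.mv b" "q \<noteq> x"
  proof (cases "q0 = x")
    case True
    then show thesis using that[of "b q0"] A.mv_closed[OF b(1) q0] q0 by (auto simp: A.mv_def)
  qed (use q0 that in blast)
  obtain P Q where PQ: "open P" "open Q" "q \<in> P" "x \<in> Q" "P \<inter> Q = {}" using hausdorff[OF q(2)] by blast
  have "open (A.mv b \<inter> P)" "A.mv b \<inter> P \<noteq> {}" "A.mv b \<inter> P \<subseteq> X"
    using A.open_mv[OF b(1)] PQ q A.mv_subset[of b] by auto
  then obtain v where v: "v \<in> carrier A.M" "A.mv v \<subseteq> A.mv b \<inter> P" "v \<noteq> \<one>\<^bsub>A.M\<^esub>"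
    using A.moving_nontrivial by metis
  have xv: "x \<notin> closure (A.mv v)"
  proof -
    have "Q \<inter> A.mv v = {}" using v PQ by blast
    then have "Q \<inter> closure (A.mv v) = {}" using PQ(2) by (simp add: open_Int_closure_eq_empty)
    then show ?thesis using PQ(4) by blast
  qed
  have "covers A.M b v" using A.covers_iff[OF b(1) v(1)] v(2) closure_subset by blast
  then have "covers B.M (\<phi> b) (\<phi> v)" using hom_covers[OF b(1) v(1)] by blast
  then have "B.mv (\<phi> v) \<subseteq> closure (ball y \<rho>)"
    using B.covers_iff[OF bc phi_carrier[OF v(1)]] b(2) mb by simp
  moreover have pv: "open (B.mv (\<phi> v))" "B.mv (\<phi> v) \<noteq> {}"
    using B.open_mv B.mv_empty phi_carrier[OF v(1)] one_iff[OF v(1)] v(3) by auto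
  ultimately have "B.mv (\<phi> v) \<inter> ball y \<rho> \<noteq> {}"
    using open_Int_closure_eq_empty[OF pv(1), of "ball y \<rho>"] by auto
  then obtain w where w: "w \<in> B.mv (\<phi> v)" "w \<in> ball y \<rho>" by blast
  obtain k' where k': "k' \<in> carrier B.M" "k' y = w" "B.mv k' \<subseteq> ball y \<rho>"
    using B.move_center[OF bY w(2)] by blast
  obtain k where k: "k \<in> carrier A.M" "\<phi> k = k'" using preimage[OF k'(1)] by blast
  have kx: "k x = x"
  proof (rule ccontr)
    assume "k x \<noteq> x"
    then have "x \<in> A.mv k" using x by (simp add: A.mv_def)
    then obtain n where n: "\<And>i. i \<ge> n \<Longrightarrow> A.mv (f' i) \<subseteq> A.mv k"
      using A.tendsD[OF t(2) A.open_mv[OF k(1)]] by blast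
    obtain m where m: "\<And>i. i \<ge> m \<Longrightarrow> B.mv (\<phi> (f' i)) \<subseteq> ball y' \<rho>"
      using B.tendsD[OF s(2) open_ball] \<rho>(1) by (metis centre_in_ball)
    let ?i = "max n m"
    have "ball y \<rho> \<inter> ball y' \<rho> = {}" using \<rho>(3) by (intro disjoint_ballI) simp
    then have "apart B.M (\<phi> (f' ?i)) k'"
      using B.apart_iff[OF pf(2) k'(1)] m[of ?i] k'(3) by auto
    then have "apart A.M (f' ?i) k" using hom_apart[OF f'(1) k(1)] k(2) by simp
    then have "A.mv (f' ?i) \<inter> A.mv k = {}" using A.apart_iff[OF f'(1) k(1)] by blast
    then have "A.mv (f' ?i) = {}" using n[of ?i] by auto
    then show False using f' A.mv_empty by blast
  qed
  have "B.tends (\<lambda>i. conjugate B.M k' (\<phi> (f i))) w"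
    using B.tends_conjugate[OF pf(1) k'(1) y s(1)] k'(2) by simp
  then obtain n where n: "\<And>i. i \<ge> n \<Longrightarrow> B.mv (conjugate B.M k' (\<phi> (f i))) \<subseteq> B.mv (\<phi> v)"
    using B.tendsD[OF _ pv(1) w(1)] by blast
  have "A.mv (conjugate A.M k (f i)) \<subseteq> closure (A.mv v)" if "i \<ge> n" for i
  proof -
    have c: "conjugate A.M k (f i) \<in> carrier A.M" using k(1) f(1) by simp
    have "covers B.M (\<phi> v) (conjugate B.M k' (\<phi> (f i)))"
      using B.covers_iff[OF phi_carrier[OF v(1)] B.conjugate_closed[OF k'(1) pf(1)]] n[OF that] closure_subset
      by blast
    then have "covers B.M (\<phi> v) (\<phi> (conjugate A.M k (f i)))"
      using hom_conjugate[OF k(1) f(1)] k(2) by simp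
    then show ?thesis using hom_covers[OF v(1) c] A.covers_iff[OF v(1) c] by blast
  qed
  moreover have "A.tends (\<lambda>i. conjugate A.M k (f i)) x"
    using A.tends_conjugate[OF f(1) k(1) x t(1)] kx by simp
  moreover have "conjugate A.M k (f i) \<noteq> \<one>\<^bsub>A.M\<^esub>" for i
    using A.mv_conjugate[OF k(1) f(1)] A.mv_empty f k(1) by (metis A.conjugate_closed image_is_empty)
  ultimately have "x \<in> closure (closure (A.mv v))"
    using A.tends_closure[of "\<lambda>i. conjugate A.M k (f i)" x n "closure (A.mv v)"] k(1) f(1) by simp
  then show False using xv by simp
qed

text \<open>For points of \<open>X\<close> existence comes from \<open>point_seq_exists\<close> and
  from \<open>point_seq_tends\<close> applied to the image sequence; \<open>limit_unique\<close>
  makes the choice immaterial.\<close>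

definition point_map :: "'a \<Rightarrow> 'b"
  where "point_map x = (SOME y. y \<in> Y \<and>
    (\<exists>f. point_seq A.M f \<and> A.tends f x \<and> B.tends (\<lambda>i. \<phi> (f i)) y))"

lemma point_seq_carrier: "point_seq A.M f \<Longrightarrow> f i \<in> carrier A.M" "point_seq A.M f \<Longrightarrow> f i \<noteq> \<one>\<^bsub>A.M\<^esub>"
  by (auto simp: point_seq_def)

lemma point_map:
  assumes x: "x \<in> X"
  shows "point_map x \<in> Y"
    and "point_seq A.M f \<Longrightarrow> A.tends f x \<Longrightarrow> B.tends (\<lambda>i. \<phi> (f i)) (point_map x)"
proof -
  have ex: "\<exists>y\<in>Y. B.tends (\<lambda>i. \<phi> (f i)) y" if "point_seq A.M f" for f
    using hom_point_seq[of f] point_seq_carrier[OF that] that B.point_seq_tends by blast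
  obtain f0 where f0: "point_seq A.M f0" "A.tends f0 x" using A.point_seq_exists[OF x] by blast
  then have "\<exists>y. y \<in> Y \<and> (\<exists>f. point_seq A.M f \<and> A.tends f x \<and> B.tends (\<lambda>i. \<phi> (f i)) y)"
    using ex[OF f0(1)] by blast
  then have *: "point_map x \<in> Y \<and>
      (\<exists>f. point_seq A.M f \<and> A.tends f x \<and> B.tends (\<lambda>i. \<phi> (f i)) (point_map x))"
    unfolding point_map_def by (rule someI_ex)
  then show "point_map x \<in> Y" by blast
  from * obtain f' where f': "point_seq A.M f'" "A.tends f' x" "B.tends (\<lambda>i. \<phi> (f' i)) (point_map x)"
    by blast
  assume f: "point_seq A.M f" "A.tends f x"
  obtain y where y: "y \<in> Y" "B.tends (\<lambda>i. \<phi> (f i)) y" using ex[OF f(1)] by blast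
  have "y = point_map x"
    using limit_unique[OF point_seq_carrier[OF f(1)] point_seq_carrier[OF f'(1)] x f(2) f'(2) y f'(3)] .
  then show "B.tends (\<lambda>i. \<phi> (f i)) (point_map x)" using y(2) by simp
qed

lemma point_map_eqI:
  assumes "x \<in> X" "point_seq A.M f" "A.tends f x" "B.tends (\<lambda>i. \<phi> (f i)) y"
  shows "point_map x = y"
proof (rule B.tends_unique[OF _ _ point_map(2)[OF assms(1-3)] assms(4)])
  show "\<phi> (f i) \<in> carrier B.M" "\<phi> (f i) \<noteq> \<one>\<^bsub>B.M\<^esub>" for i
    using point_seq_carrier[OF assms(2), of i] phi_carrier one_iff by auto
qed

text \<open>Conjugation by \<open>g\<close> turns a point sequence for \<open>x\<close> into one for
  \<open>g x\<close>, and on the other side it becomes conjugation by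
  \<open>\<phi> g\<close>.\<close>

lemma point_map_equivariant:
  assumes x: "x \<in> X" and g: "g \<in> carrier A.M"
  shows "point_map (g x) = \<phi> g (point_map x)"
proof -
  obtain f where f: "point_seq A.M f" "A.tends f x" using A.point_seq_exists[OF x] by blast
  note fc = point_seq_carrier(1)[OF f(1)]
  interpret C: group_iso A.M A.M "conjugate A.M g" using g by (rule A.inner_automorphism)
  have 1: "point_seq A.M (\<lambda>i. conjugate A.M g (f i))" using C.hom_point_seq[of f, OF fc] f(1) by blast
  have 2: "A.tends (\<lambda>i. conjugate A.M g (f i)) (g x)" using A.tends_conjugate[OF fc g x f(2)] .
  have "B.tends (\<lambda>i. conjugate B.M (\<phi> g) (\<phi> (f i))) (\<phi> g (point_map x))"
    by (rule B.tends_conjugate[OF phi_carrier[OF fc] phi_carrier[OF g] point_map(1)[OF x]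
        point_map(2)[OF x f]])
  then have 3: "B.tends (\<lambda>i. \<phi> (conjugate A.M g (f i))) (\<phi> g (point_map x))"
    using hom_conjugate[OF g fc] by simp
  show ?thesis by (rule point_map_eqI[OF A.maps[OF g x] 1 2 3])
qed

text \<open>Take \<open>g\<close> whose image under \<open>\<phi>\<close> is supported in a small
  ball around \<open>point_map x\<close>; by equivariance \<open>g\<close> moves \<open>x\<close>.
  For any \<open>z\<close> in the support of \<open>g\<close> a point sequence is eventually covered
  by \<open>g\<close>, so the limit of its image lies in the closed ball.\<close>

lemma continuous_point_map: "continuous_on X point_map"
  unfolding continuous_on_iff
proof (intro ballI allI impI)
  fix x and e :: real assume x: "x \<in> X" and e: "e > 0"
  let ?y = "point_map x"
  obtain r where r: "r > 0" "ball ?y r \<subseteq> Y" using B.X_open point_map(1)[OF x] openE by blast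
  define \<rho> where "\<rho> = min r (e / 2)"
  have \<rho>: "\<rho> > 0" "\<rho> \<le> r" "\<rho> < e" using r e by (auto simp: \<rho>_def)
  have bY: "ball ?y \<rho> \<subseteq> Y" using r \<rho>(2) subset_ball by blast
  obtain h where h: "h \<in> carrier B.M" "B.mv h = ball ?y \<rho>" using B.ball_support[OF \<rho>(1) bY] by blast
  obtain g where g: "g \<in> carrier A.M" "\<phi> g = h" using preimage[OF h(1)] by blast
  have "?y \<in> B.mv h" using h(2) \<rho>(1) by simp
  then have "\<phi> g ?y \<noteq> ?y" using g(2) by (simp add: B.mv_def)
  then have "g x \<noteq> x" using point_map_equivariant[OF x g(1)] by metis
  then have "x \<in> A.mv g" using x by (simp add: A.mv_def)
  then obtain d where d: "d > 0" "ball x d \<subseteq> A.mv g" using A.open_mv[OF g(1)] openE by blast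
  have "dist (point_map z) ?y < e" if z: "z \<in> X" "dist z x < d" for z
  proof -
    have zg: "z \<in> A.mv g" using z d(2) by (auto simp: dist_commute)
    obtain f where f: "point_seq A.M f" "A.tends f z" using A.point_seq_exists[OF z(1)] by blast
    note fc = point_seq_carrier[OF f(1)]
    obtain n where n: "\<And>i. i \<ge> n \<Longrightarrow> A.mv (f i) \<subseteq> A.mv g"
      using A.tendsD[OF f(2) A.open_mv[OF g(1)] zg] by blast
    have "B.mv (\<phi> (f i)) \<subseteq> cball ?y \<rho>" if "i \<ge> n" for i
    proof -
      have "covers A.M g (f i)" using A.covers_iff[OF g(1) fc(1)] n[OF that] closure_subset by blast
      then have "B.mv (\<phi> (f i)) \<subseteq> closure (ball ?y \<rho>)"
        using hom_covers[OF g(1) fc(1)] B.covers_iff[OF h(1) phi_carrier[OF fc(1)]] g(2) h(2) by simp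
      also have "\<dots> \<subseteq> cball ?y \<rho>" by (rule closure_minimal) auto
      finally show ?thesis .
    qed
    then have "point_map z \<in> closure (cball ?y \<rho>)"
      using B.tends_closure[of "\<lambda>i. \<phi> (f i)" "point_map z" n "cball ?y \<rho>"] point_map(2)[OF z(1) f]
        phi_carrier fc one_iff by auto
    then show ?thesis using \<rho>(3) by (simp add: dist_commute)
  qed
  then show "\<exists>d>0. \<forall>z\<in>X. dist z x < d \<longrightarrow> dist (point_map z) ?y < e" using d(1) by blast
qed

end

text \<open>The inverse isomorphism has a point map too. A point sequence for \<open>x\<close> is
  sent to one for \<open>point_map x\<close> and back to itself, so the two maps are inverse to each
  other.\<close>

lemma (in open_homeos_iso) spatial:
  "\<exists>\<tau> \<tau>'. homeomorphic_maps (top_of_set X) (top_of_set Y) \<tau> \<tau>' \<and>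
    (\<forall>g\<in>G. \<phi> g = (\<lambda>y\<in>topspace (top_of_set Y). \<tau> (g (\<tau>' y))))"
proof -
  let ?\<psi> = "inv_into (carrier A.M) \<phi>"
  interpret I: open_homeos_iso Y H X G ?\<psi> by (rule inverse)
  have psi: "?\<psi> (\<phi> a) = a" if "a \<in> carrier A.M" for a
    using that iso by (auto simp: iso_def bij_betw_def)
  have phi: "\<phi> (?\<psi> b) = b" if "b \<in> carrier B.M" for b
    using that image by (metis f_inv_into_f)
  have 1: "I.point_map (point_map x) = x" if x: "x \<in> X" for x
  proof -
    obtain f where f: "point_seq A.M f" "A.tends f x" using A.point_seq_exists[OF x] by blast
    note fc = point_seq_carrier[OF f(1)]
    have "(\<lambda>i. ?\<psi> (\<phi> (f i))) = f" using psi fc(1) by auto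
    then show ?thesis
      using I.point_map_eqI[OF point_map(1)[OF x] _ point_map(2)[OF x f], of x]
        hom_point_seq[of f, OF fc(1)] f by auto
  qed
  have 2: "point_map (I.point_map y) = y" if y: "y \<in> Y" for y
  proof -
    obtain f where f: "point_seq B.M f" "B.tends f y" using B.point_seq_exists[OF y] by blast
    note fc = I.point_seq_carrier[OF f(1)]
    have "(\<lambda>i. \<phi> (?\<psi> (f i))) = f" using phi fc(1) by auto
    then show ?thesis
      using point_map_eqI[OF I.point_map(1)[OF y] _ I.point_map(2)[OF y f], of y]
        I.hom_point_seq[of f, OF fc(1)] f by auto
  qed
  have "homeomorphic_maps (top_of_set X) (top_of_set Y) point_map I.point_map"
    unfolding homeomorphic_maps_def
    using 1 2 continuous_point_map I.continuous_point_map point_map(1) I.point_map(1)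
    by (auto simp: continuous_map_in_subtopology)
  moreover have "\<phi> g = (\<lambda>y\<in>topspace (top_of_set Y). point_map (g (I.point_map y)))" if g: "g \<in> G" for g
  proof (rule extensionalityI[of _ Y])
    have gc: "g \<in> carrier A.M" using g A.carrier_M by simp
    show "\<phi> g \<in> extensional Y"
      using phi_carrier[OF gc] B.H_sub B.carrier_M carrier_homeo_group[of "\<phi> g" "top_of_set Y"]
      by (auto simp: Bij_def)
    show "(\<lambda>y\<in>topspace (top_of_set Y). point_map (g (I.point_map y))) \<in> extensional Y" by simp
    fix y assume y: "y \<in> Y"
    then show "\<phi> g y = (\<lambda>y\<in>topspace (top_of_set Y). point_map (g (I.point_map y))) y"
      using point_map_equivariant[OF I.point_map(1)[OF y] gc] 2[OF y] by simp
  qed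
  ultimately show ?thesis by blast
qed

lemma K_NSML_faithful:
  "faithful_between (K_NSML :: ('a::real_normed_vector topology \<times> ('a \<Rightarrow> 'a) set) set)
    (K_NSML :: ('b::real_normed_vector topology \<times> ('b \<Rightarrow> 'b) set) set)"
  unfolding faithful_between_def
proof (safe)
  fix T G S H \<phi>
  assume TG: "(T, G) \<in> (K_NSML :: ('a topology \<times> ('a \<Rightarrow> 'a) set) set)"
    and SH: "(S, H) \<in> (K_NSML :: ('b topology \<times> ('b \<Rightarrow> 'b) set) set)"
    and iso: "\<phi> \<in> iso (homeo_group T\<lparr>carrier := G\<rparr>) (homeo_group S\<lparr>carrier := H\<rparr>)"
  obtain X where X: "T = top_of_set X" "infinite_dimensional (UNIV :: 'a set)" "open X"
      "space_group_pair (top_of_set X) G" "G_on X \<subseteq> G"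
    using TG unfolding K_NSML_def by blast
  obtain Y where Y: "S = top_of_set Y" "infinite_dimensional (UNIV :: 'b set)" "open Y"
      "space_group_pair (top_of_set Y) H" "G_on Y \<subseteq> H"
    using SH unfolding K_NSML_def by blast
  interpret A: open_homeos X G using X by unfold_locales
  interpret B: open_homeos Y H using Y by unfold_locales
  interpret open_homeos_iso X G Y H \<phi>
    using iso X(1) Y(1) by unfold_locales (simp add: A.M_def B.M_def)
  show "\<exists>\<tau> \<tau>'. homeomorphic_maps T S \<tau> \<tau>' \<and> (\<forall>g\<in>G. \<phi> g = (\<lambda>y\<in>topspace S. \<tau> (g (\<tau>' y))))"
    unfolding X(1) Y(1) by (rule spatial)
qed

section \<open>Brouwer's theorem in variable dimension\<close>

text \<open>The dimension \<open>m\<close> varies with the group element to which this is applied, so Brouwer's theorem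
  for a type of class \<^class>\<open>euclidean_space\<close> is of no use; Kuhn's lemma has \<open>m\<close> as a parameter.\<close>

lemma cube_approximate_fixed_point:
  fixes \<Phi> :: "(nat \<Rightarrow> real) \<Rightarrow> nat \<Rightarrow> real"
  assumes \<eta>: "\<eta> > 0"
    and maps: "\<And>t j. (\<And>i. i < m \<Longrightarrow> 0 \<le> t i \<and> t i \<le> 1) \<Longrightarrow> j < m \<Longrightarrow> 0 \<le> \<Phi> t j \<and> \<Phi> t j \<le> 1"
    and \<delta>: "\<delta> > 0"
    and unif: "\<And>s t j. (\<And>i. i < m \<Longrightarrow> 0 \<le> s i \<and> s i \<le> 1) \<Longrightarrow> (\<And>i. i < m \<Longrightarrow> 0 \<le> t i \<and> t i \<le> 1) \<Longrightarrow>
      (\<And>i. i < m \<Longrightarrow> \<bar>s i - t i\<bar> \<le> \<delta>) \<Longrightarrow> j < m \<Longrightarrow> \<bar>\<Phi> s j - \<Phi> t j\<bar> \<le> \<eta>"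
  shows "\<exists>t. (\<forall>i<m. 0 \<le> t i \<and> t i \<le> 1) \<and> (\<forall>j<m. \<bar>\<Phi> t j - t j\<bar> \<le> 2 * \<eta>)"
proof -
  obtain p0 :: nat where p0: "1 / min \<delta> \<eta> < real p0" using reals_Archimedean2 by blast
  define p where "p = max p0 1"
  have p: "p > 0" "1 / real p \<le> \<delta>" "1 / real p \<le> \<eta>"
  proof -
    define \<mu> where "\<mu> = min \<delta> \<eta>"
    have mp: "\<mu> > 0" using \<eta> \<delta> by (simp add: \<mu>_def)
    show p1: "p > 0" by (simp add: p_def)
    have "1 / \<mu> \<le> real p" using p0 by (simp add: p_def \<mu>_def)
    then have "1 / real p \<le> \<mu>" using mp p1 by (simp add: field_simps)
    then show "1 / real p \<le> \<delta>" "1 / real p \<le> \<eta>" by (auto simp: \<mu>_def)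
  qed
  define pt where "pt x = (\<lambda>i. real (x i) / real p)" for x :: "nat \<Rightarrow> nat"
  \<comment> \<open>Label 0 says that \<open>\<Phi>\<close> does not decrease the coordinate, label
    1 that it does not increase it. \<open>kuhn_lemma\<close> prescribes label 1 on the face
    \<open>x j = p\<close>; this agrees with the second reading, as \<open>\<Phi>\<close> is at most
    1.\<close>
  define label where "label x j = (if x j \<noteq> p \<and> pt x j \<le> \<Phi> (pt x) j then 0 else 1::nat)" for x j
  have pt01: "0 \<le> pt x i \<and> pt x i \<le> 1" if "x i \<le> p" for x i
    using that p by (simp add: pt_def)
  have l01: "\<forall>x. (\<forall>i<m. x i \<le> p) \<longrightarrow> (\<forall>i<m. label x i = 0 \<or> label x i = 1)"
    by (simp add: label_def)
  have l0: "\<forall>x. (\<forall>i<m. x i \<le> p) \<longrightarrow> (\<forall>i<m. x i = 0 \<longrightarrow> label x i = 0)"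
  proof (intro allI impI)
    fix x i assume x: "\<forall>i<m. x i \<le> p" "i < m" "x i = 0"
    then have "0 \<le> \<Phi> (pt x) i" using maps[of "pt x" i] pt01 by blast
    then show "label x i = 0" using x p by (simp add: label_def pt_def)
  qed
  have l1: "\<forall>x. (\<forall>i<m. x i \<le> p) \<longrightarrow> (\<forall>i<m. x i = p \<longrightarrow> label x i = 1)"
    by (simp add: label_def)
  obtain q where q: "\<forall>i<m. q i < p"
    "\<forall>i<m. \<exists>r s. (\<forall>j<m. q j \<le> r j \<and> r j \<le> q j + 1) \<and> (\<forall>j<m. q j \<le> s j \<and> s j \<le> q j + 1) \<and> label r i \<noteq> label s i"
    using kuhn_lemma[OF p(1) l01 l0 l1] by blast
  have near: "\<bar>\<Phi> (pt r) j - \<Phi> (pt q) j\<bar> \<le> \<eta>" and rp: "\<And>i. i < m \<Longrightarrow> 0 \<le> pt r i \<and> pt r i \<le> 1"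
    and rq: "pt q j \<le> pt r j" "pt r j \<le> pt q j + \<eta>"
    if r: "\<forall>i<m. q i \<le> r i \<and> r i \<le> q i + 1" and j: "j < m" for r j
  proof -
    have d: "\<bar>pt r i - pt q i\<bar> \<le> 1 / real p" if "i < m" for i
    proof -
      have "real (r i) - real (q i) \<le> 1" "real (q i) \<le> real (r i)" using r that by fastforce+
      then show ?thesis using p(1) by (simp add: pt_def divide_right_mono flip: diff_divide_distrib)
    qed
    have ri: "r i \<le> p" if "i < m" for i using r q(1) that by fastforce
    show rp: "\<And>i. i < m \<Longrightarrow> 0 \<le> pt r i \<and> pt r i \<le> 1" using ri pt01 by blast
    have qp: "\<And>i. i < m \<Longrightarrow> 0 \<le> pt q i \<and> pt q i \<le> 1" using q(1) pt01 by (simp add: less_imp_le)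
    have "\<And>i. i < m \<Longrightarrow> \<bar>pt r i - pt q i\<bar> \<le> \<delta>" using d p(2) by (meson order_trans)
    then show "\<bar>\<Phi> (pt r) j - \<Phi> (pt q) j\<bar> \<le> \<eta>" using unif[of "pt r" "pt q", OF rp qp _ j] by blast
    show "pt q j \<le> pt r j" using r j by (simp add: pt_def divide_right_mono)
    show "pt r j \<le> pt q j + \<eta>" using d[OF j] p(3) by linarith
  qed
  have "\<bar>\<Phi> (pt q) j - pt q j\<bar> \<le> 2 * \<eta>" if j: "j < m" for j
  proof -
    obtain r s where rs: "\<forall>i<m. q i \<le> r i \<and> r i \<le> q i + 1" "\<forall>i<m. q i \<le> s i \<and> s i \<le> q i + 1"
      "label r j \<noteq> label s j"
      using q(2) j by blast
    \<comment> \<open>Passing from the vertex \<open>a\<close> to the corner \<open>q\<close> costs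
      \<open>\<eta>\<close> for \<open>\<Phi>\<close>. The coordinate can only decrease, so a
      further \<open>\<eta>\<close> is lost in the upper bound alone.\<close>
    have lo: "pt q j - \<eta> \<le> \<Phi> (pt q) j" if a: "\<forall>i<m. q i \<le> a i \<and> a i \<le> q i + 1" "label a j = 0" for a
    proof -
      have "pt a j \<le> \<Phi> (pt a) j" using a(2) by (auto simp: label_def split: if_splits)
      then show ?thesis using near[OF a(1) j] rq[OF a(1) j] by linarith
    qed
    have hi: "\<Phi> (pt q) j \<le> pt q j + 2 * \<eta>" if a: "\<forall>i<m. q i \<le> a i \<and> a i \<le> q i + 1" "label a j \<noteq> 0" for a
    proof -
      have "\<Phi> (pt a) j \<le> pt a j"
      proof (cases "a j = p")
        case True
        then have "pt a j = 1" using p(1) by (simp add: pt_def)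
        then show ?thesis using maps[OF rp[OF a(1) j] j] by simp
      next
        case False
        then show ?thesis using a(2) by (auto simp: label_def split: if_splits)
      qed
      then show ?thesis using near[OF a(1) j] rq[OF a(1) j] by linarith
    qed
    have "pt q j - \<eta> \<le> \<Phi> (pt q) j \<and> \<Phi> (pt q) j \<le> pt q j + 2 * \<eta>"
    proof (cases "label r j = 0")
      case True
      then show ?thesis using lo[OF rs(1)] hi[OF rs(2)] rs(3) by simp
    next
      case False
      then have "label s j = 0" using rs(3) by (auto simp: label_def split: if_splits)
      then show ?thesis using lo[OF rs(2)] hi[OF rs(1)] False by simp
    qed
    then show ?thesis using \<eta> by auto
  qed
  moreover have "\<forall>i<m. 0 \<le> pt q i \<and> pt q i \<le> 1" using q(1) pt01 by (simp add: less_imp_le)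
  ultimately show ?thesis by blast
qed

lemma norm_combination_le:
  fixes e :: "nat \<Rightarrow> 'a::real_normed_vector"
  assumes "\<And>i. i < m \<Longrightarrow> \<bar>t i\<bar> \<le> d"
  shows "norm (\<Sum>i<m. t i *\<^sub>R e i) \<le> d * (\<Sum>i<m. norm (e i))"
proof -
  have "norm (\<Sum>i<m. t i *\<^sub>R e i) \<le> (\<Sum>i<m. \<bar>t i\<bar> * norm (e i))"
    by (rule order_trans[OF norm_sum]) simp
  also have "\<dots> \<le> (\<Sum>i<m. d * norm (e i))"
    using assms by (intro sum_mono mult_right_mono) auto
  finally show ?thesis by (simp add: sum_distrib_left)
qed

lemma radial_retraction:
  fixes z :: "'a::real_normed_vector"
  assumes "R > 0"
  shows "norm ((R / max R (norm z)) *\<^sub>R z) \<le> R" "norm ((R / max R (norm z)) *\<^sub>R z - z) = max 0 (norm z - R)"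
proof -
  show "norm ((R / max R (norm z)) *\<^sub>R z) \<le> R" using assms by (auto simp: max_def)
  show "norm ((R / max R (norm z)) *\<^sub>R z - z) = max 0 (norm z - R)"
  proof (cases "norm z \<le> R")
    case False
    then have z0: "z \<noteq> 0" using assms by auto
    have "(R / norm z) *\<^sub>R z - z = (R / norm z - 1) *\<^sub>R z" by (simp add: algebra_simps)
    then have "norm ((R / norm z) *\<^sub>R z - z) = \<bar>R / norm z - 1\<bar> * norm z" by simp
    also have "\<bar>R / norm z - 1\<bar> = 1 - R / norm z" using False assms by (simp add: divide_le_eq_1)
    also have "\<dots> = (norm z - R) / norm z" using z0 by (simp add: diff_divide_distrib)
    also have "(norm z - R) / norm z * norm z = norm z - R" using z0 by simp
    finally show ?thesis using False by (simp add: max_def)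
  qed (use assms in simp)
qed

text \<open>In coordinates a cube containing the ball becomes the unit cube, and the retraction
  \<open>\<rho>\<close> extends \<open>\<Psi>\<close> to it. The approximate fixed point may lie
  outside the ball, but by no more than the error, so \<open>\<rho>\<close> brings it back at a cost
  of \<open>\<eta> / 2\<close>.\<close>

lemma ball_approximate_fixed_point:
  fixes e :: "nat \<Rightarrow> 'a::real_normed_vector" and m :: nat
  defines "F \<equiv> span (e ` {..<m})"
  assumes \<kappa>: "\<kappa> \<ge> 0" "\<And>t j. j < m \<Longrightarrow> \<bar>t j\<bar> \<le> \<kappa> * norm (\<Sum>i<m. t i *\<^sub>R e i)"
    and R: "R > 0" and \<Psi>: "\<And>z. z \<in> F \<Longrightarrow> norm z \<le> R \<Longrightarrow> \<Psi> z \<in> F \<and> norm (\<Psi> z) \<le> R"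
    and cont: "continuous_on (F \<inter> cball 0 R) \<Psi>" and \<eta>: "\<eta> > 0"
  shows "\<exists>z\<in>F. norm z \<le> R \<and> norm (\<Psi> z - z) \<le> \<eta>"
proof -
  let ?c = "\<lambda>t. \<Sum>i<m. t i *\<^sub>R e i"
  have F: "F = range ?c" unfolding F_def by (rule span_combinations)
  define N where "N = (\<Sum>i<m. norm (e i))"
  have N: "N \<ge> 0" unfolding N_def by (intro sum_nonneg) auto
  \<comment> \<open>Half the side of the coordinate cube; the summand 1 keeps it positive when
    \<open>\<kappa>\<close> is 0.\<close>
  define A where "A = \<kappa> * R + 1"
  have A: "A > 0" "\<kappa> * R \<le> A" using \<kappa> R by (auto simp: A_def intro: add_nonneg_pos)
  \<comment> \<open>The bound \<open>\<kappa>\<close> makes the coordinates below \<open>m\<close>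
    unique, so the arbitrary choice is Lipschitz there.\<close>
  define crd where "crd z = (SOME t. z = ?c t)" for z
  have crd: "z = ?c (crd z)" if "z \<in> F" for z
  proof -
    have "\<exists>t. z = ?c t" using that F by blast
    then show ?thesis unfolding crd_def by (rule someI_ex)
  qed
  have crd_lip: "\<bar>crd z j - crd w j\<bar> \<le> \<kappa> * norm (z - w)" if "z \<in> F" "w \<in> F" "j < m" for z w j
  proof -
    have "z - w = ?c (\<lambda>i. crd z i - crd w i)"
      using crd[OF that(1)] crd[OF that(2)] by (simp add: scaleR_left_diff_distrib sum_subtractf)
    then show ?thesis using \<kappa>(2)[OF that(3), of "\<lambda>i. crd z i - crd w i"] by simp
  qed
  have crd_A: "\<bar>crd z j\<bar> \<le> A" if "z \<in> F" "norm z \<le> R" "j < m" for z j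
  proof -
    have "\<bar>crd z j\<bar> \<le> \<kappa> * norm z" using \<kappa>(2)[OF that(3), of "crd z"] crd[OF that(1)] by simp
    also have "\<dots> \<le> \<kappa> * R" using that \<kappa>(1) by (intro mult_left_mono)
    finally show ?thesis using A by simp
  qed
  define \<rho> where "\<rho> z = (R / max R (norm z)) *\<^sub>R z" for z :: 'a
  have \<rho>: "norm (\<rho> z) \<le> R" "norm (\<rho> z - z) = max 0 (norm z - R)" for z
    unfolding \<rho>_def using radial_retraction[OF R] by auto
  have \<rho>F: "\<rho> z \<in> F" if "z \<in> F" for z
    using that unfolding \<rho>_def F_def by (rule span_scale)
  define g where "g z = \<Psi> (\<rho> z)" for z
  have gF: "g z \<in> F" "norm (g z) \<le> R" if "z \<in> F" for z
    unfolding g_def using \<Psi>[OF \<rho>F[OF that] \<rho>(1)] by auto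
  have \<rho>c: "continuous_on UNIV \<rho>"
    unfolding \<rho>_def using R by (intro continuous_intros) (auto simp: max_def)
  have "continuous_on F g"
    unfolding g_def using \<rho>F \<rho>(1) continuous_on_subset[OF \<rho>c subset_UNIV]
    by (intro continuous_on_compose2[OF cont]) auto
  define K where "K = {?c t | t. \<forall>i<m. \<bar>t i\<bar> \<le> A}"
  have K: "compact K" "K \<subseteq> F" unfolding K_def F using compact_combinations by auto
  have ug: "uniformly_continuous_on K g"
    using K \<open>continuous_on F g\<close> continuous_on_subset compact_uniformly_continuous by blast
  \<comment> \<open>Coordinates will be off by at most \<open>4 * A * \<eta>'\<close> and vectors by
    at most \<open>N\<close> times as much, which has to stay within
    \<open>\<eta> / 2\<close>.\<close>
  define \<eta>' where "\<eta>' = \<eta> / (8 * A * (N + 1))"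
  have \<eta>': "\<eta>' > 0" using \<eta> A N by (simp add: \<eta>'_def)
  define \<epsilon> where "\<epsilon> = 2 * A * \<eta>' / (\<kappa> + 1)"
  have \<epsilon>: "\<epsilon> > 0" using \<eta>' A \<kappa> by (simp add: \<epsilon>_def)
  obtain d where d: "d > 0" "\<And>z w. z \<in> K \<Longrightarrow> w \<in> K \<Longrightarrow> dist w z < d \<Longrightarrow> dist (g w) (g z) < \<epsilon>"
    using ug \<epsilon> unfolding uniformly_continuous_on_def by metis
  define \<delta> where "\<delta> = d / (2 * A * (N + 1))"
  have \<delta>: "\<delta> > 0" using d A N by (simp add: \<delta>_def)
  define z where "z t = ?c (\<lambda>i. (2 * t i - 1) * A)" for t
  have zK: "z t \<in> K" if "\<And>i. i < m \<Longrightarrow> 0 \<le> t i \<and> t i \<le> 1" for t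
  proof -
    have "\<bar>(2 * t i - 1) * A\<bar> \<le> A" if "i < m" for i
    proof -
      have "\<bar>2 * t i - 1\<bar> \<le> 1" using \<open>\<And>i. i < m \<Longrightarrow> 0 \<le> t i \<and> t i \<le> 1\<close>[OF that] by auto
      then show ?thesis using A(1) mult_right_mono[of "\<bar>2 * t i - 1\<bar>" 1 A] by (simp add: abs_mult)
    qed
    then show ?thesis unfolding K_def z_def
      by (intro CollectI exI[of _ "\<lambda>i. (2 * t i - 1) * A"]) blast
  qed
  define \<Phi> where "\<Phi> t j = (crd (g (z t)) j / A + 1) / 2" for t j
  have "\<exists>t. (\<forall>i<m. 0 \<le> t i \<and> t i \<le> 1) \<and> (\<forall>j<m. \<bar>\<Phi> t j - t j\<bar> \<le> 2 * \<eta>')"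
  proof (rule cube_approximate_fixed_point[OF \<eta>' _ \<delta>])
    fix t :: "nat \<Rightarrow> real" and j assume t: "\<And>i. i < m \<Longrightarrow> 0 \<le> t i \<and> t i \<le> 1" and j: "j < m"
    have "z t \<in> F" using zK[of t] t K(2) by blast
    then have "\<bar>crd (g (z t)) j\<bar> \<le> A" using crd_A[OF gF _] j by blast
    then have "- 1 \<le> crd (g (z t)) j / A" "crd (g (z t)) j / A \<le> 1"
      using A(1) by (auto simp: pos_le_divide_eq pos_divide_le_eq)
    then show "0 \<le> \<Phi> t j \<and> \<Phi> t j \<le> 1" unfolding \<Phi>_def by auto
  next
    fix s t :: "nat \<Rightarrow> real" and j assume s: "\<And>i. i < m \<Longrightarrow> 0 \<le> s i \<and> s i \<le> 1" and t: "\<And>i. i < m \<Longrightarrow> 0 \<le> t i \<and> t i \<le> 1"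
      and st: "\<And>i. i < m \<Longrightarrow> \<bar>s i - t i\<bar> \<le> \<delta>" and j: "j < m"
    have zz: "z s \<in> K" "z t \<in> K" using zK s t by blast+
    have "z s - z t = (\<Sum>i<m. ((2 * s i - 1) * A) *\<^sub>R e i - ((2 * t i - 1) * A) *\<^sub>R e i)"
      by (simp add: z_def sum_subtractf)
    also have "\<dots> = ?c (\<lambda>i. 2 * A * (s i - t i))"
      by (rule sum.cong) (simp_all add: algebra_simps)
    also have "norm \<dots> \<le> (2 * A * \<delta>) * N"
      unfolding N_def
    proof (rule norm_combination_le)
      fix i assume "i < m"
      then show "\<bar>2 * A * (s i - t i)\<bar> \<le> 2 * A * \<delta>" using st[of i] A(1) by (simp add: abs_mult)
    qed
    also have "\<dots> < 2 * A * \<delta> * (N + 1)" using A \<delta> by simp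
    also have "\<dots> = d" using A N by (simp add: \<delta>_def)
    finally have "dist (g (z s)) (g (z t)) < \<epsilon>" using d(2) zz by (simp add: dist_norm)
    then have "\<kappa> * norm (g (z s) - g (z t)) \<le> \<kappa> * \<epsilon>" using \<kappa>(1) by (intro mult_left_mono) (auto simp: dist_norm)
    also have "\<dots> \<le> (\<kappa> + 1) * \<epsilon>" using \<epsilon> by simp
    also have "\<dots> = 2 * A * \<eta>'" using \<kappa>(1) by (simp add: \<epsilon>_def)
    finally have *: "\<bar>crd (g (z s)) j - crd (g (z t)) j\<bar> \<le> 2 * A * \<eta>'"
      using crd_lip[OF gF(1) gF(1) j, of "z s" "z t"] zz K(2) by fastforce
    have "\<Phi> s j - \<Phi> t j = (crd (g (z s)) j - crd (g (z t)) j) / (2 * A)"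
      unfolding \<Phi>_def using A(1) by (simp add: field_simps)
    then have "\<bar>\<Phi> s j - \<Phi> t j\<bar> = \<bar>crd (g (z s)) j - crd (g (z t)) j\<bar> / (2 * A)" using A(1) by simp
    also have "\<dots> \<le> 2 * A * \<eta>' / (2 * A)" using * A(1) by (intro divide_right_mono) auto
    finally show "\<bar>\<Phi> s j - \<Phi> t j\<bar> \<le> \<eta>'" using A(1) by simp
  qed
  then obtain t where t: "\<And>i. i < m \<Longrightarrow> 0 \<le> t i \<and> t i \<le> 1" "\<And>j. j < m \<Longrightarrow> \<bar>\<Phi> t j - t j\<bar> \<le> 2 * \<eta>'"
    by blast
  have ztF: "z t \<in> F" using zK[of t] t(1) K(2) by blast
  have gz: "g (z t) = ?c (crd (g (z t)))" using crd gF(1)[OF ztF] by blast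
  have "g (z t) - z t = ?c (\<lambda>i. crd (g (z t)) i - (2 * t i - 1) * A)"
    by (subst gz) (simp add: z_def sum_subtractf scaleR_left_diff_distrib)
  also have "norm \<dots> \<le> (4 * A * \<eta>') * N"
    unfolding N_def
  proof (rule norm_combination_le)
    fix i assume i: "i < m"
    have "crd (g (z t)) i - (2 * t i - 1) * A = 2 * A * (\<Phi> t i - t i)"
      unfolding \<Phi>_def using A(1) by (simp add: field_simps)
    then have "\<bar>crd (g (z t)) i - (2 * t i - 1) * A\<bar> = 2 * A * \<bar>\<Phi> t i - t i\<bar>"
      using A(1) by (simp add: abs_mult)
    also have "\<dots> \<le> 2 * A * (2 * \<eta>')" using t(2)[OF i] A(1) by (intro mult_left_mono) auto
    finally show "\<bar>crd (g (z t)) i - (2 * t i - 1) * A\<bar> \<le> 4 * A * \<eta>'" by simp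
  qed
  also have "\<dots> \<le> 4 * A * \<eta>' * (N + 1)" using A \<eta>' by simp
  also have "\<dots> = \<eta> / 2"
  proof -
    have "\<eta>' * (8 * A * (N + 1)) = \<eta>" using A N by (simp add: \<eta>'_def)
    then show ?thesis by (simp add: mult_ac)
  qed
  finally have gd: "norm (g (z t) - z t) \<le> \<eta> / 2" .
  have "norm (z t) \<le> norm (g (z t)) + norm (g (z t) - z t)"
    by (metis norm_minus_commute norm_triangle_sub)
  then have "norm (z t) \<le> R + \<eta> / 2" using gF(2)[OF ztF] gd by simp
  then have "norm (\<rho> (z t) - z t) \<le> \<eta> / 2" unfolding \<rho>(2) using \<eta> by (auto simp: max_def)
  then have "norm (\<Psi> (\<rho> (z t)) - \<rho> (z t)) \<le> \<eta>"
    using gd norm_triangle_ineq4[of "g (z t) - z t" "\<rho> (z t) - z t"] by (simp add: g_def)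
  then show ?thesis using \<rho>F[OF ztF] \<rho>(1) by blast
qed

section \<open>Displacements of finite rank\<close>

text \<open>Coefficients instead of a subspace: the vectors of a composition are then a
  concatenation, and the bound \<open>M\<close> makes the displacements over a compact set fit into
  finitely many boxes.\<close>

definition finite_rank_displacement :: "nat \<Rightarrow> ('a::real_normed_vector \<Rightarrow> 'a) \<Rightarrow> bool"
  where "finite_rank_displacement n g \<longleftrightarrow>
    (\<forall>z. \<exists>U w M. open U \<and> z \<in> U \<and>
      (\<forall>x\<in>U. \<exists>t. (\<forall>k<n. \<bar>t k\<bar> \<le> M) \<and> g x = x + (\<Sum>k<n. t k *\<^sub>R w k)))"

lemma sum_lessThan_add: "(\<Sum>k<n + m. f k) = (\<Sum>k<n. f k) + (\<Sum>k<m. f (n + k))"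
  for f :: "nat \<Rightarrow> 'a::comm_monoid_add"
  by (induction m) (simp_all add: add.assoc)

lemma finite_rank_displacement_compose:
  assumes g: "finite_rank_displacement m g" and h: "finite_rank_displacement n h"
    and cont: "continuous_on UNIV h"
  shows "finite_rank_displacement (n + m) (\<lambda>x. g (h x))"
  unfolding finite_rank_displacement_def
proof
  fix z
  obtain U u M where U: "open U" "z \<in> U"
    "\<And>x. x \<in> U \<Longrightarrow> \<exists>t. (\<forall>k<n. \<bar>t k\<bar> \<le> M) \<and> h x = x + (\<Sum>k<n. t k *\<^sub>R u k)"
    using h unfolding finite_rank_displacement_def by metis
  obtain V w L where V: "open V" "h z \<in> V"
    "\<And>x. x \<in> V \<Longrightarrow> \<exists>t. (\<forall>k<m. \<bar>t k\<bar> \<le> L) \<and> g x = x + (\<Sum>k<m. t k *\<^sub>R w k)"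
    using g unfolding finite_rank_displacement_def by metis
  let ?w = "\<lambda>k. if k < n then u k else w (k - n)"
  show "\<exists>U w M. open U \<and> z \<in> U \<and>
      (\<forall>x\<in>U. \<exists>t. (\<forall>k<n + m. \<bar>t k\<bar> \<le> M) \<and> g (h x) = x + (\<Sum>k<n + m. t k *\<^sub>R w k))"
  proof (intro exI[of _ "U \<inter> h -` V"] exI[of _ ?w] exI[of _ "max M L"] conjI ballI)
    have "open (h -` V)" using V(1) cont by (metis continuous_on_open_vimage open_UNIV Int_UNIV_right)
    then show "open (U \<inter> h -` V)" using U(1) by blast
    show "z \<in> U \<inter> h -` V" using U V by simp
    fix x assume x: "x \<in> U \<inter> h -` V"
    obtain s where s: "\<forall>k<n. \<bar>s k\<bar> \<le> M" "h x = x + (\<Sum>k<n. s k *\<^sub>R u k)" using U(3) x by blast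
    obtain t where t: "\<forall>k<m. \<bar>t k\<bar> \<le> L" "g (h x) = h x + (\<Sum>k<m. t k *\<^sub>R w k)" using V(3) x by blast
    let ?t = "\<lambda>k. if k < n then s k else t (k - n)"
    show "\<exists>t. (\<forall>k<n + m. \<bar>t k\<bar> \<le> max M L) \<and> g (h x) = x + (\<Sum>k<n + m. t k *\<^sub>R ?w k)"
    proof (intro exI[of _ ?t] conjI allI impI)
      fix k assume "k < n + m"
      then show "\<bar>?t k\<bar> \<le> max M L"
        using s(1) t(1) by (cases "k < n") (auto simp: le_max_iff_disj)
    next
      show "g (h x) = x + (\<Sum>k<n + m. ?t k *\<^sub>R ?w k)"
        unfolding sum_lessThan_add by (subst t(2), subst s(2)) (simp add: add.assoc)
    qed
  qed
qed

text \<open>The displacement of \<open>h\<close> at \<open>x\<close> is the opposite of that of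
  \<open>g\<close> at \<open>h x\<close>, so the vectors can be kept.\<close>

lemma finite_rank_displacement_inverse:
  assumes g: "finite_rank_displacement n g"
    and inv: "\<And>x. h (g x) = x" "\<And>x. g (h x) = x" and cont: "continuous_on UNIV h"
  shows "finite_rank_displacement n h"
  unfolding finite_rank_displacement_def
proof
  fix z
  obtain U u M where U: "open U" "h z \<in> U"
    "\<And>x. x \<in> U \<Longrightarrow> \<exists>t. (\<forall>k<n. \<bar>t k\<bar> \<le> M) \<and> g x = x + (\<Sum>k<n. t k *\<^sub>R u k)"
    using g unfolding finite_rank_displacement_def by metis
  show "\<exists>U w M. open U \<and> z \<in> U \<and>
      (\<forall>x\<in>U. \<exists>t. (\<forall>k<n. \<bar>t k\<bar> \<le> M) \<and> h x = x + (\<Sum>k<n. t k *\<^sub>R w k))"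
  proof (intro exI[of _ "h -` U"] exI[of _ u] exI[of _ M] conjI ballI)
    show "open (h -` U)" using U(1) cont by (metis continuous_on_open_vimage open_UNIV Int_UNIV_right)
    show "z \<in> h -` U" using U by simp
    fix x assume "x \<in> h -` U"
    then obtain t where t: "\<forall>k<n. \<bar>t k\<bar> \<le> M" "g (h x) = h x + (\<Sum>k<n. t k *\<^sub>R u k)" using U(3) by blast
    then have "h x = x + (\<Sum>k<n. (- t k) *\<^sub>R u k)"
      using inv(2)[of x] by (simp add: sum_negf algebra_simps)
    then show "\<exists>t. (\<forall>k<n. \<bar>t k\<bar> \<le> M) \<and> h x = x + (\<Sum>k<n. t k *\<^sub>R u k)"
      using t(1) by (intro exI[of _ "\<lambda>k. - t k"]) simp
  qed
qed

text \<open>If \<open>r0\<close> separates the tubes, a ball of radius \<open>r0 / 2\<close> meets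
  at most one of them, so \<open>h\<close> moves its points along a single vector. Continuity of
  \<open>h\<close> bounds the displacement and with it the coefficient.\<close>

lemma G_gens_finite_rank_displacement:
  assumes h: "h \<in> G_gens" and cont: "continuous_on UNIV h"
  shows "finite_rank_displacement 1 h"
  unfolding finite_rank_displacement_def
proof
  fix z
  from h obtain f x v r where f: "\<forall>i::nat. basic_homeo (f i) (x i) (v i) (r i)"
    and sep: "separated_family (range (\<lambda>i. tube (x i) (v i) (r i)))"
    and out: "\<forall>z. z \<notin> (\<Union>i. tube (x i) (v i) (r i)) \<longrightarrow> h z = z"
    and on: "\<forall>i. \<forall>z \<in> tube (x i) (v i) (r i). h z = f i z"
    unfolding G_gens_def mem_Collect_eq by (elim conjE exE) assumption
  let ?S = "\<lambda>i. tube (x i) (v i) (r i)"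
  obtain r0 where r0: "r0 > 0" "\<And>i j. ?S i \<noteq> ?S j \<Longrightarrow> r0 < setdist (?S i) (?S j)"
    using sep unfolding separated_family_def by auto
  define d where "d y = norm (h y - y)" for y
  have "continuous_on UNIV d" unfolding d_def by (intro continuous_intros cont)
  then obtain \<delta> where \<delta>: "\<delta> > 0" "\<And>y. dist y z < \<delta> \<Longrightarrow> dist (d y) (d z) < 1"
    unfolding continuous_on_iff by (metis UNIV_I zero_less_one)
  let ?U = "ball z (min \<delta> (r0 / 2))"
  have dB: "d y \<le> d z + 1" if "y \<in> ?U" for y
    using \<delta>(2)[of y] that by (auto simp: dist_commute dist_real_def abs_if split: if_splits)
  have "\<exists>u. \<forall>y\<in>?U. \<exists>t. h y = y + t *\<^sub>R u"
  proof (cases "\<exists>i. ?S i \<inter> ?U \<noteq> {}")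
    case True
    then obtain i a where a: "a \<in> ?S i" "a \<in> ?U" by blast
    have "\<exists>t. h y = y + t *\<^sub>R v i" if y: "y \<in> ?U" for y
    proof (cases "y \<in> (\<Union>i. ?S i)")
      case True
      then obtain j where j: "y \<in> ?S j" by blast
      have "?S i = ?S j"
      proof (rule ccontr)
        assume "?S i \<noteq> ?S j"
        then have "r0 < dist a y" using r0(2)[of i j] setdist_le_dist[OF a(1) j] by linarith
        moreover have "dist a y < r0" using a(2) y dist_triangle3[of a y z] by auto
        ultimately show False by simp
      qed
      \<comment> \<open>One tube may occur with several indices and different vectors; on it
        \<open>h\<close> agrees with each of these \<open>f i\<close>, so \<open>v i\<close>
        serves.\<close>
      then have "h y = f i y" using on j by metis
      moreover have "\<exists>t. f i y = y + t *\<^sub>R v i"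
        using f[rule_format, of i] unfolding basic_homeo_def by blast
      ultimately show ?thesis by simp
    next
      case False
      then show ?thesis using out[rule_format, of y] by (intro exI[of _ 0]) simp
    qed
    then show ?thesis by blast
  next
    case False
    then have "h y = y" if "y \<in> ?U" for y using out[rule_format, of y] that by blast
    then show ?thesis by (intro exI[of _ 0]) simp
  qed
  then obtain u where u: "\<And>y. y \<in> ?U \<Longrightarrow> \<exists>t. h y = y + t *\<^sub>R u" by blast
  \<comment> \<open>For \<open>u = 0\<close> the quotient is 0 by convention, and the coefficient 0
    satisfies the bound.\<close>
  have bt: "\<exists>t. \<bar>t\<bar> \<le> (d z + 1) / norm u \<and> h y = y + t *\<^sub>R u" if y: "y \<in> ?U" for y
  proof (cases "u = 0")
    case True
    then show ?thesis using u[OF y] by (intro exI[of _ 0]) simp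
  next
    case False
    obtain t where t: "h y = y + t *\<^sub>R u" using u[OF y] by blast
    then have "\<bar>t\<bar> * norm u \<le> d z + 1" using dB[OF y] by (simp add: d_def)
    then have "\<bar>t\<bar> \<le> (d z + 1) / norm u" using False by (simp add: pos_le_divide_eq)
    then show ?thesis using t by blast
  qed
  have "\<exists>t. (\<forall>k<1::nat. \<bar>t k\<bar> \<le> (d z + 1) / norm u) \<and> h y = y + (\<Sum>k<1::nat. t k *\<^sub>R u)" if y: "y \<in> ?U" for y
  proof -
    obtain t where "\<bar>t\<bar> \<le> (d z + 1) / norm u" "h y = y + t *\<^sub>R u"
      using bt[OF y] by blast
    then show ?thesis by (intro exI[of _ "\<lambda>_. t"]) simp
  qed
  then show "\<exists>U w M. open U \<and> z \<in> U \<and>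
      (\<forall>x\<in>U. \<exists>t. (\<forall>k<1::nat. \<bar>t k\<bar> \<le> M) \<and> h x = x + (\<Sum>k<1::nat. t k *\<^sub>R w k))"
    using \<delta>(1) r0(1)
    by (intro exI[of _ ?U] exI[of _ "\<lambda>_. u"] exI[of _ "(d z + 1) / norm u"] conjI) auto
qed

lemma G_whole_finite_rank_displacement:
  assumes "g \<in> G_whole"
  shows "g \<in> carrier (homeo_group euclidean) \<and> (\<exists>n. finite_rank_displacement n g)"
proof -
  interpret E: group "homeo_group (euclidean :: 'a topology)" by (rule group_homeo_group)
  let ?E = "homeo_group (euclidean :: 'a topology)"
  have mult: "(a \<otimes>\<^bsub>?E\<^esub> b) = (\<lambda>x. a (b x))" if "a \<in> carrier ?E" "b \<in> carrier ?E" for a b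
    using homeo_group_mult[OF that] by (auto simp: compose_def)
  have id: "\<one>\<^bsub>?E\<^esub> = (\<lambda>x. x)" by (auto simp: homeo_group_one)
  have cont: "continuous_on UNIV a" if "a \<in> carrier ?E" for a
    using that homeomorphic_imp_continuous_map[of euclidean euclidean a] by (simp add: carrier_homeo_group)
  have gens: "a \<in> carrier ?E" "finite_rank_displacement 1 a" if "a \<in> G_gens" for a
  proof -
    show "a \<in> carrier ?E" using that by (simp add: G_gens_def)
    then show "finite_rank_displacement 1 a" using G_gens_finite_rank_displacement[OF that] cont by blast
  qed
  have "g \<in> generate ?E G_gens" using assms by (simp add: G_whole_def)
  then show ?thesis
  proof (induction rule: generate.induct)
    case one
    have "finite_rank_displacement 0 (\<lambda>x::'a. x)"
      unfolding finite_rank_displacement_def by (intro allI exI[of _ UNIV]) auto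
    then show ?case using E.one_closed unfolding id by blast
  next
    case (incl h)
    then show ?case using gens by blast
  next
    case (inv h)
    note h = gens(1)[OF inv]
    have i: "inv\<^bsub>?E\<^esub> h \<in> carrier ?E" using h by simp
    have "(inv\<^bsub>?E\<^esub> h) (h x) = x" "h ((inv\<^bsub>?E\<^esub> h) x) = x" for x
      using mult[OF i h] mult[OF h i] E.l_inv[OF h] E.r_inv[OF h] id by metis+
    then have "finite_rank_displacement 1 (inv\<^bsub>?E\<^esub> h)"
      using finite_rank_displacement_inverse[OF gens(2)[OF inv] _ _ cont[OF i]] by blast
    then show ?case using i by blast
  next
    case (eng a b)
    then obtain m n where "finite_rank_displacement m a" "finite_rank_displacement n b" by blast
    then have "finite_rank_displacement (n + m) (a \<otimes>\<^bsub>?E\<^esub> b)"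
      using finite_rank_displacement_compose[of m a n b] cont eng mult by metis
    then show ?case using eng by blast
  qed
qed

text \<open>There are \<open>N ^ (n + 1)\<close> grid points but at most
  \<open>card D * (3 * p) ^ n * N ^ n\<close> cells, so the additional dimension wins as soon as
  \<open>N\<close> exceeds the constant.\<close>

lemma grid_pigeonhole:
  fixes cell :: "(nat \<Rightarrow> nat) \<Rightarrow> 'd \<times> (nat \<Rightarrow> int)"
  assumes D: "finite D" and N: "N > card D * (3 * p) ^ n" and p: "p \<ge> (1::nat)"
    and cell: "\<And>a. a \<in> {..<Suc n} \<rightarrow>\<^sub>E {..<N} \<Longrightarrow> fst (cell a) \<in> D \<and>
      snd (cell a) \<in> {..<n} \<rightarrow>\<^sub>E {- int (N * p)..int (N * p)}"
  shows "\<exists>a b. a \<in> {..<Suc n} \<rightarrow>\<^sub>E {..<N} \<and> b \<in> {..<Suc n} \<rightarrow>\<^sub>E {..<N} \<and> a \<noteq> b \<and> cell a = cell b"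
proof (rule ccontr)
  assume neg: "\<not> ?thesis"
  let ?A = "{..<Suc n} \<rightarrow>\<^sub>E {..<N}" and ?C = "{..<n} \<rightarrow>\<^sub>E {- int (N * p)..int (N * p)}"
  have fin: "finite (D \<times> ?C)" using D by (intro finite_cartesian_product finite_PiE) auto
  have "card ?A \<le> card (D \<times> ?C)"
  proof (rule card_inj_on_le[OF _ _ fin])
    show "inj_on cell ?A" using neg by (auto simp: inj_on_def)
    show "cell ` ?A \<subseteq> D \<times> ?C" using cell by (metis image_subsetI mem_Times_iff)
  qed
  also have "card ?A = N ^ Suc n" by (simp add: card_PiE)
  also have "card (D \<times> ?C) = card D * (2 * (N * p) + 1) ^ n"
    by (simp add: card_cartesian_product card_PiE nat_add_distrib nat_mult_distrib)
  also have "(2 * (N * p) + 1) ^ n \<le> (N * (3 * p)) ^ n"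
  proof (rule power_mono)
    have "N * p \<ge> 1" using N p by (metis One_nat_def Suc_leI less_nat_zero_code mult_eq_0_iff neq0_conv not_one_le_zero)
    then show "2 * (N * p) + 1 \<le> N * (3 * p)" by (simp add: algebra_simps)
  qed simp
  finally have "N ^ n * N \<le> N ^ n * (card D * (3 * p) ^ n)"
    by (simp add: power_mult_distrib mult_ac)
  moreover have "N ^ n > 0" using N by simp
  ultimately show False using N by simp
qed

text \<open>The map \<open>z \<mapsto> c + z - g (c + z)\<close> of a ball of dimension \<open>n + 1\<close> would be uniformly close to
  the identity while taking values in finitely many boxes of dimension \<open>n\<close>. A Lipschitz
  map \<open>q\<close> built from a partition of unity brings the values back into the ball, and Brouwer's
  theorem makes them nearly hit every point of a grid of \<open>N ^ (n + 1)\<close> points, for all \<open>N\<close>.\<close>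

lemma finite_rank_displacement_nonshrinking:
  fixes g :: "'a::real_normed_vector \<Rightarrow> 'a"
  assumes inf: "infinite_dimensional (UNIV :: 'a set)" and frd: "finite_rank_displacement n g"
    and cont: "continuous_on UNIV g" and R: "R > 0"
  shows "\<not> g ` ball c R \<subseteq> ball c (R / 10)"
proof
  assume shrink: "g ` ball c R \<subseteq> ball c (R / 10)"
  define \<epsilon> where "\<epsilon> = R / 10"
  have \<epsilon>: "\<epsilon> > 0" "R = 10 * \<epsilon>" using R by (auto simp: \<epsilon>_def)
  obtain e :: "nat \<Rightarrow> 'a" where e: "\<And>m. e m \<notin> span (e ` {..<m})" using independent_sequence[OF inf] by blast
  define m where "m = Suc n"
  obtain \<kappa> where \<kappa>: "\<kappa> \<ge> 0" "\<And>t j. j < m \<Longrightarrow> \<bar>t j\<bar> \<le> \<kappa> * norm (\<Sum>i<m. t i *\<^sub>R e i)"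
    using coordinate_bound[OF e, of m] by blast
  define F where "F = span (e ` {..<m})"
  \<comment> \<open>In \<open>hit\<close> the target \<open>y\<close> has norm at most
    \<open>\<epsilon>\<close>, \<open>q\<close> moves points by at most
    \<open>3 * \<epsilon>\<close> and \<open>f\<close> by at most \<open>\<epsilon>\<close>, which
    adds up to 5. The ball stays within radius \<open>R = 10 * \<epsilon>\<close>, where
    \<open>g\<close> is known to shrink.\<close>
  define B where "B = F \<inter> cball 0 (5 * \<epsilon>)"
  have F_comb: "F = range (\<lambda>t. \<Sum>i<m. t i *\<^sub>R e i)" unfolding F_def by (rule span_combinations)
  have B: "compact B"
  proof -
    let ?K = "{(\<Sum>i<m. t i *\<^sub>R e i) | t. \<forall>i<m. \<bar>t i\<bar> \<le> \<kappa> * (5 * \<epsilon>)}"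
    have "B = ?K \<inter> cball 0 (5 * \<epsilon>)"
    proof
      show "B \<subseteq> ?K \<inter> cball 0 (5 * \<epsilon>)"
      proof
        fix z assume z: "z \<in> B"
        then obtain t where t: "z = (\<Sum>i<m. t i *\<^sub>R e i)" unfolding B_def F_comb by blast
        have "\<bar>t i\<bar> \<le> \<kappa> * (5 * \<epsilon>)" if "i < m" for i
        proof -
          have "\<bar>t i\<bar> \<le> \<kappa> * norm z" using \<kappa>(2)[OF that, of t] t by simp
          also have "\<dots> \<le> \<kappa> * (5 * \<epsilon>)" using z \<kappa>(1) by (intro mult_left_mono) (auto simp: B_def)
          finally show ?thesis .
        qed
        then show "z \<in> ?K \<inter> cball 0 (5 * \<epsilon>)" using t z by (auto simp: B_def)
      qed
      show "?K \<inter> cball 0 (5 * \<epsilon>) \<subseteq> B" unfolding B_def F_comb by blast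
    qed
    then show ?thesis using compact_Int_closed[OF compact_combinations closed_cball] by simp
  qed
  define f where "f z = z - (g (c + z) - c)" for z
  have fz: "norm (f z - z) \<le> \<epsilon>" if "z \<in> B" for z
  proof -
    have "c + z \<in> ball c R" using that \<epsilon> by (auto simp: B_def dist_norm)
    then have "g (c + z) \<in> ball c (R / 10)" using shrink by blast
    then show ?thesis by (simp add: f_def dist_norm \<epsilon>_def norm_minus_commute)
  qed
  have fcont: "continuous_on UNIV f"
    unfolding f_def by (intro continuous_intros continuous_on_compose2[OF cont]) auto

  have "\<forall>z. \<exists>p. case p of (U, w, M) \<Rightarrow> open U \<and> z \<in> U \<and>
      (\<forall>x\<in>U. \<exists>t. (\<forall>k<n. \<bar>t k\<bar> \<le> M) \<and> f x = (\<Sum>k<n. t k *\<^sub>R w k))"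
  proof
    fix z
    obtain U w M where U: "open U" "c + z \<in> U"
      "\<And>x. x \<in> U \<Longrightarrow> \<exists>t. (\<forall>k<n. \<bar>t k\<bar> \<le> M) \<and> g x = x + (\<Sum>k<n. t k *\<^sub>R w k)"
      using frd unfolding finite_rank_displacement_def by metis
    have "open ((\<lambda>z. c + z) -` U)" using U(1) by (intro open_vimage continuous_intros)
    moreover have "\<exists>t. (\<forall>k<n. \<bar>t k\<bar> \<le> M) \<and> f x = (\<Sum>k<n. t k *\<^sub>R w k)" if x: "c + x \<in> U" for x
    proof -
      obtain t where "\<forall>k<n. \<bar>t k\<bar> \<le> M" "g (c + x) = c + x + (\<Sum>k<n. t k *\<^sub>R w k)" using U(3)[OF x] by blast
      then show ?thesis by (intro exI[of _ "\<lambda>k. - t k"]) (simp add: f_def sum_negf)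
    qed
    ultimately show "\<exists>p. case p of (U, w, M) \<Rightarrow> open U \<and> z \<in> U \<and>
      (\<forall>x\<in>U. \<exists>t. (\<forall>k<n. \<bar>t k\<bar> \<le> M) \<and> f x = (\<Sum>k<n. t k *\<^sub>R w k))"
      using U(2) by (intro exI[of _ "((\<lambda>z. c + z) -` U, w, M)"]) simp
  qed
  from choice[OF this] obtain C where C: "\<forall>z. case C z of (U, w, M) \<Rightarrow> open U \<and> z \<in> U \<and>
      (\<forall>x\<in>U. \<exists>t. (\<forall>k<n. \<bar>t k\<bar> \<le> M) \<and> f x = (\<Sum>k<n. t k *\<^sub>R w k))"
    by blast
  define U where "U z = fst (C z)" for z
  define w where "w z = fst (snd (C z))" for z
  define M where "M z = snd (snd (C z))" for z
  have U: "open (U z)" "z \<in> U z"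
    "x \<in> U z \<Longrightarrow> \<exists>t. (\<forall>k<n. \<bar>t k\<bar> \<le> M z) \<and> f x = (\<Sum>k<n. t k *\<^sub>R w z k)" for z x
    using C[rule_format, of z] by (simp_all add: U_def w_def M_def case_prod_unfold)
  have "B \<subseteq> (\<Union>z\<in>B. U z)" using U(2) by blast
  from compactE_image[OF B U(1) this] obtain D where D: "finite D" "B \<subseteq> (\<Union>z\<in>D. U z)"
    by metis
  define L0 where "L0 = (\<Sum>d\<in>D. \<bar>M d\<bar>)"
  define W where "W = (\<Sum>d\<in>D. \<Sum>k<n. norm (w d k))"
  have W: "W \<ge> 0" "\<And>d. d \<in> D \<Longrightarrow> (\<Sum>k<n. norm (w d k)) \<le> W"
    unfolding W_def using D(1) by (auto intro!: sum_nonneg member_le_sum)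
  have "\<bar>M d\<bar> \<le> L0" if "d \<in> D" for d
    unfolding L0_def using D(1) that by (intro member_le_sum) auto
  note M_le = this
  have rep: "\<exists>d t. d \<in> D \<and> (\<forall>k<n. \<bar>t k\<bar> \<le> L0) \<and> f z = (\<Sum>k<n. t k *\<^sub>R w d k)" if z: "z \<in> B" for z
  proof -
    obtain d where d: "d \<in> D" "z \<in> U d" using D(2) z by blast
    obtain t where t: "\<forall>k<n. \<bar>t k\<bar> \<le> M d" "f z = (\<Sum>k<n. t k *\<^sub>R w d k)" using U(3)[OF d(2)] by blast
    have "\<bar>t k\<bar> \<le> L0" if "k < n" for k
      using t(1)[rule_format, OF that] M_le[OF d(1)] by linarith
    then show ?thesis using d(1) t(2) by blast
  qed

  have "B \<subseteq> (\<Union>u\<in>B. ball u \<epsilon>)" using \<epsilon>(1) by auto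
  from compactE_image[OF B open_ball this]
  obtain K where K: "K \<subseteq> B" "finite K" "B \<subseteq> (\<Union>u\<in>K. ball u \<epsilon>)"
    by metis
  define \<phi> where "\<phi> u x = max 0 (3 * \<epsilon> - dist x u)" for u x :: 'a
  define S where "S x = (\<Sum>u\<in>K. \<phi> u x)" for x
  define P where "P x = (\<Sum>u\<in>K. \<phi> u x *\<^sub>R u)" for x
  define q where "q x = (1 / S x) *\<^sub>R P x" for x
  define E where "E = {x. \<epsilon> \<le> S x}"
  have \<phi>0: "0 \<le> \<phi> u x" for u x by (simp add: \<phi>_def)
  have fE: "f z \<in> E" if z: "z \<in> B" for z
  proof -
    obtain u where u: "u \<in> K" "dist z u < \<epsilon>" using K(3) z by (auto simp: dist_commute)
    have "dist (f z) u \<le> dist (f z) z + dist z u" by (rule dist_triangle)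
    then have "\<epsilon> \<le> \<phi> u (f z)" using u(2) fz[OF z] by (simp add: \<phi>_def dist_norm)
    also have "\<dots> \<le> S (f z)" unfolding S_def using K(2) u(1) \<phi>0 by (intro member_le_sum) auto
    finally show ?thesis by (simp add: E_def)
  qed
  have Kn: "norm u \<le> 5 * \<epsilon>" if "u \<in> K" for u using that K(1) by (auto simp: B_def)
  have qS: "S x *\<^sub>R q x = P x" if "x \<in> E" for x
    using that \<epsilon>(1) by (simp add: q_def E_def)
  have qF: "q x \<in> F" for x
    unfolding q_def P_def F_def
  proof (intro span_scale span_sum)
    show "u \<in> span (e ` {..<m})" if "u \<in> K" for u using that K(1) by (auto simp: B_def F_def)
  qed
  have q_near: "norm (q x - x) \<le> 3 * \<epsilon>" if x: "x \<in> E" for x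
  proof -
    have Sx: "S x > 0" using x \<epsilon>(1) by (simp add: E_def)
    have "S x *\<^sub>R (q x - x) = (\<Sum>u\<in>K. \<phi> u x *\<^sub>R (u - x))"
      using qS[OF x] by (simp add: scaleR_diff_right sum_subtractf P_def S_def scaleR_sum_left)
    then have "S x * norm (q x - x) = norm (\<Sum>u\<in>K. \<phi> u x *\<^sub>R (u - x))"
      using Sx by (metis abs_of_pos norm_scaleR)
    also have "\<dots> \<le> (\<Sum>u\<in>K. \<phi> u x * (3 * \<epsilon>))"
    proof (rule sum_norm_le)
      fix u assume "u \<in> K"
      show "norm (\<phi> u x *\<^sub>R (u - x)) \<le> \<phi> u x * (3 * \<epsilon>)"
      proof (cases "dist x u \<le> 3 * \<epsilon>")
        case True
        then have "\<phi> u x * norm (u - x) \<le> \<phi> u x * (3 * \<epsilon>)"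
          using \<phi>0 by (intro mult_left_mono) (simp_all add: dist_norm norm_minus_commute)
        then show ?thesis using \<phi>0[of u x] by simp
      qed (simp add: \<phi>_def)
    qed
    also have "\<dots> = S x * (3 * \<epsilon>)" by (simp add: S_def sum_distrib_right)
    finally show ?thesis using Sx by simp
  qed
  \<comment> \<open>The difference of \<open>P\<close> and the term
    \<open>(S y - S x) *\<^sub>R q y\<close> each contribute \<open>5 * \<epsilon>\<close> for every
    point of \<open>K\<close>; division by \<open>S x\<close>, which is at least
    \<open>\<epsilon>\<close>, leaves 10.\<close>
  define Lq where "Lq = 10 * real (card K)"
  have Lq: "Lq \<ge> 0" by (simp add: Lq_def)
  have q_lip: "dist (q x) (q y) \<le> Lq * dist x y" if x: "x \<in> E" and y: "y \<in> E" for x y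
  proof -
    have Sx: "S x \<ge> \<epsilon>" "S y > 0" using x y \<epsilon>(1) by (auto simp: E_def)
    have \<phi>l: "\<bar>\<phi> u x - \<phi> u y\<bar> \<le> dist x y" for u
    proof -
      have "\<bar>\<phi> u x - \<phi> u y\<bar> \<le> \<bar>dist y u - dist x u\<bar>" unfolding \<phi>_def by (auto simp: max_def)
      also have "\<dots> \<le> dist x y"
        using dist_triangle[of y u x] dist_triangle[of x u y] by (simp add: dist_commute abs_le_iff)
      finally show ?thesis .
    qed
    have PP: "norm (P x - P y) \<le> real (card K) * (5 * \<epsilon> * dist x y)"
    proof -
      have "P x - P y = (\<Sum>u\<in>K. (\<phi> u x - \<phi> u y) *\<^sub>R u)"
        by (simp add: P_def sum_subtractf scaleR_left_diff_distrib)
      also have "norm \<dots> \<le> (\<Sum>u\<in>K. 5 * \<epsilon> * dist x y)"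
      proof (rule sum_norm_le)
        fix u assume "u \<in> K"
        then have "\<bar>\<phi> u x - \<phi> u y\<bar> * norm u \<le> dist x y * (5 * \<epsilon>)"
          using \<phi>l[of u] Kn by (intro mult_mono) auto
        then show "norm ((\<phi> u x - \<phi> u y) *\<^sub>R u) \<le> 5 * \<epsilon> * dist x y" by (simp add: mult.commute)
      qed
      finally show ?thesis by simp
    qed
    have SS: "\<bar>S y - S x\<bar> \<le> real (card K) * dist x y"
    proof -
      have "S y - S x = (\<Sum>u\<in>K. \<phi> u y - \<phi> u x)" by (simp add: S_def sum_subtractf)
      also have "\<bar>\<dots>\<bar> \<le> (\<Sum>u\<in>K. dist x y)"
        using \<phi>l by (intro order_trans[OF sum_abs] sum_mono) (simp add: abs_minus_commute)
      finally show ?thesis by simp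
    qed
    have qn: "norm (q y) \<le> 5 * \<epsilon>"
    proof -
      have "norm (P y) \<le> (\<Sum>u\<in>K. \<phi> u y * (5 * \<epsilon>))"
        unfolding P_def
      proof (rule sum_norm_le)
        fix u assume "u \<in> K"
        then show "norm (\<phi> u y *\<^sub>R u) \<le> \<phi> u y * (5 * \<epsilon>)"
          using \<phi>0[of u y] Kn[of u] by (simp add: mult_left_mono)
      qed
      also have "\<dots> = S y * (5 * \<epsilon>)" by (simp add: S_def sum_distrib_right)
      finally have "S y * norm (q y) \<le> S y * (5 * \<epsilon>)"
        using qS[OF y] Sx(2) by (metis abs_of_pos norm_scaleR)
      then show ?thesis using Sx(2) by simp
    qed
    have "S x *\<^sub>R (q x - q y) = (P x - P y) + (S y - S x) *\<^sub>R q y"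
      using qS[OF x] qS[OF y] by (simp add: algebra_simps)
    then have "S x * norm (q x - q y) \<le> norm (P x - P y) + \<bar>S y - S x\<bar> * norm (q y)"
      using Sx(1) \<epsilon>(1) by (metis abs_of_pos less_le_trans norm_scaleR norm_triangle_ineq real_norm_def)
    also have "\<dots> \<le> real (card K) * (5 * \<epsilon> * dist x y) + (real (card K) * dist x y) * (5 * \<epsilon>)"
      using PP SS qn by (intro add_mono mult_mono) auto
    also have "\<dots> = \<epsilon> * (Lq * dist x y)" by (simp add: Lq_def)
    finally have "S x * norm (q x - q y) \<le> \<epsilon> * (Lq * dist x y)" .
    moreover have "\<epsilon> * norm (q x - q y) \<le> S x * norm (q x - q y)" using Sx(1) by (intro mult_right_mono) auto
    ultimately have "\<epsilon> * norm (q x - q y) \<le> \<epsilon> * (Lq * dist x y)" by linarith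
    then show ?thesis using \<epsilon>(1) by (simp add: dist_norm)
  qed
  have qc: "continuous_on E q"
  proof (rule lipschitz_on_continuous_on)
    show "Lq-lipschitz_on E q" using q_lip Lq by (rule lipschitz_onI)
  qed

  have hit: "\<exists>z\<in>B. norm (q (f z) - y) \<le> \<eta>" if y: "y \<in> F" "norm y \<le> \<epsilon>" and \<eta>: "\<eta> > 0" for y \<eta>
  proof -
    \<comment> \<open>Fixed points of \<open>\<Psi>\<close> are the solutions of
      \<open>q (f z) = y\<close>, and approximate ones solve it with the same error.\<close>
    define \<Psi> where "\<Psi> z = z - q (f z) + y" for z
    have c: "continuous_on B (\<lambda>z. q (f z))"
      using fE continuous_on_subset[OF fcont subset_UNIV] by (intro continuous_on_compose2[OF qc]) auto
    have "\<exists>z\<in>F. norm z \<le> 5 * \<epsilon> \<and> norm (\<Psi> z - z) \<le> \<eta>"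
      unfolding F_def
    proof (rule ball_approximate_fixed_point[OF \<kappa>])
      show "5 * \<epsilon> > 0" "\<eta> > 0" using \<epsilon> \<eta> by auto
      show "continuous_on (span (e ` {..<m}) \<inter> cball 0 (5 * \<epsilon>)) \<Psi>"
        unfolding \<Psi>_def using c by (intro continuous_intros) (simp add: B_def F_def)
      fix z assume "z \<in> span (e ` {..<m})" "norm z \<le> 5 * \<epsilon>"
      then have z: "z \<in> B" by (simp add: B_def F_def)
      have "\<Psi> z \<in> span (e ` {..<m})"
        unfolding \<Psi>_def using z qF[of "f z"] y(1) by (intro span_add span_diff) (auto simp: B_def F_def)
      moreover have "\<Psi> z = y - ((q (f z) - f z) + (f z - z))" by (simp add: \<Psi>_def)
      then have "norm (\<Psi> z) \<le> norm y + (norm (q (f z) - f z) + norm (f z - z))"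
        by (metis norm_triangle_ineq norm_triangle_ineq4 add_left_mono order_trans)
      then have "norm (\<Psi> z) \<le> 5 * \<epsilon>" using y(2) q_near[OF fE[OF z]] fz[OF z] by linarith
      ultimately show "\<Psi> z \<in> span (e ` {..<m}) \<and> norm (\<Psi> z) \<le> 5 * \<epsilon>" by blast
    qed
    then obtain z where z: "z \<in> F" "norm z \<le> 5 * \<epsilon>" "norm (\<Psi> z - z) \<le> \<eta>" by blast
    have "norm (q (f z) - y) \<le> \<eta>" using z(3) by (simp add: \<Psi>_def norm_minus_commute)
    then show ?thesis using z by (intro bexI[of _ z]) (auto simp: B_def)
  qed

  \<comment> \<open>The side of the grid in coordinates, small enough for all grid points to have
    norm at most \<open>\<epsilon>\<close>.\<close>
  define \<sigma> where "\<sigma> = \<epsilon> / ((\<Sum>i<m. norm (e i)) + 1)"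
  have se: "(\<Sum>i<m. norm (e i)) \<ge> 0" by (intro sum_nonneg) auto
  have \<sigma>: "\<sigma> > 0" using \<epsilon>(1) se by (simp add: \<sigma>_def)
  have \<sigma>\<epsilon>: "\<sigma> * (\<Sum>i<m. norm (e i)) \<le> \<epsilon>"
  proof -
    have "\<sigma> * (\<Sum>i<m. norm (e i)) \<le> \<sigma> * ((\<Sum>i<m. norm (e i)) + 1)" using \<sigma> by simp
    also have "\<dots> = \<epsilon>" using se by (simp add: \<sigma>_def)
    finally show ?thesis .
  qed
  \<comment> \<open>Cells will have side \<open>1 / Q\<close> with \<open>Q = N * Q0\<close>, and
    \<open>\<eta>\<close> will be proportional to \<open>1 / N\<close>; this choice gives
    \<open>Q * (2 * \<eta>) = Lq * W + 1\<close>. As \<open>Q0\<close> and \<open>p\<close> do not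
    involve \<open>N\<close>, the latter can be taken large afterwards.\<close>
  define Q0 where "Q0 = 2 * (\<kappa> + 1) * (Lq * W + 1) / \<sigma>"
  have LW: "Lq * W \<ge> 0" using Lq W(1) by simp
  have Q0: "Q0 > 0" unfolding Q0_def using \<kappa>(1) \<sigma> LW by (intro divide_pos_pos mult_pos_pos) auto
  obtain p1 :: nat where p1: "L0 * Q0 < real p1" using reals_Archimedean2 by blast
  define p where "p = max p1 1"
  have p: "p \<ge> 1" "L0 * Q0 \<le> real p" using p1 by (auto simp: p_def)
  define N where "N = card D * (3 * p) ^ n + 1"
  have "N > 0" unfolding N_def by simp
  then have N: "N > card D * (3 * p) ^ n" "real N > 0" by (simp add: N_def, simp only: of_nat_0_less_iff)
  \<comment> \<open>Grid points with the same cell are closer than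
    \<open>\<eta> + 2 * \<eta> + \<eta>\<close>. Distinct ones differ by at least
    \<open>\<sigma> / N\<close> in some coordinate, hence by at least \<open>4 * \<eta>\<close> in
    norm.\<close>
  define \<eta> where "\<eta> = \<sigma> / (4 * real N * (\<kappa> + 1))"
  have \<eta>: "\<eta> > 0" using \<sigma> N(2) \<kappa>(1) by (simp add: \<eta>_def)
  define y where "y a = (\<Sum>i<m. (\<sigma> * real (a i) / real N) *\<^sub>R e i)" for a :: "nat \<Rightarrow> nat"
  let ?A = "{..<m} \<rightarrow>\<^sub>E {..<N}"
  have "\<exists>z\<in>B. norm (q (f z) - y a) \<le> \<eta>" if a: "a \<in> ?A" for a
  proof (rule hit[OF _ _ \<eta>])
    show "y a \<in> F" unfolding y_def F_def by (rule combination_in_span)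
    have "norm (y a) \<le> \<sigma> * (\<Sum>i<m. norm (e i))"
      unfolding y_def
    proof (rule norm_combination_le)
      fix i assume "i < m"
      then have "a i < N" using a by (meson PiE_mem lessThan_iff)
      then have "real (a i) / real N \<le> 1" by simp
      then have "\<sigma> * (real (a i) / real N) \<le> \<sigma> * 1" using \<sigma> by (intro mult_left_mono) auto
      then show "\<bar>\<sigma> * real (a i) / real N\<bar> \<le> \<sigma>" using \<sigma> by simp
    qed
    then show "norm (y a) \<le> \<epsilon>" using \<sigma>\<epsilon> by simp
  qed
  then obtain z where z: "\<And>a. a \<in> ?A \<Longrightarrow> z a \<in> B" "\<And>a. a \<in> ?A \<Longrightarrow> norm (q (f (z a)) - y a) \<le> \<eta>"
    by metis
  have "\<forall>a\<in>?A. \<exists>s. fst s \<in> D \<and> (\<forall>k<n. \<bar>snd s k\<bar> \<le> L0) \<and> f (z a) = (\<Sum>k<n. snd s k *\<^sub>R w (fst s) k)"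
  proof
    fix a assume "a \<in> ?A"
    from rep[OF z(1)[OF this]] obtain d t where
      "d \<in> D" "\<forall>k<n. \<bar>t k\<bar> \<le> L0" "f (z a) = (\<Sum>k<n. t k *\<^sub>R w d k)"
      by blast
    then show "\<exists>s. fst s \<in> D \<and> (\<forall>k<n. \<bar>snd s k\<bar> \<le> L0) \<and> f (z a) = (\<Sum>k<n. snd s k *\<^sub>R w (fst s) k)"
      by (intro exI[of _ "(d, t)"]) simp
  qed
  from bchoice[OF this] obtain s where s: "\<forall>a\<in>?A. fst (s a) \<in> D \<and> (\<forall>k<n. \<bar>snd (s a) k\<bar> \<le> L0) \<and>
      f (z a) = (\<Sum>k<n. snd (s a) k *\<^sub>R w (fst (s a)) k)"
    by blast
  define d where "d a = fst (s a)" for a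
  define t where "t a = snd (s a)" for a
  have dt: "d a \<in> D" "k < n \<Longrightarrow> \<bar>t a k\<bar> \<le> L0" "f (z a) = (\<Sum>k<n. t a k *\<^sub>R w (d a) k)"
    if "a \<in> ?A" for a k
    using s[rule_format, OF that] by (simp_all add: d_def t_def)
  define Q where "Q = real N * Q0"
  have Q: "Q > 0" using Q0 N(2) by (simp add: Q_def)
  define cell where "cell a = (d a, \<lambda>k\<in>{..<n}. \<lfloor>t a k * Q\<rfloor>)" for a
  have cells: "fst (cell a) \<in> D \<and> snd (cell a) \<in> {..<n} \<rightarrow>\<^sub>E {- int (N * p)..int (N * p)}"
    if a: "a \<in> {..<Suc n} \<rightarrow>\<^sub>E {..<N}" for a
  proof -
    have a': "a \<in> ?A" using a by (simp add: m_def)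
    have "\<lfloor>t a k * Q\<rfloor> \<in> {- int (N * p)..int (N * p)}" if k: "k < n" for k
    proof -
      have "\<bar>t a k * Q\<bar> \<le> L0 * Q" using dt(2)[OF a' k] Q by (simp add: abs_mult mult_right_mono)
      also have "\<dots> = real N * (L0 * Q0)" by (simp add: Q_def)
      also have "\<dots> \<le> real N * real p" using p(2) by (intro mult_left_mono) auto
      finally have *: "\<bar>t a k * Q\<bar> \<le> real_of_int (int (N * p))" by simp
      then have "- int (N * p) \<le> \<lfloor>t a k * Q\<rfloor>" by (simp add: le_floor_iff abs_le_iff)
      moreover have "\<lfloor>t a k * Q\<rfloor> \<le> int (N * p)"
      proof -
        have "\<lfloor>t a k * Q\<rfloor> \<le> \<lfloor>real_of_int (int (N * p))\<rfloor>" using * by (intro floor_mono) (simp add: abs_le_iff)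
        then show ?thesis by (simp only: floor_of_int)
      qed
      ultimately show ?thesis by simp
    qed
    then show ?thesis using dt(1)[OF a'] by (auto simp: cell_def)
  qed
  have "\<exists>a b. a \<in> ?A \<and> b \<in> ?A \<and> a \<noteq> b \<and> cell a = cell b"
    unfolding m_def by (rule grid_pigeonhole[OF D(1) N(1) p(1)]) (rule cells)
  then obtain a b where ab: "a \<in> ?A" "b \<in> ?A" "a \<noteq> b" "cell a = cell b"
    by (elim exE conjE)
  have dab: "d a = d b" using ab(4) by (simp add: cell_def)
  have tab: "\<bar>t a k - t b k\<bar> \<le> 1 / Q" if k: "k < n" for k
  proof -
    have "snd (cell a) k = snd (cell b) k" using ab(4) by (rule arg_cong)
    then have "\<lfloor>t a k * Q\<rfloor> = \<lfloor>t b k * Q\<rfloor>" using k by (simp add: cell_def)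
    then have "\<bar>t a k * Q - t b k * Q\<bar> \<le> 1" by linarith
    then have "\<bar>t a k - t b k\<bar> * Q \<le> 1" using Q by (simp add: abs_mult flip: left_diff_distrib)
    then show ?thesis using Q by (simp add: pos_le_divide_eq)
  qed
  have "f (z a) - f (z b) = (\<Sum>k<n. (t a k - t b k) *\<^sub>R w (d a) k)"
    using dt(3)[OF ab(1)] dt(3)[OF ab(2)] dab by (simp add: sum_subtractf scaleR_left_diff_distrib)
  also have "norm \<dots> \<le> 1 / Q * (\<Sum>k<n. norm (w (d a) k))" by (rule norm_combination_le[OF tab])
  also have "\<dots> \<le> 1 / Q * W" using Q W(2)[OF dt(1)[OF ab(1)]] by (intro mult_left_mono) auto
  finally have fab: "dist (f (z a)) (f (z b)) \<le> W / Q" by (simp add: dist_norm)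
  have "dist (q (f (z a))) (q (f (z b))) \<le> Lq * dist (f (z a)) (f (z b))"
    using q_lip fE z(1) ab by blast
  also have "\<dots> \<le> Lq * (W / Q)" using fab Lq by (rule mult_left_mono)
  also have "\<dots> < 2 * \<eta>"
  proof -
    have "Lq * W * \<sigma> < (Lq * W + 1) * \<sigma>" using \<sigma> by simp
    then have "Lq * (W / Q) < (Lq * W + 1) / Q" using Q by (simp add: divide_strict_right_mono)
    also have "\<dots> = 2 * \<eta>"
    proof -
      have "Q * (2 * \<eta>) = Lq * W + 1"
        unfolding Q_def Q0_def \<eta>_def using N(2) \<sigma> \<kappa>(1) by (simp add: divide_simps)
      then show ?thesis using Q by (simp add: divide_eq_eq mult.commute)
    qed
    finally show ?thesis .
  qed
  finally have qq: "dist (q (f (z a))) (q (f (z b))) < 2 * \<eta>" .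
  have "dist (y a) (y b) \<le> norm (q (f (z a)) - y a) + dist (q (f (z a))) (q (f (z b))) + norm (q (f (z b)) - y b)"
    using dist_triangle3[of "y a" "y b" "q (f (z a))"] dist_triangle[of "q (f (z a))" "y b" "q (f (z b))"]
    by (simp add: dist_norm)
  then have yab: "dist (y a) (y b) < 4 * \<eta>" using z(2)[OF ab(1)] z(2)[OF ab(2)] qq by linarith
  obtain i where i: "i < m" "a i \<noteq> b i" using ab(1-3) by (metis PiE_ext lessThan_iff)
  have "y a - y b = (\<Sum>i<m. (\<sigma> * (real (a i) - real (b i)) / real N) *\<^sub>R e i)"
    by (simp add: y_def right_diff_distrib diff_divide_distrib scaleR_left_diff_distrib sum_subtractf)
  then have "\<bar>\<sigma> * (real (a i) - real (b i)) / real N\<bar> \<le> \<kappa> * dist (y a) (y b)"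
    using \<kappa>(2)[OF i(1), of "\<lambda>i. \<sigma> * (real (a i) - real (b i)) / real N"] by (simp add: dist_norm)
  moreover have "\<sigma> / real N \<le> \<bar>\<sigma> * (real (a i) - real (b i)) / real N\<bar>"
  proof -
    have "1 \<le> \<bar>real (a i) - real (b i)\<bar>" using i(2) by linarith
    then have "\<sigma> * 1 \<le> \<sigma> * \<bar>real (a i) - real (b i)\<bar>" using \<sigma> by (intro mult_left_mono) auto
    then show ?thesis using \<sigma> by (simp add: abs_mult divide_right_mono)
  qed
  moreover have "\<kappa> * dist (y a) (y b) \<le> (\<kappa> + 1) * dist (y a) (y b)" by (simp add: mult_right_mono)
  moreover have "(\<kappa> + 1) * dist (y a) (y b) < (\<kappa> + 1) * (4 * \<eta>)"
    using yab \<kappa>(1) by (intro mult_strict_left_mono) auto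
  moreover have "(\<kappa> + 1) * (4 * \<eta>) = \<sigma> / real N"
    unfolding \<eta>_def using \<kappa>(1) N(2) by (simp add: divide_simps)
  ultimately show False by linarith
qed

lemma no_small_set:
  fixes X :: "'e::real_normed_vector set"
  assumes inf: "infinite_dimensional (UNIV :: 'e set)" and X: "open X"
  shows "\<not> small_set (top_of_set X) (G_on X) U"
proof
  assume small: "small_set (top_of_set X) (G_on X) U"
  then have U: "U \<noteq> {}" "open U" "U \<subseteq> X"
    using X openin_open_eq[OF X] unfolding small_set_def by auto
  then obtain c R where c: "R > 0" "ball c R \<subseteq> U" by (meson all_not_in_conv openE)
  let ?V = "ball c (R / 10)"
  have "?V \<subseteq> U" using c subset_ball[of "R / 10" R c] by auto
  then have "?V \<noteq> {} \<and> openin (top_of_set X) ?V \<and> ?V \<subseteq> U"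
    using c(1) U(3) openin_open_eq[OF X] by auto
  then obtain g where g: "g \<in> G_on X" "g ` U \<subseteq> ?V" using small unfolding small_set_def by blast
  then obtain h where h: "g = restrict h X" "h \<in> G_whole" unfolding G_on_def by blast
  obtain n where n: "h \<in> carrier (homeo_group euclidean)" "finite_rank_displacement n h"
    using G_whole_finite_rank_displacement[OF h(2)] by blast
  have "continuous_on UNIV h"
    using n(1) homeomorphic_imp_continuous_map[of euclidean euclidean h] by (simp add: carrier_homeo_group)
  moreover have "h ` ball c R \<subseteq> ?V"
  proof
    fix z assume "z \<in> h ` ball c R"
    then obtain x where x: "x \<in> U" "z = h x" using c(2) by blast
    then have "z = g x" using h(1) U(3) by auto
    then show "z \<in> ?V" using g(2) x(1) by blast
  qed
  ultimately show False using finite_rank_displacement_nonshrinking[OF inf n(2) _ c(1)] by blast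
qed

theorem theoremC:
  shows "(\<forall>X :: 'e::real_normed_vector set.
            infinite_dimensional (UNIV :: 'e set) \<and> open X \<and> X \<noteq> {} \<longrightarrow>
              \<not> (\<exists>U. small_set (top_of_set X) (G_on X) U))
       \<and> faithful_between
            (K_NSML :: ('a::real_normed_vector topology \<times> ('a \<Rightarrow> 'a) set) set)
            (K_NSML :: ('b::real_normed_vector topology \<times> ('b \<Rightarrow> 'b) set) set)"
proof (intro conjI allI impI)
  fix X :: "'e set"
  assume X: "infinite_dimensional (UNIV :: 'e set) \<and> open X \<and> X \<noteq> {}"
  show "\<not> (\<exists>U. small_set (top_of_set X) (G_on X) U)"
    using no_small_set[of X] X by blast
qed (rule K_NSML_faithful)

end
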